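(* For every $r>0$, the set $$\mathcal{E}_r^H:=\Big\{\Big(0,\tfrac{1}{\nu}(-\partial_{x_1}^2)^{-1}\theta^H\Big)\in\mathcal{H}:\ \theta^H\in L^2_{0,H},\ \|\theta^H\|_2\le r\Big\}$$ is an infinite-dimensional Hilbert ellipsoid in $\mathcal{H}$ and satisfies $$\mathcal{E}_r^H\subset P_u\mathcal{A}_r,$$ where $P_u(u,\theta):=u$ and $\mathcal{A}_r$ is the local attractor at level $r$ of the Boussinesq system with viscosity $\nu>0$ and without heat diffusion.
   Context: Let $L>0$, $\Omega=\mathbb{T}^2=\mathbb{R}^2/(L\mathbb{Z}^2)$, $\nu>0$, $e_2=(0,1)^T$. All functions are real, periodic and mean-free: $L^2$ denotes the space of scalar functions in $L^2(\Omega)$ with zero average, with norm $\|\cdot\|_2$. $\mathcal{H}$ and $V$ are the closures, in $L^2(\Omega)^2$ and $H^1(\Omega)^2$ respectively, of the divergence-free zero-average vector-valued trigonometric polynomials on $\Omega$. $\lambda_1>0$ is the smallest eigenvalue of the Stokes operator $A=-P_\sigma\Delta$ ($=-\Delta$) on $\mathcal{H}$, $P_\sigma$ being the Leray–Helmholtz projection. The Boussinesq system is $$\partial_t u+(u\cdot\nabla)u+\nabla p-\nu\Delta u=\theta e_2,\quad \partial_t\theta+u\cdot\nabla\theta=0,\quad \nabla\cdot u=0\quad\text{in }\Omega\times\mathbb{R}_+,\qquad (u,\theta)(\cdot,0)=(u_0,\theta_0).$$ A solution with data $(u_0,\theta_0)\in\mathcal{H}\times L^2$ is a pair with $(u(t),\theta(t))\in\mathcal{H}\times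 L^2$ for all $t$ such that, for every $T>0$, $$-\int_0^T\langle u,\Phi'\rangle ds+\int_0^T\langle (u\cdot\nabla)u,\Phi\rangle ds-\langle u_0,\Phi(\cdot,0)\rangle=-\nu\int_0^T\langle\nabla u,\nabla\Phi\rangle ds+\int_0^T\langle\theta e_2,\Phi\rangle ds,$$ $$-\int_0^T\langle\theta,\phi'\rangle ds+\int_0^T\langle u\cdot\nabla\theta,\phi\rangle ds=\langle\theta_0,\phi(\cdot,0)\rangle$$ for all mean-free periodic $\phi\in C^\infty(\Omega\times[0,T])$ with $\phi(\cdot,T)=0$ and all mean-free periodic divergence-free $\Phi\in C^\infty(\Omega\times[0,T])^2$ with $\Phi(\cdot,T)=0$ (here $\langle u\cdot\nabla\theta,\phi\rangle=-\langle\theta,u\cdot\nabla\phi\rangle$). It is known that for every $(u_0,\theta_0)\in\mathcal{H}\times L^2$ there is a unique solution with $u\in C([0,T];\mathcal{H})\cap L^2(0,T;V)$, $\theta\in C([0,T];L^2)$ for every $T>0$; set $S(t)(u_0,\theta_0):=(u(t),\theta(t))$, $t\ge0$. For $r\ge0$, $\mathcal{B}_r:=\{(u_0,\theta_0)\in\mathcal{H}\times L^2:\|\theta_0\|_2\le r,\ \|u_0\|_2\le 2r/(\nu\lambda_1)\}$ and $$\mathcal{A}_r:=\bigcap_{\tau\ge0}\overline{\{S(t)(u_0,\theta_0):t>\tau,\ (u_0,\theta_0)\in\mathcal{B}_r\}}^{wk},$$ the closure being in the weak topology of $\mathcal{H}\times L^2$. $L^2_{0,H}$ is the space of zero-mean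 $L^2$ functions on $\Omega$ depending only on the horizontal variable $x_1$; for $\theta^H\in L^2_{0,H}$, $(-\partial_{x_1}^2)^{-1}\theta^H$ is the unique mean-free periodic function $w=w(x_1)$ with $-w''=\theta^H$. An infinite-dimensional Hilbert ellipsoid in $\mathcal{H}$ is a set of the form $\{\sum_{n\ge1}c_nf_n:\sum_{n\ge1}c_n^2/\alpha_n^2\le1\}$ with $(f_n)_{n\ge1}$ an (infinite) orthonormal sequence in $\mathcal{H}$ and semi-axes $\alpha_n>0$, $\alpha_n\to 0$. *)

theory Defs
  imports "HOL-Analysis.Analysis"
begin

text \<open>
  Elements of the spaces below are represented by Borel functions on the plane that are
  \<open>L\<close>-periodic in both variables; two functions represent the same element iff they agree almost
  everywhere. Every set of functions that stands for a subset of such a space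
  (phase space, flow, attractor, ellipsoid) is closed under almost-everywhere equality.
\<close>

section \<open>Function spaces on the torus\<close>

definition cell :: "real \<Rightarrow> (real \<times> real) set" where
  "cell L = {0..L} \<times> {0..L}"

definition periodic :: "real \<Rightarrow> (real \<times> real \<Rightarrow> 'b) \<Rightarrow> bool" where
  "periodic L f \<longleftrightarrow> (\<forall>x. f (x + (L, 0)) = f x \<and> f (x + (0, L)) = f x)"

definition mean_free :: "real \<Rightarrow> (real \<times> real \<Rightarrow> 'b::euclidean_space) \<Rightarrow> bool" where
  "mean_free L f \<longleftrightarrow> (LINT x:cell L|lborel. f x) = 0"

definition l2_inner ::
    "real \<Rightarrow> (real \<times> real \<Rightarrow> 'b::euclidean_space) \<Rightarrow> (real \<times> real \<Rightarrow> 'b) \<Rightarrow> real" where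
  "l2_inner L f g = (LINT x:cell L|lborel. f x \<bullet> g x)"

definition l2_norm :: "real \<Rightarrow> (real \<times> real \<Rightarrow> 'b::euclidean_space) \<Rightarrow> real" where
  "l2_norm L f = sqrt (l2_inner L f f)"

definition ae_eq :: "(real \<times> real \<Rightarrow> 'b) \<Rightarrow> (real \<times> real \<Rightarrow> 'b) \<Rightarrow> bool" where
  "ae_eq f g \<longleftrightarrow> (AE x in lborel. f x = g x)"

definition L2 :: "real \<Rightarrow> (real \<times> real \<Rightarrow> 'b::euclidean_space) set" where
  "L2 L = {f. f \<in> borel_measurable borel \<and> periodic L f
              \<and> set_integrable lborel (cell L) (\<lambda>x. (norm (f x))\<^sup>2)}"

definition L2_0 :: "real \<Rightarrow> (real \<times> real \<Rightarrow> real) set" where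
  "L2_0 L = {f \<in> L2 L. mean_free L f}"

text \<open>
  At boundary points of \<open>S\<close> derivatives are taken within \<open>S\<close>. This is used only for the whole
  space and for slabs \<open>{0..T} \<times> UNIV\<close> with \<open>T > 0\<close>, where such derivatives are unique.
\<close>

primrec Ck_on :: "nat \<Rightarrow> 'a::euclidean_space set \<Rightarrow> ('a \<Rightarrow> 'b::euclidean_space) \<Rightarrow> bool" where
  "Ck_on 0 S f \<longleftrightarrow> continuous_on S f"
| "Ck_on (Suc k) S f \<longleftrightarrow>
     (\<forall>x\<in>S. f differentiable (at x within S))
     \<and> (\<forall>b\<in>Basis. Ck_on k S (\<lambda>x. frechet_derivative f (at x within S) b))"

definition Cinf_on :: "'a::euclidean_space set \<Rightarrow> ('a \<Rightarrow> 'b::euclidean_space) \<Rightarrow> bool" where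
  "Cinf_on S f \<longleftrightarrow> (\<forall>k. Ck_on k S f)"

definition pd ::
    "real \<times> real \<Rightarrow> (real \<times> real \<Rightarrow> 'b::euclidean_space) \<Rightarrow> real \<times> real \<Rightarrow> 'b" where
  "pd b f x = frechet_derivative f (at x) b"

definition divergence :: "(real \<times> real \<Rightarrow> real \<times> real) \<Rightarrow> real \<times> real \<Rightarrow> real" where
  "divergence u x = (\<Sum>b\<in>Basis. pd b u x \<bullet> b)"

definition has_weak_pd ::
    "real \<Rightarrow> real \<times> real \<Rightarrow> (real \<times> real \<Rightarrow> 'b::euclidean_space) \<Rightarrow> (real \<times> real \<Rightarrow> 'b) \<Rightarrow> bool" where
  "has_weak_pd L b f g \<longleftrightarrow>
     (\<forall>\<phi> :: real \<times> real \<Rightarrow> real. Cinf_on UNIV \<phi> \<and> periodic L \<phi> \<longrightarrow>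
        (LINT x:cell L|lborel. pd b \<phi> x *\<^sub>R f x) = - (LINT x:cell L|lborel. \<phi> x *\<^sub>R g x))"

text \<open>The weak derivative is unique only almost everywhere, hence the choice operator.\<close>

definition wpd ::
    "real \<Rightarrow> real \<times> real \<Rightarrow> (real \<times> real \<Rightarrow> 'b::euclidean_space) \<Rightarrow> real \<times> real \<Rightarrow> 'b" where
  "wpd L b f = (SOME g. g \<in> L2 L \<and> has_weak_pd L b f g)"

definition H1 :: "real \<Rightarrow> (real \<times> real \<Rightarrow> 'b::euclidean_space) set" where
  "H1 L = {f \<in> L2 L. \<forall>b\<in>Basis. \<exists>g\<in>L2 L. has_weak_pd L b f g}"

definition grad_norm_sq :: "real \<Rightarrow> (real \<times> real \<Rightarrow> 'b::euclidean_space) \<Rightarrow> real" where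
  "grad_norm_sq L f = (\<Sum>b\<in>Basis. (l2_norm L (wpd L b f))\<^sup>2)"

definition h1_norm :: "real \<Rightarrow> (real \<times> real \<Rightarrow> 'b::euclidean_space) \<Rightarrow> real" where
  "h1_norm L f = sqrt ((l2_norm L f)\<^sup>2 + grad_norm_sq L f)"

definition trig_poly :: "real \<Rightarrow> (real \<times> real \<Rightarrow> real \<times> real) \<Rightarrow> bool" where
  "trig_poly L p \<longleftrightarrow>
     (\<exists>(K :: (int \<times> int) set) a b. finite K \<and>
        p = (\<lambda>x. \<Sum>k\<in>K.
               cos (2 * pi / L * (real_of_int (fst k) * fst x + real_of_int (snd k) * snd x)) *\<^sub>R a k
             + sin (2 * pi / L * (real_of_int (fst k) * fst x + real_of_int (snd k) * snd x)) *\<^sub>R b k))"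

definition solenoidal_trig :: "real \<Rightarrow> (real \<times> real \<Rightarrow> real \<times> real) set" where
  "solenoidal_trig L = {p. trig_poly L p \<and> (\<forall>x. divergence p x = 0) \<and> mean_free L p}"

definition Hsp :: "real \<Rightarrow> (real \<times> real \<Rightarrow> real \<times> real) set" where
  "Hsp L = {u \<in> L2 L. \<forall>\<epsilon>>0. \<exists>p\<in>solenoidal_trig L. l2_norm L (\<lambda>x. u x - p x) < \<epsilon>}"

definition Vsp :: "real \<Rightarrow> (real \<times> real \<Rightarrow> real \<times> real) set" where
  "Vsp L = {u \<in> H1 L. \<forall>\<epsilon>>0. \<exists>p\<in>solenoidal_trig L. h1_norm L (\<lambda>x. u x - p x) < \<epsilon>}"


section \<open>The Stokes operator\<close>

definition leray_projection ::
    "real \<Rightarrow> (real \<times> real \<Rightarrow> real \<times> real) \<Rightarrow> (real \<times> real \<Rightarrow> real \<times> real) \<Rightarrow> bool" where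
  "leray_projection L f g \<longleftrightarrow> g \<in> Hsp L \<and> (\<forall>v\<in>Hsp L. l2_inner L (\<lambda>x. f x - g x) v = 0)"

definition weak_laplacian ::
    "real \<Rightarrow> (real \<times> real \<Rightarrow> real \<times> real) \<Rightarrow> real \<times> real \<Rightarrow> real \<times> real" where
  "weak_laplacian L u x = (\<Sum>b\<in>Basis. wpd L b (wpd L b u) x)"

definition stokes_domain :: "real \<Rightarrow> (real \<times> real \<Rightarrow> real \<times> real) set" where
  "stokes_domain L = {u \<in> Vsp L. \<forall>b\<in>Basis. wpd L b u \<in> H1 L}"

definition stokes_eigenvalue :: "real \<Rightarrow> real \<Rightarrow> bool" where
  "stokes_eigenvalue L l \<longleftrightarrow>
     (\<exists>u\<in>stokes_domain L. l2_norm L u \<noteq> 0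
        \<and> leray_projection L (\<lambda>x. - weak_laplacian L u x) (\<lambda>x. l *\<^sub>R u x))"

definition lambda1 :: "real \<Rightarrow> real" where
  "lambda1 L = (LEAST l. stokes_eigenvalue L l)"


section \<open>The Boussinesq system\<close>

definition test_function ::
    "real \<Rightarrow> real \<Rightarrow> (real \<Rightarrow> real \<times> real \<Rightarrow> 'b::euclidean_space) \<Rightarrow> bool" where
  "test_function L T \<phi> \<longleftrightarrow>
     Cinf_on ({0..T} \<times> UNIV) (\<lambda>(t, x). \<phi> t x)
     \<and> (\<forall>t\<in>{0..T}. periodic L (\<phi> t) \<and> mean_free L (\<phi> t))
     \<and> (\<forall>x. \<phi> T x = 0)"

definition time_deriv ::
    "real \<Rightarrow> (real \<Rightarrow> real \<times> real \<Rightarrow> 'b::euclidean_space) \<Rightarrow> real \<Rightarrow> real \<times> real \<Rightarrow> 'b" where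
  "time_deriv T \<phi> t x = vector_derivative (\<lambda>s. \<phi> s x) (at t within {0..T})"

text \<open>
  Time integrals use the completed measure because on the null set of times with
  \<open>u s \<notin> Vsp L\<close> the value \<open>wpd L b (u s)\<close> is arbitrary.
\<close>

definition momentum_eq ::
    "real \<Rightarrow> real \<Rightarrow> (real \<times> real \<Rightarrow> real \<times> real)
     \<Rightarrow> (real \<Rightarrow> real \<times> real \<Rightarrow> real \<times> real) \<Rightarrow> (real \<Rightarrow> real \<times> real \<Rightarrow> real) \<Rightarrow> bool" where
  "momentum_eq L \<nu> u0 u \<theta> \<longleftrightarrow>
     (\<forall>T>0. \<forall>\<Phi> :: real \<Rightarrow> real \<times> real \<Rightarrow> real \<times> real.
        test_function L T \<Phi> \<and> (\<forall>t\<in>{0..T}. \<forall>x. divergence (\<Phi> t) x = 0) \<longrightarrow>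
        - (LINT s:{0..T}|lebesgue. l2_inner L (u s) (time_deriv T \<Phi> s))
        + (LINT s:{0..T}|lebesgue.
             l2_inner L (\<lambda>x. \<Sum>b\<in>Basis. (u s x \<bullet> b) *\<^sub>R wpd L b (u s) x) (\<Phi> s))
        - l2_inner L u0 (\<Phi> 0)
        = - \<nu> * (LINT s:{0..T}|lebesgue. \<Sum>b\<in>Basis. l2_inner L (wpd L b (u s)) (pd b (\<Phi> s)))
          + (LINT s:{0..T}|lebesgue. l2_inner L (\<lambda>x. \<theta> s x *\<^sub>R (0, 1)) (\<Phi> s)))"

definition transport_eq ::
    "real \<Rightarrow> (real \<times> real \<Rightarrow> real)
     \<Rightarrow> (real \<Rightarrow> real \<times> real \<Rightarrow> real \<times> real) \<Rightarrow> (real \<Rightarrow> real \<times> real \<Rightarrow> real) \<Rightarrow> bool" where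
  "transport_eq L \<theta>0 u \<theta> \<longleftrightarrow>
     (\<forall>T>0. \<forall>\<phi> :: real \<Rightarrow> real \<times> real \<Rightarrow> real.
        test_function L T \<phi> \<longrightarrow>
        - (LINT s:{0..T}|lebesgue. l2_inner L (\<theta> s) (time_deriv T \<phi> s))
        + (LINT s:{0..T}|lebesgue.
             - l2_inner L (\<theta> s) (\<lambda>x. \<Sum>b\<in>Basis. (u s x \<bullet> b) * pd b (\<phi> s) x))
        = l2_inner L \<theta>0 (\<phi> 0))"

definition l2_continuous :: "real \<Rightarrow> (real \<Rightarrow> real \<times> real \<Rightarrow> 'b::euclidean_space) \<Rightarrow> bool" where
  "l2_continuous L f \<longleftrightarrow>
     (\<forall>t\<ge>0. ((\<lambda>s. l2_norm L (\<lambda>x. f s x - f t x)) \<longlongrightarrow> 0) (at t within {0..}))"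

text \<open>
  For the membership in the Bochner space \<open>L\<^sup>2(0,T;V)\<close>, strong measurability of \<open>u\<close> as a
  \<open>V\<close>-valued map is not listed, since it follows from continuity into \<open>L\<^sup>2\<close>.
\<close>

definition boussinesq_solution ::
    "real \<Rightarrow> real \<Rightarrow> (real \<times> real \<Rightarrow> real \<times> real) \<times> (real \<times> real \<Rightarrow> real)
     \<Rightarrow> (real \<Rightarrow> real \<times> real \<Rightarrow> real \<times> real) \<Rightarrow> (real \<Rightarrow> real \<times> real \<Rightarrow> real) \<Rightarrow> bool" where
  "boussinesq_solution L \<nu> z0 u \<theta> \<longleftrightarrow>
     (\<forall>t\<ge>0. u t \<in> Hsp L \<and> \<theta> t \<in> L2_0 L)
     \<and> l2_continuous L u \<and> l2_continuous L \<theta>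
     \<and> (\<forall>T>0. (AE t in lebesgue. t \<in> {0..T} \<longrightarrow> u t \<in> Vsp L)
            \<and> set_integrable lebesgue {0..T} (\<lambda>t. (h1_norm L (u t))\<^sup>2))
     \<and> momentum_eq L \<nu> (fst z0) u \<theta> \<and> transport_eq L (snd z0) u \<theta>"

text \<open>
  \<open>S(t)z0\<close> as the set of its representatives: by existence and uniqueness of solutions this is
  exactly one almost-everywhere equivalence class for each \<open>t \<ge> 0\<close> and each \<open>z0\<close> in the phase space.
\<close>

definition boussinesq_flow ::
    "real \<Rightarrow> real \<Rightarrow> real \<Rightarrow> (real \<times> real \<Rightarrow> real \<times> real) \<times> (real \<times> real \<Rightarrow> real)
     \<Rightarrow> ((real \<times> real \<Rightarrow> real \<times> real) \<times> (real \<times> real \<Rightarrow> real)) set" where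
  "boussinesq_flow L \<nu> t z0 = {(u t, \<theta> t) | u \<theta>. boussinesq_solution L \<nu> z0 u \<theta>}"

definition Bset ::
    "real \<Rightarrow> real \<Rightarrow> real \<Rightarrow> ((real \<times> real \<Rightarrow> real \<times> real) \<times> (real \<times> real \<Rightarrow> real)) set" where
  "Bset L \<nu> r = {(u0, \<theta>0). u0 \<in> Hsp L \<and> \<theta>0 \<in> L2_0 L
                   \<and> l2_norm L \<theta>0 \<le> r \<and> l2_norm L u0 \<le> 2 * r / (\<nu> * lambda1 L)}"

definition weak_topology ::
    "real \<Rightarrow> ((real \<times> real \<Rightarrow> real \<times> real) \<times> (real \<times> real \<Rightarrow> real)) topology" where
  "weak_topology L = topology_generated_by
     {{(u, \<theta>). u \<in> Hsp L \<and> \<theta> \<in> L2_0 L \<and> l2_inner L u v + l2_inner L \<theta> \<eta> \<in> U} | v \<eta> U.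
        v \<in> Hsp L \<and> \<eta> \<in> L2_0 L \<and> open U}"

definition local_attractor ::
    "real \<Rightarrow> real \<Rightarrow> real \<Rightarrow> ((real \<times> real \<Rightarrow> real \<times> real) \<times> (real \<times> real \<Rightarrow> real)) set" where
  "local_attractor L \<nu> r =
     (\<Inter>\<tau>\<in>{0..}. weak_topology L closure_of (\<Union>t\<in>{\<tau><..}. \<Union>z0\<in>Bset L \<nu> r. boussinesq_flow L \<nu> t z0))"


section \<open>Horizontal profiles and Hilbert ellipsoids\<close>

definition L2_0H :: "real \<Rightarrow> (real \<times> real \<Rightarrow> real) set" where
  "L2_0H L = {f \<in> L2_0 L. \<exists>g :: real \<Rightarrow> real. ae_eq f (\<lambda>x. g (fst x))}"

text \<open>\<open>inv_neg_d1_sq L \<theta> w\<close>: the function \<open>w\<close> represents \<open>(-\<partial>\<^sub>1\<^sup>2)\<close>-inverse of \<open>\<theta>\<close>.\<close>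

definition inv_neg_d1_sq ::
    "real \<Rightarrow> (real \<times> real \<Rightarrow> real) \<Rightarrow> (real \<times> real \<Rightarrow> real) \<Rightarrow> bool" where
  "inv_neg_d1_sq L \<theta> w \<longleftrightarrow> w \<in> L2_0H L \<and>
     (\<exists>g\<in>L2 L. has_weak_pd L (1, 0) w g \<and> has_weak_pd L (1, 0) g (\<lambda>x. - \<theta> x))"

definition EH :: "real \<Rightarrow> real \<Rightarrow> real \<Rightarrow> (real \<times> real \<Rightarrow> real \<times> real) set" where
  "EH L \<nu> r = {u \<in> L2 L. \<exists>\<theta> w. \<theta> \<in> L2_0H L \<and> l2_norm L \<theta> \<le> r \<and> inv_neg_d1_sq L \<theta> w
                  \<and> ae_eq u (\<lambda>x. (0, 1 / \<nu> * w x))}"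

definition infinite_dim_hilbert_ellipsoid ::
    "real \<Rightarrow> (real \<times> real \<Rightarrow> real \<times> real) set \<Rightarrow> bool" where
  "infinite_dim_hilbert_ellipsoid L E \<longleftrightarrow>
     (\<exists>(f :: nat \<Rightarrow> real \<times> real \<Rightarrow> real \<times> real) (\<alpha> :: nat \<Rightarrow> real).
        (\<forall>n. f n \<in> Hsp L)
        \<and> (\<forall>m n. l2_inner L (f m) (f n) = (if m = n then 1 else 0))
        \<and> (\<forall>n. \<alpha> n > 0) \<and> \<alpha> \<longlonglongrightarrow> 0
        \<and> E = {u \<in> Hsp L. \<exists>c :: nat \<Rightarrow> real.
                 summable (\<lambda>n. (c n)\<^sup>2 / (\<alpha> n)\<^sup>2) \<and> (\<Sum>n. (c n)\<^sup>2 / (\<alpha> n)\<^sup>2) \<le> 1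
                 \<and> (\<lambda>N. l2_norm L (\<lambda>x. u x - (\<Sum>n<N. c n *\<^sub>R f n x))) \<longlonglongrightarrow> 0})"

end

theory Submission
  imports Defs
begin

text \<open>
  A temperature that depends on \<open>x\<^sub>1\<close> only can be balanced exactly by a vertical shear flow. If \<open>-w'' = \<theta>\<close>
  with \<open>\<theta>\<close> and \<open>w\<close> functions of \<open>x\<^sub>1\<close>, then \<open>u = (0, w/\<nu>)\<close> is divergence free, \<open>-\<nu> \<Delta>u = \<theta> e\<^sub>2\<close>, and both
  nonlinear terms vanish because \<open>u\<close> only transports in the direction \<open>x\<^sub>2\<close>, in which \<open>u\<close> and \<open>\<theta>\<close> are
  constant. So \<open>(u, \<theta>)\<close> is a stationary solution without pressure (\<open>stationary_solution\<close>). On mean-free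
  horizontal profiles \<open>-\<Delta>\<close> is at least \<open>(2\<pi>/L)\<^sup>2\<close>, which is also the first Stokes eigenvalue
  (\<open>lambda1_eq\<close>); hence \<open>\<parallel>u\<parallel> \<le> \<parallel>\<theta>\<parallel>/(\<nu>\<lambda>\<^sub>1)\<close>, at most half the bound imposed
  on initial velocities, and the point belongs to the attractor because it equals its own orbit (\<open>profile_in_attractor\<close>).

  That these velocities form an ellipsoid is read off in the Fourier basis of horizontal modes, where
  \<open>\<theta> \<mapsto> (0, w/\<nu>)\<close> is diagonal: it divides the coefficient of wave number \<open>k\<close> by \<open>\<nu>k\<^sup>2\<close>. The ball
  \<open>\<parallel>\<theta>\<parallel> \<le> r\<close> therefore becomes the ellipsoid with semi-axes \<open>r/(\<nu>k\<^sup>2)\<close> (\<open>EH_ellipsoid\<close>).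

  Two analytic facts carry all of this. An integrable function on the torus is determined by its Fourier
  coefficients (\<open>trig_system_complete\<close>); it makes weak derivatives unique, so that the derivative picked by choice in
  the definition of the equations is the expected one (\<open>weak_pd_unique\<close>), it gives the expansion of
  horizontal functions (\<open>horizontal_expansion\<close>), and it excludes Stokes eigenvalues below \<open>(2\<pi>/L)\<^sup>2\<close>.
  The space \<open>L\<^sup>2\<close> is complete (\<open>L2_complete\<close>); it yields the temperature that belongs to prescribed
  coefficients.
\<close>

section \<open>Square-integrable functions on the torus\<close>

lemma compact_cell: "compact (cell L)"
  and cell_sets [measurable]: "cell L \<in> sets borel"
  and emeasure_cell: "emeasure lborel (cell L) < \<infinity>"
proof -
  have c: "cell L = cbox (0,0) (L,L)"
    by (auto simp: cell_def cbox_Pair_eq)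
  show "compact (cell L)" "cell L \<in> sets borel"
      "emeasure lborel (cell L) < \<infinity>"
    by (auto simp: c emeasure_lborel_cbox_eq)
qed

lemma set_integrable_cell_bounded:
  fixes f :: "real \<times> real \<Rightarrow> 'b::euclidean_space"
  assumes [measurable]: "f \<in> borel_measurable borel" and "\<And>x. x \<in> cell L \<Longrightarrow> norm (f x) \<le> B"
  shows "set_integrable lborel (cell L) f"
  unfolding set_integrable_def
  by (rule integrableI_bounded_set[where A="cell L" and B=B])
     (use assms emeasure_cell in \<open>auto simp: indicator_def\<close>)

lemma set_integrable_cell_dominated:
  fixes f :: "real \<times> real \<Rightarrow> 'b::euclidean_space" and g :: "real \<times> real \<Rightarrow> 'c::euclidean_space"
  assumes "set_integrable lborel (cell L) f" and "\<And>x. norm (g x) \<le> norm (f x)"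
    and [measurable]: "g \<in> borel_measurable borel"
  shows "set_integrable lborel (cell L) g"
  using assms(1)
  by (rule set_integrable_bound) (use assms in \<open>auto simp: set_borel_measurable_def\<close>)

lemma set_integrable_cell_continuous:
  fixes f :: "real \<times> real \<Rightarrow> 'b::euclidean_space"
  assumes "continuous_on UNIV f"
  shows "set_integrable lborel (cell L) f"
proof -
  have "bounded (f ` cell L)"
    by (intro compact_imp_bounded compact_continuous_image compact_cell continuous_on_subset[OF assms]) auto
  then obtain B where "\<And>x. x \<in> cell L \<Longrightarrow> norm (f x) \<le> B"
    by (auto simp: bounded_iff)
  then show ?thesis
    using borel_measurable_continuous_onI[OF assms] by (rule set_integrable_cell_bounded[rotated])
qed

lemma L2_D: "f \<in> L2 L \<Longrightarrow> f \<in> borel_measurable borel"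
  and L2_periodic: "f \<in> L2 L \<Longrightarrow> periodic L f"
  by (auto simp: L2_def)

lemma L2_I_continuous:
  fixes f :: "real \<times> real \<Rightarrow> 'b::euclidean_space"
  assumes "continuous_on UNIV f" "periodic L f"
  shows "f \<in> L2 L"
  unfolding L2_def using assms
  by (auto intro!: set_integrable_cell_continuous continuous_intros borel_measurable_continuous_onI)

lemma inner_integrable_L2:
  fixes f g :: "real \<times> real \<Rightarrow> 'b::euclidean_space"
  assumes f: "f \<in> L2 L" and g: "g \<in> L2 L"
  shows "set_integrable lborel (cell L) (\<lambda>x. f x \<bullet> g x)"
proof -
  note [measurable] = L2_D[OF f] L2_D[OF g]
  have "set_integrable lborel (cell L) (\<lambda>x. (norm (f x))\<^sup>2 + (norm (g x))\<^sup>2)"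
    using f g by (auto simp: L2_def)
  moreover have "norm (f x \<bullet> g x) \<le> norm ((norm (f x))\<^sup>2 + (norm (g x))\<^sup>2)" for x
  proof -
    have "\<bar>f x \<bullet> g x\<bar> \<le> norm (f x) * norm (g x)" by (rule Cauchy_Schwarz_ineq2)
    also have "\<dots> \<le> (norm (f x))\<^sup>2 + (norm (g x))\<^sup>2"
      using sum_squares_bound[of "norm (f x)" "norm (g x)"]
        mult_nonneg_nonneg[OF norm_ge_zero[of "f x"] norm_ge_zero[of "g x"]] by linarith
    finally show ?thesis by simp
  qed
  ultimately show ?thesis
    by (rule set_integrable_cell_dominated) measurable
qed

lemma norm_integrable_L2:
  assumes f: "f \<in> L2 L"
  shows "set_integrable lborel (cell L) f"
proof -
  note [measurable] = L2_D[OF f]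
  have "set_integrable lborel (cell L) (\<lambda>x. 1 + (norm (f x))\<^sup>2)"
    using f set_integrable_cell_bounded[of "\<lambda>_. 1::real" L 1] by (auto simp: L2_def)
  moreover have "norm (f x) \<le> norm (1 + (norm (f x))\<^sup>2)" for x
    using sum_squares_bound[of 1 "norm (f x)"] norm_ge_zero[of "f x"] by (simp add: abs_if)
  ultimately show ?thesis
    by (rule set_integrable_cell_dominated) measurable
qed

lemma L2_add:
  assumes f: "f \<in> L2 L" and g: "g \<in> L2 L"
  shows "(\<lambda>x. f x + g x) \<in> L2 L"
proof -
  note [measurable] = L2_D[OF f] L2_D[OF g]
  have "set_integrable lborel (cell L) (\<lambda>x. (norm (f x))\<^sup>2 + 2 * (f x \<bullet> g x) + (norm (g x))\<^sup>2)"
    using f g inner_integrable_L2[OF f g] by (intro set_integral_add) (auto simp: L2_def)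
  also have "(\<lambda>x. (norm (f x))\<^sup>2 + 2 * (f x \<bullet> g x) + (norm (g x))\<^sup>2) = (\<lambda>x. (norm (f x + g x))\<^sup>2)"
    by (simp add: power2_norm_eq_inner inner_add algebra_simps inner_commute)
  finally show ?thesis using f g by (auto simp: L2_def periodic_def)
qed

lemma L2_scaleR:
  assumes f: "f \<in> L2 L"
  shows "(\<lambda>x. c *\<^sub>R f x) \<in> L2 L"
  using f by (auto simp: L2_def periodic_def power_mult_distrib)

lemma L2_uminus: "f \<in> L2 L \<Longrightarrow> (\<lambda>x. - f x) \<in> L2 L"
  using L2_scaleR[of f L "-1"] by simp

lemma L2_diff: "f \<in> L2 L \<Longrightarrow> g \<in> L2 L \<Longrightarrow> (\<lambda>x. f x - g x) \<in> L2 L"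
  using L2_add[of f L "\<lambda>x. - g x"] L2_uminus by auto

lemma L2_zero: "(\<lambda>x. 0) \<in> L2 L"
  by (rule L2_I_continuous) (auto simp: periodic_def)

lemma L2_sum: "(\<And>i. i \<in> I \<Longrightarrow> f i \<in> L2 L) \<Longrightarrow> (\<lambda>x. \<Sum>i\<in>I. f i x) \<in> L2 L"
  by (induction I rule: infinite_finite_induct) (auto intro: L2_zero L2_add)

lemma L2_bounded_linear:
  fixes f :: "real \<times> real \<Rightarrow> 'b::euclidean_space" and A :: "'b \<Rightarrow> 'c::euclidean_space"
  assumes f: "f \<in> L2 L" and A: "bounded_linear A"
  shows "(\<lambda>x. A (f x)) \<in> L2 L"
proof -
  note [measurable] = L2_D[OF f]
  have [measurable]: "A \<in> borel_measurable borel"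
    using A by (intro borel_measurable_continuous_onI linear_continuous_on)
  obtain K where K: "\<And>x. norm (A x) \<le> norm x * K" "K > 0"
    using A bounded_linear.pos_bounded by blast
  have "set_integrable lborel (cell L) (\<lambda>x. K\<^sup>2 * (norm (f x))\<^sup>2)"
    using f by (auto simp: L2_def)
  then have "set_integrable lborel (cell L) (\<lambda>x. (norm (A (f x)))\<^sup>2)"
    by (rule set_integrable_cell_dominated)
       (use K in \<open>auto simp: power_mult_distrib[symmetric] mult.commute intro!: power_mono\<close>)
  then show ?thesis using f by (auto simp: L2_def periodic_def)
qed

lemma l2_inner_commute: "l2_inner L f g = l2_inner L g f"
  by (simp add: l2_inner_def inner_commute)

lemma l2_inner_add_left:
  "f \<in> L2 L \<Longrightarrow> g \<in> L2 L \<Longrightarrow> h \<in> L2 L \<Longrightarrow>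
   l2_inner L (\<lambda>x. f x + g x) h = l2_inner L f h + l2_inner L g h"
  by (simp add: l2_inner_def inner_add_left inner_integrable_L2)

lemma l2_inner_diff_left:
  "f \<in> L2 L \<Longrightarrow> g \<in> L2 L \<Longrightarrow> h \<in> L2 L \<Longrightarrow>
   l2_inner L (\<lambda>x. f x - g x) h = l2_inner L f h - l2_inner L g h"
  by (simp add: l2_inner_def inner_diff_left inner_integrable_L2)

lemma l2_inner_scaleR_left: "l2_inner L (\<lambda>x. c *\<^sub>R f x) h = c * l2_inner L f h"
  and l2_inner_scaleR_right: "l2_inner L f (\<lambda>x. c *\<^sub>R h x) = c * l2_inner L f h"
  by (simp_all add: l2_inner_def)

lemma l2_inner_zero_left: "l2_inner L (\<lambda>x. 0) h = 0"
  by (simp add: l2_inner_def)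

lemma l2_inner_sum_left:
  "(\<And>i. i \<in> I \<Longrightarrow> f i \<in> L2 L) \<Longrightarrow> h \<in> L2 L \<Longrightarrow>
   l2_inner L (\<lambda>x. \<Sum>i\<in>I. f i x) h = (\<Sum>i\<in>I. l2_inner L (f i) h)"
  by (induction I rule: infinite_finite_induct)
     (auto simp: l2_inner_zero_left l2_inner_add_left L2_sum)

lemma l2_inner_cong_ae:
  assumes "f \<in> borel_measurable borel" "f' \<in> borel_measurable borel" "g \<in> borel_measurable borel" "ae_eq f f'"
  shows "l2_inner L f g = l2_inner L f' g"
  unfolding l2_inner_def set_lebesgue_integral_def using assms
  by (intro integral_cong_AE) (auto simp: ae_eq_def)

lemma l2_inner_nonneg: "l2_inner L f f \<ge> 0"
  unfolding l2_inner_def set_lebesgue_integral_def by (rule integral_nonneg_AE) auto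

lemma l2_norm_nonneg: "l2_norm L f \<ge> 0"
  by (simp add: l2_norm_def l2_inner_nonneg)

lemma l2_norm_sq: "(l2_norm L f)\<^sup>2 = l2_inner L f f"
  by (simp add: l2_norm_def l2_inner_nonneg)

lemma l2_norm_zero: "l2_norm L (\<lambda>x. 0) = 0"
  by (simp add: l2_norm_def l2_inner_zero_left)

lemma l2_norm_sq_add:
  assumes f: "f \<in> L2 L" and g: "g \<in> L2 L"
  shows "(l2_norm L (\<lambda>x. f x + g x))\<^sup>2 = (l2_norm L f)\<^sup>2 + 2 * l2_inner L f g + (l2_norm L g)\<^sup>2"
proof -
  have "(l2_norm L (\<lambda>x. f x + g x))\<^sup>2 = l2_inner L f (\<lambda>x. f x + g x) + l2_inner L g (\<lambda>x. f x + g x)"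
    using f g by (simp only: l2_norm_sq l2_inner_add_left L2_add)
  moreover have "l2_inner L f (\<lambda>x. f x + g x) = l2_inner L f f + l2_inner L f g"
    using l2_inner_add_left[OF f g f] l2_inner_commute[of L f] by metis
  moreover have "l2_inner L g (\<lambda>x. f x + g x) = l2_inner L f g + l2_inner L g g"
    using l2_inner_add_left[OF f g g] l2_inner_commute[of L g] by metis
  ultimately show ?thesis by (simp only: l2_norm_sq)
qed

lemma l2_norm_scaleR: "l2_norm L (\<lambda>x. c *\<^sub>R f x) = \<bar>c\<bar> * l2_norm L f"
  by (simp add: l2_norm_def l2_inner_scaleR_left l2_inner_scaleR_right real_sqrt_mult)

lemma l2_norm_minus_commute: "l2_norm L (\<lambda>x. f x - g x) = l2_norm L (\<lambda>x. g x - f x)"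
  using l2_norm_scaleR[of L "-1" "\<lambda>x. f x - g x"] by (simp add: algebra_simps)

lemma l2_Cauchy_Schwarz:
  assumes f: "f \<in> L2 L" and g: "g \<in> L2 L"
  shows "\<bar>l2_inner L f g\<bar> \<le> l2_norm L f * l2_norm L g"
proof -
  have q: "0 \<le> (l2_norm L f)\<^sup>2 + 2 * t * l2_inner L f g + t\<^sup>2 * (l2_norm L g)\<^sup>2" for t
    using l2_norm_sq_add[OF f L2_scaleR[OF g], of t] zero_le_power2[of "l2_norm L (\<lambda>x. f x + t *\<^sub>R g x)"]
    by (simp add: l2_norm_scaleR l2_inner_scaleR_right power_mult_distrib)
  define F G I where "F = (l2_norm L f)\<^sup>2" and "G = (l2_norm L g)\<^sup>2" and "I = l2_inner L f g"
  have q': "0 \<le> F + 2 * t * I + t\<^sup>2 * G" for t using q[of t] by (simp add: F_def G_def I_def)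
  have "I\<^sup>2 \<le> F * G"
  proof (cases "G = 0")
    case True
    have "I = 0"
    proof (rule ccontr)
      assume n: "I \<noteq> 0"
      show False
        using q'[of "- (F + 1) / (2 * I)"] n True by (simp add: field_simps)
    qed
    then show ?thesis using True by simp
  next
    case False
    then have "G > 0" by (simp add: G_def)
    have "F + 2 * (- I / G) * I + (- I / G)\<^sup>2 * G = F - I\<^sup>2 / G"
      using False by (simp add: power2_eq_square)
    then have "I\<^sup>2 / G \<le> F" using q'[of "- I / G"] by linarith
    then show ?thesis using \<open>G > 0\<close> by (simp add: divide_le_eq)
  qed
  then have "\<bar>I\<bar>\<^sup>2 \<le> (l2_norm L f * l2_norm L g)\<^sup>2"
    by (simp add: F_def G_def power_mult_distrib)
  then show ?thesis
    unfolding I_def by (rule power2_le_imp_le) (simp add: l2_norm_nonneg)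
qed

lemma l2_norm_triangle:
  assumes f: "f \<in> L2 L" and g: "g \<in> L2 L"
  shows "l2_norm L (\<lambda>x. f x + g x) \<le> l2_norm L f + l2_norm L g"
proof (rule power2_le_imp_le)
  show "(l2_norm L (\<lambda>x. f x + g x))\<^sup>2 \<le> (l2_norm L f + l2_norm L g)\<^sup>2"
    using l2_norm_sq_add[OF f g] l2_Cauchy_Schwarz[OF f g] by (simp add: power2_sum)
qed (simp add: l2_norm_nonneg)

lemma l2_inner_tendsto:
  assumes "\<And>n. s n \<in> L2 L" "f \<in> L2 L" "g \<in> L2 L"
    and "(\<lambda>n. l2_norm L (\<lambda>x. f x - s n x)) \<longlonglongrightarrow> 0"
  shows "(\<lambda>n. l2_inner L (s n) g) \<longlonglongrightarrow> l2_inner L f g"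
proof -
  have "(\<lambda>n. l2_norm L (\<lambda>x. f x - s n x) * l2_norm L g) \<longlonglongrightarrow> 0 * l2_norm L g"
    by (intro tendsto_intros assms)
  then have "(\<lambda>n. l2_norm L (\<lambda>x. f x - s n x) * l2_norm L g) \<longlonglongrightarrow> 0" by simp
  moreover have "norm (l2_inner L f g - l2_inner L (s n) g) \<le> l2_norm L (\<lambda>x. f x - s n x) * l2_norm L g" for n
    using l2_Cauchy_Schwarz[of "\<lambda>x. f x - s n x" L g] assms
    by (simp add: l2_inner_diff_left L2_diff)
  ultimately have "(\<lambda>n. l2_inner L f g - l2_inner L (s n) g) \<longlonglongrightarrow> 0"
    by (metis (no_types, lifting) Lim_null_comparison always_eventually)
  then show ?thesis
    using tendsto_diff[OF tendsto_const[of "l2_inner L f g"]] by force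
qed

text \<open>A periodic null set is a countable union of translates of its part in one period cell.\<close>

lemma periodic_AE_zero:
  fixes f :: "real \<times> real \<Rightarrow> 'b::real_normed_vector"
  assumes L: "L > 0" and per: "periodic L f" and "AE x in lborel. x \<in> cell L \<longrightarrow> f x = 0"
  shows "AE x in lborel. f x = 0"
proof -
  have multiple: "f (x + of_int i *\<^sub>R a) = f x" if a: "\<And>y. f (y + a) = f y" for a x and i :: int
  proof (induction i rule: int_induct[where k=0])
    case (step1 i)
    have "f (x + of_int (i+1) *\<^sub>R a) = f ((x + of_int i *\<^sub>R a) + a)"
      by (simp add: scaleR_left_distrib add.assoc)
    also have "\<dots> = f (x + of_int i *\<^sub>R a)" by (rule a)
    finally show ?case using step1 by simp
  next
    case (step2 i)
    have "f (x + of_int (i-1) *\<^sub>R a) = f ((x + of_int (i-1) *\<^sub>R a) + a)"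
      by (rule a[symmetric])
    also have "\<dots> = f (x + of_int i *\<^sub>R a)" by (simp add: scaleR_left_diff_distrib)
    finally show ?case using step2 by simp
  qed simp
  have period: "f (y + (L, 0)) = f y" "f (y + (0, L)) = f y" for y
    using per unfolding periodic_def by blast+
  have shift: "f (x + (of_int i * L, of_int j * L)) = f x" for x i j
    using multiple[OF period(2), of "x + of_int i *\<^sub>R (L, 0)" j] multiple[OF period(1), of x i]
    by (simp add: add.assoc)
  obtain N where N: "N \<in> null_sets lborel" "\<And>x. x \<in> cell L \<Longrightarrow> f x \<noteq> 0 \<Longrightarrow> x \<in> N"
    using assms(3) by (force elim!: AE_E simp: null_sets_def)
  define N' where "N' = (\<Union>(i,j) \<in> (UNIV :: (int \<times> int) set). {x. x - (of_int i * L, of_int j * L) \<in> N})"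
  have "N' \<in> null_sets lborel"
    unfolding N'_def case_prod_beta by (intro null_sets_UN' null_sets_translation N) auto
  moreover have "x \<in> N'" if "f x \<noteq> 0" for x
  proof -
    define i j where "i = \<lfloor>fst x / L\<rfloor>" and "j = \<lfloor>snd x / L\<rfloor>"
    define y where "y = x - (of_int i * L, of_int j * L)"
    have "0 \<le> fst x - of_int i * L" "fst x - of_int i * L \<le> L"
         "0 \<le> snd x - of_int j * L" "snd x - of_int j * L \<le> L"
      using L of_int_floor_le[of "fst x / L"] of_int_floor_le[of "snd x / L"]
        floor_correct[of "fst x / L"] floor_correct[of "snd x / L"]
      unfolding i_def j_def pos_le_divide_eq[OF L] pos_divide_less_eq[OF L]
      by (auto simp: algebra_simps)
    then have "y \<in> cell L" by (auto simp: y_def cell_def minus_prod_def)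
    moreover have "f y \<noteq> 0" using that shift[of y i j] by (simp add: y_def)
    ultimately have "y \<in> N" by (rule N(2))
    then show ?thesis unfolding N'_def y_def by blast
  qed
  ultimately show ?thesis
    by (intro AE_I'[of N']) auto
qed

lemma l2_norm_eq_0_imp_ae:
  assumes L: "L > 0" and f: "f \<in> L2 L" and "l2_norm L f = 0"
  shows "ae_eq f (\<lambda>x. 0)"
proof -
  have "l2_inner L f f = 0" using assms(3) by (metis l2_norm_sq zero_power2)
  then have "AE x in lborel. indicator (cell L) x *\<^sub>R (f x \<bullet> f x) = 0"
    unfolding l2_inner_def set_lebesgue_integral_def using inner_integrable_L2[OF f f]
    by (subst (asm) integral_nonneg_eq_0_iff_AE) (auto simp: set_integrable_def)
  then have "AE x in lborel. x \<in> cell L \<longrightarrow> f x = 0" by eventually_elim auto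
  from periodic_AE_zero[OF L L2_periodic[OF f] this] show ?thesis by (simp add: ae_eq_def)
qed

lemma l2_norm_cong_ae:
  assumes "f \<in> borel_measurable borel" "f' \<in> borel_measurable borel" "ae_eq f f'"
  shows "l2_norm L f = l2_norm L f'"
  using l2_inner_cong_ae[OF assms(1,2,1,3)] l2_inner_cong_ae[OF assms(1,2,2,3)]
  by (simp add: l2_norm_def l2_inner_commute)

section \<open>Smooth periodic functions and integration by parts\<close>

lemma Basis_plane: "(Basis :: (real \<times> real) set) = {(1, 0), (0, 1)}"
  by (auto simp: Basis_prod_def)

lemma sum_Basis_plane: "(\<Sum>b\<in>(Basis :: (real \<times> real) set). f b) = f (1, 0) + f (0, 1)"
  by (simp add: Basis_plane)

definition C1 :: "(real \<times> real \<Rightarrow> 'b::euclidean_space) \<Rightarrow> bool" where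
  "C1 f \<longleftrightarrow> (\<forall>x. f differentiable (at x)) \<and> (\<forall>b\<in>Basis. continuous_on UNIV (pd b f))"

lemma Cinf_imp_C1: "Cinf_on UNIV f \<Longrightarrow> C1 f"
  unfolding Cinf_on_def C1_def pd_def by (auto dest!: spec[of _ "Suc 0"])

lemma C1_differentiable: "C1 f \<Longrightarrow> f differentiable (at x)"
  unfolding C1_def by blast

lemma C1_has_derivative: "C1 f \<Longrightarrow> (f has_derivative (\<lambda>h. pd h f x)) (at x)"
  using C1_differentiable[of f x] by (simp add: pd_def frechet_derivative_works)

lemma C1_continuous: "C1 f \<Longrightarrow> continuous_on UNIV f"
  by (auto simp: C1_def intro!: continuous_at_imp_continuous_on differentiable_imp_continuous_within)

lemma C1_pd_continuous: "C1 f \<Longrightarrow> b \<in> Basis \<Longrightarrow> continuous_on UNIV (pd b f)"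
  by (simp add: C1_def)

lemma pd_scaleR:
  assumes "C1 f" "C1 g"
  shows "pd b (\<lambda>x. f x *\<^sub>R g x) x = pd b f x *\<^sub>R g x + f x *\<^sub>R pd b g x"
proof -
  have "(f has_derivative (\<lambda>h. pd h f x)) (at x)" "(g has_derivative (\<lambda>h. pd h g x)) (at x)"
    by (intro C1_has_derivative assms)+
  then have "((\<lambda>x. f x *\<^sub>R g x) has_derivative (\<lambda>h. f x *\<^sub>R pd h g x + pd h f x *\<^sub>R g x)) (at x)"
    by (rule has_derivative_scaleR)
  from frechet_derivative_at[OF this, symmetric] show ?thesis by (simp add: pd_def)
qed

lemma C1_scaleR:
  assumes "C1 f" "C1 g"
  shows "C1 (\<lambda>x. f x *\<^sub>R g x)"
  unfolding C1_def
proof (intro conjI ballI allI)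
  show "(\<lambda>x. f x *\<^sub>R g x) differentiable at x" for x
    by (intro differentiable_scaleR C1_differentiable assms)
  show "continuous_on UNIV (pd b (\<lambda>x. f x *\<^sub>R g x))" if "b \<in> Basis" for b
    unfolding pd_scaleR[OF assms, abs_def]
    by (intro continuous_intros C1_continuous C1_pd_continuous assms that)
qed

lemma pd_inner:
  assumes "C1 f"
  shows "pd b (\<lambda>x. f x \<bullet> c) x = pd b f x \<bullet> c"
proof -
  have "(f has_derivative (\<lambda>h. pd h f x)) (at x)"
    by (intro C1_has_derivative assms)+
  then have "((\<lambda>x. f x \<bullet> c) has_derivative (\<lambda>h. pd h f x \<bullet> c)) (at x)"
    by (rule has_derivative_inner_left)
  from frechet_derivative_at[OF this, symmetric] show ?thesis by (simp add: pd_def)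
qed

lemma C1_inner:
  assumes "C1 f"
  shows "C1 (\<lambda>x. f x \<bullet> c)"
  unfolding C1_def
proof (intro conjI ballI allI)
  show "(\<lambda>x. f x \<bullet> c) differentiable at x" for x
    using has_derivative_inner_left[OF C1_has_derivative[OF assms]] by (rule differentiableI)
  show "continuous_on UNIV (pd b (\<lambda>x. f x \<bullet> c))" if "b \<in> Basis" for b
    unfolding pd_inner[OF assms, abs_def]
    by (intro continuous_intros C1_pd_continuous assms that)
qed

lemma pd_vector_derivative:
  assumes "C1 f"
  shows "((\<lambda>t. f (t, y)) has_vector_derivative pd (1,0) f (t, y)) (at t within S)"
    and "((\<lambda>t. f (y, t)) has_vector_derivative pd (0,1) f (y, t)) (at t within S)"
proof -
  have d: "(f has_derivative (\<lambda>h. pd h f x)) (at x)" for x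
    by (intro C1_has_derivative assms)+
  have lin: "pd (r *\<^sub>R h) f x = r *\<^sub>R pd h f x" for r h x
    by (rule linear_scale[OF has_derivative_linear[OF d]])
  have "((\<lambda>t. f (t, y)) has_derivative (\<lambda>h. pd (h, 0) f (t, y))) (at t)"
    by (rule has_derivative_compose[OF _ d, of "\<lambda>t. (t, y)" "\<lambda>h. (h, 0)"])
       (intro has_derivative_Pair has_derivative_ident has_derivative_const)
  moreover have "(\<lambda>h. pd (h, 0) f (t, y)) = (\<lambda>h. h *\<^sub>R pd (1, 0) f (t, y))"
  proof
    show "pd (h, 0) f (t, y) = h *\<^sub>R pd (1, 0) f (t, y)" for h
      using lin[of h "(1, 0)"] by simp
  qed
  ultimately show "((\<lambda>t. f (t, y)) has_vector_derivative pd (1,0) f (t, y)) (at t within S)"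
    by (simp add: has_vector_derivative_def has_derivative_at_withinI)
  have "((\<lambda>t. f (y, t)) has_derivative (\<lambda>h. pd (0, h) f (y, t))) (at t)"
    by (rule has_derivative_compose[OF _ d, of "\<lambda>t. (y, t)" "\<lambda>h. (0, h)"])
       (intro has_derivative_Pair has_derivative_ident has_derivative_const)
  moreover have "(\<lambda>h. pd (0, h) f (y, t)) = (\<lambda>h. h *\<^sub>R pd (0, 1) f (y, t))"
  proof
    show "pd (0, h) f (y, t) = h *\<^sub>R pd (0, 1) f (y, t)" for h
      using lin[of h "(0, 1)"] by simp
  qed
  ultimately show "((\<lambda>t. f (y, t)) has_vector_derivative pd (0,1) f (y, t)) (at t within S)"
    by (simp add: has_vector_derivative_def has_derivative_at_withinI)
qed

lemma periodic_edges:
  assumes "periodic L f"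
  shows "f (L, y) = f (0, y)" "f (y, L) = f (y, 0)"
proof -
  have "f ((0, y) + (L, 0)) = f (0, y)" "f ((y, 0) + (0, L)) = f (y, 0)"
    using assms unfolding periodic_def by blast+
  then show "f (L, y) = f (0, y)" "f (y, L) = f (y, 0)" by simp_all
qed

lemma integral_pd_line:
  assumes L: "L > 0" and "C1 F" "periodic L F"
  shows "(\<integral>t. indicator {0..L} t *\<^sub>R pd (1, 0) F (t, y) \<partial>lborel) = 0"
    and "(\<integral>t. indicator {0..L} t *\<^sub>R pd (0, 1) F (y, t) \<partial>lborel) = 0"
proof -
  have c: "continuous_on UNIV (pd (1,0) F)" "continuous_on UNIV (pd (0,1) F)"
    by (auto intro!: C1_pd_continuous assms simp: Basis_plane)
  have "continuous_on {0..L} (\<lambda>t. pd (1, 0) F (t, y))"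
    by (rule continuous_on_compose2[OF c(1)]) (auto intro!: continuous_intros)
  then have "(\<integral>t. indicator {0..L} t *\<^sub>R pd (1, 0) F (t, y) \<partial>lborel) = F (L, y) - F (0, y)"
    by (intro integral_FTC_atLeastAtMost[where F="\<lambda>t. F (t, y)"] pd_vector_derivative(1) assms)
       (use assms in auto)
  then show "(\<integral>t. indicator {0..L} t *\<^sub>R pd (1, 0) F (t, y) \<partial>lborel) = 0"
    using periodic_edges[OF assms(3)] by simp
  have "continuous_on {0..L} (\<lambda>t. pd (0, 1) F (y, t))"
    by (rule continuous_on_compose2[OF c(2)]) (auto intro!: continuous_intros)
  then have "(\<integral>t. indicator {0..L} t *\<^sub>R pd (0, 1) F (y, t) \<partial>lborel) = F (y, L) - F (y, 0)"
    by (intro integral_FTC_atLeastAtMost[where F="\<lambda>t. F (y, t)"] pd_vector_derivative(2) assms)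
       (use assms in auto)
  then show "(\<integral>t. indicator {0..L} t *\<^sub>R pd (0, 1) F (y, t) \<partial>lborel) = 0"
    using periodic_edges[OF assms(3)] by simp
qed

lemma indicator_cell: "indicator (cell L) (x, y) = (indicator {0..L} x * indicator {0..L} y :: real)"
  by (auto simp: cell_def indicator_def)

text \<open>
  Along every line the integral over one period vanishes by the fundamental theorem of calculus.
  Applied to products this is integration by parts without boundary terms.
\<close>

theorem torus_integral_pd:
  fixes F :: "real \<times> real \<Rightarrow> 'b::euclidean_space"
  assumes L: "L > 0" and "C1 F" "periodic L F" "b \<in> Basis"
  shows "(LINT x:cell L|lborel. pd b F x) = 0"
proof -
  have int: "integrable (lborel \<Otimes>\<^sub>M lborel) (\<lambda>(x,y). indicator (cell L) (x,y) *\<^sub>R pd b F (x,y))"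
    using set_integrable_cell_continuous[OF C1_pd_continuous[OF assms(2,4)], of L]
    by (simp add: lborel_prod set_integrable_def case_prod_beta')
  consider "b = (1,0)" | "b = (0,1)" using assms(4) by (auto simp: Basis_plane)
  then show ?thesis
  proof cases
    case 1
    have "(\<integral>y. (\<integral>x. indicator (cell L) (x,y) *\<^sub>R pd b F (x,y) \<partial>lborel) \<partial>lborel) = 0"
    proof -
      have "indicator (cell L) (x,y) *\<^sub>R pd b F (x,y)
          = indicator {0..L} y *\<^sub>R (indicator {0..L} x *\<^sub>R pd (1, 0) F (x, y))" for x y
        by (simp add: indicator_cell 1 mult.commute)
      then show ?thesis using integral_pd_line(1)[OF assms(1-3)] by (simp del: scaleR_scaleR)
    qed
    then show ?thesis
      using lborel_pair.integral_snd[OF int] by (simp add: set_lebesgue_integral_def lborel_prod case_prod_beta')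
  next
    case 2
    have "(\<integral>x. (\<integral>y. indicator (cell L) (x,y) *\<^sub>R pd b F (x,y) \<partial>lborel) \<partial>lborel) = 0"
    proof -
      have "indicator (cell L) (x,y) *\<^sub>R pd b F (x,y)
          = indicator {0..L} x *\<^sub>R (indicator {0..L} y *\<^sub>R pd (0, 1) F (x, y))" for x y
        by (simp add: indicator_cell 2)
      then show ?thesis using integral_pd_line(2)[OF assms(1-3)] by (simp del: scaleR_scaleR)
    qed
    then show ?thesis
      using lborel_pair.integral_fst[OF int] by (simp add: set_lebesgue_integral_def lborel_prod case_prod_beta')
  qed
qed

lemma set_integrable_cell_mult_continuous:
  fixes f h :: "real \<times> real \<Rightarrow> real"
  assumes [measurable]: "f \<in> borel_measurable borel" and f: "set_integrable lborel (cell L) f"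
    and h: "continuous_on UNIV h"
  shows "set_integrable lborel (cell L) (\<lambda>x. f x * h x)"
proof -
  note [measurable] = borel_measurable_continuous_onI[OF h]
  have "bounded (h ` cell L)"
    by (intro compact_imp_bounded compact_continuous_image compact_cell continuous_on_subset[OF h]) auto
  then obtain B where B: "\<And>x. x \<in> cell L \<Longrightarrow> norm (h x) \<le> B"
    by (auto simp: bounded_iff)
  have "set_integrable lborel (cell L) (\<lambda>x. B * f x)" using f by simp
  then show ?thesis
  proof (rule set_integrable_bound)
    have "norm (f x * h x) \<le> norm (B * f x)" if "x \<in> cell L" for x
    proof -
      have "\<bar>h x\<bar> \<le> \<bar>B\<bar>" using B[OF that] by simp
      then show ?thesis using mult_left_mono[of "\<bar>h x\<bar>" "\<bar>B\<bar>" "\<bar>f x\<bar>"]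
        by (simp add: abs_mult mult.commute)
    qed
    then show "AE x in lborel. x \<in> cell L \<longrightarrow> norm (f x * h x) \<le> norm (B * f x)" by simp
  qed (simp add: set_borel_measurable_def)
qed

text \<open>
  On a vertical line \<open>f\<close> is constant and the derivative in \<open>x\<^sub>2\<close> integrates to zero. The profile \<open>g\<close> may be
  non-measurable; it only ever enters as a constant factor under the inner integral, so no measurable
  version of it has to be constructed.
\<close>

lemma integral_horizontal_pd:
  fixes f F :: "real \<times> real \<Rightarrow> real"
  assumes L: "L > 0" and "C1 F" "periodic L F"
    and [measurable]: "f \<in> borel_measurable borel" and f: "set_integrable lborel (cell L) f"
    and ae: "ae_eq f (\<lambda>x. g (fst x))"
  shows "(LINT x:cell L|lborel. f x * pd (0, 1) F x) = 0"
proof -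
  have c: "continuous_on UNIV (pd (0,1) F)"
    by (auto intro!: C1_pd_continuous assms simp: Basis_plane)
  note [measurable] = borel_measurable_continuous_onI[OF c]
  have int: "integrable (lborel \<Otimes>\<^sub>M lborel) (\<lambda>(x,y). indicator (cell L) (x,y) *\<^sub>R (f (x,y) * pd (0,1) F (x,y)))"
    using set_integrable_cell_mult_continuous[OF assms(4) f c]
    by (simp add: lborel_prod set_integrable_def case_prod_beta')
  have "AE z in lborel \<Otimes>\<^sub>M lborel. f z = g (fst z)"
    using ae by (simp only: ae_eq_def lborel_prod)
  from lborel_pair.AE_pair[OF this]
  have "AE x in lborel. AE y in lborel. f (x, y) = g x" by simp
  then have "AE x in lborel. (\<integral>y. indicator (cell L) (x,y) *\<^sub>R (f (x,y) * pd (0,1) F (x,y)) \<partial>lborel) = 0"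
  proof eventually_elim
    case (elim x)
    have "(\<integral>y. indicator (cell L) (x,y) *\<^sub>R (f (x,y) * pd (0,1) F (x,y)) \<partial>lborel)
      = (\<integral>y. (indicator {0..L} x * g x) *\<^sub>R (indicator {0..L} y *\<^sub>R pd (0,1) F (x,y)) \<partial>lborel)"
      using elim by (intro integral_cong_AE) (auto simp: indicator_cell mult_ac elim: eventually_mono)
    also have "\<dots> = (indicator {0..L} x * g x) *\<^sub>R (\<integral>y. indicator {0..L} y *\<^sub>R pd (0,1) F (x,y) \<partial>lborel)"
      by (rule integral_scaleR_right)
    also have "\<dots> = 0" using integral_pd_line(2)[OF assms(1-3)] by simp
    finally show ?case .
  qed
  then have "(\<integral>x. (\<integral>y. indicator (cell L) (x,y) *\<^sub>R (f (x,y) * pd (0,1) F (x,y)) \<partial>lborel) \<partial>lborel) = 0"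
    by (rule integral_eq_zero_AE)
  then show ?thesis
    using lborel_pair.integral_fst[OF int] by (simp add: set_lebesgue_integral_def lborel_prod case_prod_beta')
qed

section \<open>Trigonometric modes\<close>

definition freq :: "real \<Rightarrow> int \<times> int \<Rightarrow> real \<times> real" where
  "freq L k = (2 * pi / L) *\<^sub>R (real_of_int (fst k), real_of_int (snd k))"

definition cmode :: "real \<Rightarrow> int \<times> int \<Rightarrow> real \<times> real \<Rightarrow> real" where
  "cmode L k x = cos (freq L k \<bullet> x)"

definition smode :: "real \<Rightarrow> int \<times> int \<Rightarrow> real \<times> real \<Rightarrow> real" where
  "smode L k x = sin (freq L k \<bullet> x)"

lemma freq_arith:
  "freq L (k + l) = freq L k + freq L l" "freq L (k - l) = freq L k - freq L l" "freq L (-k) = - freq L k"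
  "freq L 0 = 0"
  by (simp_all add: freq_def algebra_simps prod_eq_iff add_divide_distrib diff_divide_distrib)

lemma trig_has_derivative:
  fixes a b :: "'b::euclidean_space"
  shows "((\<lambda>x. cos (p \<bullet> x) *\<^sub>R a + sin (p \<bullet> x) *\<^sub>R b) has_derivative
    (\<lambda>h. (p \<bullet> h) *\<^sub>R (cos (p \<bullet> x) *\<^sub>R b - sin (p \<bullet> x) *\<^sub>R a))) (at x)"
  by (auto intro!: derivative_eq_intros ext simp: algebra_simps)

lemma pd_trig:
  fixes a b :: "'b::euclidean_space"
  shows "pd h (\<lambda>x. cos (p \<bullet> x) *\<^sub>R a + sin (p \<bullet> x) *\<^sub>R b) =
    (\<lambda>x. (p \<bullet> h) *\<^sub>R (cos (p \<bullet> x) *\<^sub>R b - sin (p \<bullet> x) *\<^sub>R a))"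
  unfolding pd_def by (rule ext) (simp add: frechet_derivative_at[OF trig_has_derivative, symmetric])

lemma Cinf_trig:
  fixes a b :: "'b::euclidean_space"
  shows "Cinf_on UNIV (\<lambda>x. cos (p \<bullet> x) *\<^sub>R a + sin (p \<bullet> x) *\<^sub>R b)"
  unfolding Cinf_on_def
proof
  fix k show "Ck_on k UNIV (\<lambda>x. cos (p \<bullet> x) *\<^sub>R a + sin (p \<bullet> x) *\<^sub>R b)"
  proof (induction k arbitrary: a b)
    case (Suc k)
    have "Ck_on k UNIV (\<lambda>x. frechet_derivative (\<lambda>x. cos (p \<bullet> x) *\<^sub>R a + sin (p \<bullet> x) *\<^sub>R b) (at x) h)" for h
      using Suc[of "(p \<bullet> h) *\<^sub>R b" "- (p \<bullet> h) *\<^sub>R a"]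
      by (simp add: frechet_derivative_at[OF trig_has_derivative, symmetric] algebra_simps)
    then show ?case using trig_has_derivative[of p a b] by (auto simp: differentiable_def)
  qed (auto intro!: continuous_intros)
qed

lemma freq_shift:
  assumes L: "L > 0"
  shows "freq L k \<bullet> (x + (L, 0)) = freq L k \<bullet> x + 2 * pi * of_int (fst k)"
    "freq L k \<bullet> (x + (0, L)) = freq L k \<bullet> x + 2 * pi * of_int (snd k)"
  using assms by (auto simp: freq_def inner_add_right inner_Pair field_simps)

lemma cos_sin_shift: "cos (x + 2 * pi * of_int n) = cos x" "sin (x + 2 * pi * of_int n) = sin x"
  by (simp_all add: cos_add sin_add)

lemma periodic_trig:
  fixes a b :: "'b::euclidean_space"
  assumes L: "L > 0"
  shows "periodic L (\<lambda>x. cos (freq L k \<bullet> x) *\<^sub>R a + sin (freq L k \<bullet> x) *\<^sub>R b)"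
  unfolding periodic_def freq_shift[OF assms] cos_sin_shift by simp

lemma Cinf_mode: "Cinf_on UNIV (cmode L k)" "Cinf_on UNIV (smode L k)"
  using Cinf_trig[of "freq L k" "1::real" 0] Cinf_trig[of "freq L k" "0::real" 1]
  by (simp_all add: cmode_def[abs_def] smode_def[abs_def])

lemma pd_mode:
  "pd h (cmode L k) x = - (freq L k \<bullet> h) * smode L k x"
  "pd h (smode L k) x = (freq L k \<bullet> h) * cmode L k x"
  using pd_trig[of h "freq L k" "1::real" 0] pd_trig[of h "freq L k" "0::real" 1]
  by (simp_all add: cmode_def[abs_def] smode_def[abs_def])

lemma periodic_mode: "L > 0 \<Longrightarrow> periodic L (cmode L k)" "L > 0 \<Longrightarrow> periodic L (smode L k)"
  using periodic_trig[of L k "1::real" 0] periodic_trig[of L k "0::real" 1]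
  by (simp_all add: cmode_def[abs_def] smode_def[abs_def])

lemma C1_mode: "C1 (cmode L k)" "C1 (smode L k)"
  by (simp_all add: Cinf_mode Cinf_imp_C1)

lemma continuous_mode: "continuous_on S (cmode L k)" "continuous_on S (smode L k)"
  unfolding cmode_def[abs_def] smode_def[abs_def] by (auto intro!: continuous_intros)

lemma L2_mode: "L > 0 \<Longrightarrow> cmode L k \<in> L2 L" "L > 0 \<Longrightarrow> smode L k \<in> L2 L"
  by (auto intro!: L2_I_continuous continuous_mode periodic_mode)

lemma C1_const: "C1 (\<lambda>x. c)"
  by (simp add: C1_def pd_def[abs_def])

lemma freq_eq_0: "L > 0 \<Longrightarrow> freq L k = 0 \<longleftrightarrow> k = 0"
  by (auto simp: freq_def prod_eq_iff)

lemma integral_mode: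
  assumes L: "L > 0"
  shows "(LINT x:cell L|lborel. cmode L k x) = (if k = 0 then L\<^sup>2 else 0)"
    and "(LINT x:cell L|lborel. smode L k x) = 0"
proof -
  have m0: "measure lborel (cell L) = L\<^sup>2"
  proof -
    have "cell L = cbox (0,0) (L,L)"
      by (auto simp: cell_def cbox_Pair_eq)
    then show ?thesis using L
      by (simp add: measure_lborel_cbox_eq Basis_plane power2_eq_square)
  qed
  have z: "cmode L 0 = (\<lambda>x. 1)" "smode L 0 = (\<lambda>x. 0)"
    by (auto simp: cmode_def smode_def freq_arith)
  have nz: "\<exists>b\<in>Basis. freq L k \<bullet> b \<noteq> 0" if "k \<noteq> 0"
    using that freq_eq_0[OF assms, of k] by (metis euclidean_all_zero_iff)
  show "(LINT x:cell L|lborel. cmode L k x) = (if k = 0 then L\<^sup>2 else 0)"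
  proof (cases "k = 0")
    case False
    then obtain b where b: "b \<in> Basis" "freq L k \<bullet> b \<noteq> 0" using nz by blast
    then show ?thesis
      using torus_integral_pd[OF assms C1_mode(2)[of L k] periodic_mode(2)[OF assms] b(1)] False
      by (simp add: pd_mode)
  qed (use m0 in \<open>simp add: z set_lebesgue_integral_def\<close>)
  show "(LINT x:cell L|lborel. smode L k x) = 0"
  proof (cases "k = 0")
    case False
    then obtain b where b: "b \<in> Basis" "freq L k \<bullet> b \<noteq> 0" using nz by blast
    have "(LINT x:cell L|lborel. - (freq L k \<bullet> b) * smode L k x)
        = - (freq L k \<bullet> b) * (LINT x:cell L|lborel. smode L k x)"
      by (rule set_integral_mult_right)
    then show ?thesis
      using torus_integral_pd[OF assms C1_mode(1)[of L k] periodic_mode(1)[OF assms] b(1)] b(2)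
      unfolding pd_mode by (metis mult_eq_0_iff neg_equal_0_iff_equal)
  qed (simp add: z)
qed

lemma mode_mult:
  "cmode L k x * cmode L l x = (cmode L (k - l) x + cmode L (k + l) x) / 2"
  "smode L k x * smode L l x = (cmode L (k - l) x - cmode L (k + l) x) / 2"
  "smode L k x * cmode L l x = (smode L (k + l) x + smode L (k - l) x) / 2"
  "cmode L k x * smode L l x = (smode L (k + l) x - smode L (k - l) x) / 2"
  by (simp_all add: cmode_def smode_def freq_arith inner_add_left inner_diff_left
      cos_times_cos sin_times_sin sin_times_cos cos_times_sin)

lemma l2_inner_mode:
  assumes L: "L > 0"
  shows "l2_inner L (cmode L k) (cmode L l) = ((if k = l then L\<^sup>2 else 0) + (if k = - l then L\<^sup>2 else 0)) / 2"
    "l2_inner L (smode L k) (smode L l) = ((if k = l then L\<^sup>2 else 0) - (if k = - l then L\<^sup>2 else 0)) / 2"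
    "l2_inner L (smode L k) (cmode L l) = 0"
    "l2_inner L (cmode L k) (smode L l) = 0"
  using set_integrable_cell_continuous[OF continuous_mode(1), of L L]
    set_integrable_cell_continuous[OF continuous_mode(2), of L L]
  by (simp_all add: l2_inner_def mode_mult integral_mode[OF assms] eq_neg_iff_add_eq_0)

section \<open>Completeness of the trigonometric system\<close>

text \<open>
  The span of the modes. The factor \<open>a\<close> sits in the generators so that one closure rule is enough; the set
  is then an algebra by the product formulas, and composition with polynomials stays inside it.
\<close>

inductive_set trigs :: "real \<Rightarrow> (real \<times> real \<Rightarrow> real) set" for L where
  cmode: "(\<lambda>x. a * cmode L k x) \<in> trigs L"
| smode: "(\<lambda>x. a * smode L k x) \<in> trigs L"
| add: "f \<in> trigs L \<Longrightarrow> g \<in> trigs L \<Longrightarrow> (\<lambda>x. f x + g x) \<in> trigs L"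

lemma trigs_scale: "f \<in> trigs L \<Longrightarrow> (\<lambda>x. c * f x) \<in> trigs L"
  by (induction rule: trigs.induct)
     (auto simp: distrib_left mult.assoc[symmetric] intro: trigs.intros)

lemma trigs_const: "(\<lambda>x. c) \<in> trigs L"
  using trigs.cmode[of c L 0] by (simp add: cmode_def freq_arith)

lemma trigs_mult_mode:
  assumes "f \<in> trigs L"
  shows "(\<lambda>x. f x * cmode L l x) \<in> trigs L \<and> (\<lambda>x. f x * smode L l x) \<in> trigs L"
  using assms
proof (induction rule: trigs.induct)
  case (cmode a k)
  have "a * cmode L k x * cmode L l x = (a/2) * cmode L (k - l) x + (a/2) * cmode L (k + l) x"
    "a * cmode L k x * smode L l x = (a/2) * smode L (k + l) x + (-a/2) * smode L (k - l) x" for x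
    unfolding mult.assoc mode_mult by (simp_all add: field_simps)
  then show ?case by (simp only:) (intro conjI trigs.intros)
next
  case (smode a k)
  have "a * smode L k x * cmode L l x = (a/2) * smode L (k + l) x + (a/2) * smode L (k - l) x"
    "a * smode L k x * smode L l x = (a/2) * cmode L (k - l) x + (-a/2) * cmode L (k + l) x" for x
    unfolding mult.assoc mode_mult by (simp_all add: field_simps)
  then show ?case by (simp only:) (intro conjI trigs.intros)
next
  case (add f g)
  then show ?case by (auto simp: distrib_right intro: trigs.intros)
qed

lemma trigs_mult:
  assumes "g \<in> trigs L" and f: "f \<in> trigs L"
  shows "(\<lambda>x. f x * g x) \<in> trigs L"
  using assms(1)
proof (induction rule: trigs.induct)
  case (cmode a k)
  show ?case using trigs_scale[OF conjunct1[OF trigs_mult_mode[OF f]], of a] by (simp add: mult_ac)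
next
  case (smode a k)
  show ?case using trigs_scale[OF conjunct2[OF trigs_mult_mode[OF f]], of a] by (simp add: mult_ac)
next
  case (add f g)
  then show ?case by (auto simp: distrib_left intro: trigs.intros)
qed

lemma trigs_continuous: "f \<in> trigs L \<Longrightarrow> continuous_on UNIV f"
  by (induction rule: trigs.induct) (auto intro!: continuous_intros continuous_mode)

lemma trigs_polynomial:
  assumes "real_polynomial_function p" and s: "s \<in> trigs L"
  shows "(\<lambda>x. p (s x)) \<in> trigs L"
  using assms(1)
proof (induction rule: real_polynomial_function.induct)
  case (linear f)
  have "(\<lambda>x. f (s x)) = (\<lambda>x. f 1 * s x)"
  proof
    show "f (s x) = f 1 * s x" for x
      using linear_scale[OF bounded_linear.linear[OF linear], of "s x" 1] by (simp only: real_scaleR_def mult.commute mult_1)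
  qed
  then show ?case using trigs_scale[OF s, of "f 1"] by simp
next
  case (const c) show ?case by (rule trigs_const)
next
  case (add f g) then show ?case by (intro trigs.add)
next
  case (mult f g) then show ?case by (intro trigs_mult)
qed

text \<open>
  Steep ramps \<open>min 1 (max 0 (n t))\<close> tend to the indicator of \<open>t > 0\<close> at every point, zero included, and by the
  Weierstrass theorem each of them is within \<open>1/(n+1)\<close> of a polynomial on the range of \<open>s\<close>.
\<close>

lemma trigs_approx_superlevel:
  assumes s: "s \<in> trigs L" and bnd: "\<And>x. \<bar>s x\<bar> \<le> 2"
  obtains h :: "nat \<Rightarrow> real \<times> real \<Rightarrow> real" where "\<And>n. h n \<in> trigs L" "\<And>n x. \<bar>h n x\<bar> \<le> 2"
    "\<And>x. (\<lambda>n. h n x) \<longlonglongrightarrow> (if s x > 0 then 1 else 0)"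
proof -
  define \<psi> :: "nat \<Rightarrow> real \<Rightarrow> real" where "\<psi> n t = min 1 (max 0 (real n * t))" for n t
  have "\<exists>p. real_polynomial_function p \<and> (\<forall>t\<in>{-2..2}. \<bar>\<psi> n t - p t\<bar> < inverse (real (Suc n)))" for n
  proof -
    have "continuous_on {-2..2} (\<psi> n)" unfolding \<psi>_def by (intro continuous_intros)
    then obtain p where "real_polynomial_function p" "\<And>t. t \<in> {-2..2} \<Longrightarrow> \<bar>\<psi> n t - p t\<bar> < inverse (real (Suc n))"
      using Stone_Weierstrass_real_polynomial_function[of "{-2..2::real}" "\<psi> n" "inverse (real (Suc n))"]
      by (metis compact_Icc inverse_positive_iff_positive of_nat_0_less_iff zero_less_Suc)
    then show ?thesis by blast
  qed
  then obtain p where p: "\<And>n. real_polynomial_function (p n)"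
      "\<And>n t. t \<in> {-2..2} \<Longrightarrow> \<bar>\<psi> n t - p n t\<bar> < inverse (real (Suc n))"
    by metis
  have pb: "\<bar>\<psi> n (s x) - p n (s x)\<bar> < inverse (real (Suc n))" for n x
    using p(2)[of "s x" n] bnd[of x] by (auto simp: abs_le_iff)
  show ?thesis
  proof (rule that[of "\<lambda>n x. p n (s x)"])
    show "(\<lambda>x. p n (s x)) \<in> trigs L" for n by (rule trigs_polynomial[OF p(1) s])
    show "\<bar>p n (s x)\<bar> \<le> 2" for n x
    proof -
      have "inverse (real (Suc n)) \<le> 1" by (simp add: inverse_eq_divide)
      moreover have "\<bar>\<psi> n (s x)\<bar> \<le> 1" by (simp add: \<psi>_def)
      ultimately show ?thesis using pb[of n x] by linarith
    qed
    show "(\<lambda>n. p n (s x)) \<longlonglongrightarrow> (if s x > 0 then 1 else 0)" for x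
    proof -
      have "(\<lambda>n. \<psi> n (s x) - p n (s x)) \<longlonglongrightarrow> 0"
        by (rule Lim_null_comparison[OF _ LIMSEQ_inverse_real_of_nat])
           (use pb[of _ x] in \<open>auto intro!: always_eventually less_imp_le\<close>)
      moreover have "(\<lambda>n. \<psi> n (s x)) \<longlonglongrightarrow> (if s x > 0 then 1 else 0)"
      proof (cases "s x > 0")
        case True
        obtain N where N: "real N > 1 / s x" using reals_Archimedean2 by blast
        have "\<psi> n (s x) = 1" if "n \<ge> N" for n
        proof -
          have "1 / s x \<le> real n" using N that by linarith
          then have "1 \<le> real n * s x" using True by (simp add: field_simps)
          then show ?thesis by (simp add: \<psi>_def)
        qed
        then show ?thesis using True
          by (intro tendsto_eventually) (auto simp: eventually_sequentially)
      next
        case False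
        then have "real n * s x \<le> 0" for n
          by (simp add: mult_nonneg_nonpos)
        then have "\<psi> n (s x) = 0" for n
          by (simp add: \<psi>_def)
        then show ?thesis using False by simp
      qed
      ultimately have "(\<lambda>n. \<psi> n (s x) - (\<psi> n (s x) - p n (s x))) \<longlonglongrightarrow> (if s x > 0 then 1 else 0) - 0"
        by (intro tendsto_diff)
      then show ?thesis by simp
    qed
  qed
qed

text \<open>
  Within one period a shifted cosine exceeds a level exactly on an interval, so indicators of intervals
  are accessible through superlevel sets of trigonometric functions.
\<close>

lemma cos_superlevel_interval:
  fixes L a b x :: real
  assumes L: "L > 0" and "0 \<le> a" "a < b" "b \<le> L" "0 \<le> x" "x \<le> L"
  shows "cos (2*pi/L * (x - (a+b)/2)) > cos (2*pi/L * ((b-a)/2)) \<longleftrightarrow> a < x \<and> x < b"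
proof -
  define \<kappa> where "\<kappa> = 2*pi/L"
  define y h where "y = \<bar>x - (a+b)/2\<bar>" and "h = (b-a)/2"
  have \<kappa>: "\<kappa> > 0" "\<kappa> * L = 2*pi" using assms by (auto simp: \<kappa>_def)
  have h: "0 < h" "h \<le> L/2" and y: "0 \<le> y" "y \<le> L - h"
    using assms by (auto simp: y_def h_def abs_if field_simps)
  have kh: "0 \<le> \<kappa>*h" "\<kappa>*h \<le> pi"
    using h \<kappa> mult_left_mono[of h "L/2" \<kappa>] by auto
  have "cos (\<kappa> * (x - (a+b)/2)) = cos (\<kappa> * y)"
    using \<kappa>(1) cos_abs_real[of "\<kappa> * (x - (a+b)/2)"] by (simp add: y_def abs_mult)
  moreover have "cos (\<kappa> * y) > cos (\<kappa> * h) \<longleftrightarrow> y < h"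
  proof (cases "y \<le> L/2")
    case True
    then have "\<kappa>*y \<le> pi" using \<kappa> mult_left_mono[of y "L/2" \<kappa>] by auto
    then show ?thesis
      using cos_mono_less_eq[of "\<kappa>*h" "\<kappa>*y"] kh \<kappa> y by auto
  next
    case False
    have "\<kappa> * y = 2 * pi - \<kappa> * (L - y)" using \<kappa> by (simp add: algebra_simps)
    then have "cos (\<kappa> * y) = cos (\<kappa> * (L - y))" by (simp add: cos_diff)
    moreover have "cos (\<kappa> * (L - y)) \<le> cos (\<kappa> * h)"
    proof (rule cos_monotone_0_pi_le)
      show "\<kappa> * h \<le> \<kappa> * (L - y)" using \<kappa> y by (intro mult_left_mono) auto
      show "\<kappa> * (L - y) \<le> pi" using \<kappa> False mult_left_mono[of "L-y" "L/2" \<kappa>] by auto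
    qed (use kh in auto)
    ultimately show ?thesis using False h by auto
  qed
  moreover have "y < h \<longleftrightarrow> a < x \<and> x < b"
    by (auto simp: y_def h_def abs_if field_simps)
  ultimately show ?thesis by (simp add: \<kappa>_def h_def)
qed

lemma trigs_shifted_cos:
  "(\<lambda>x. cos (2*pi/L * (fst x - m)) - c) \<in> trigs L" "(\<lambda>x. cos (2*pi/L * (snd x - m)) - c) \<in> trigs L"
proof -
  have cos_shift: "cos (2*pi/L * (t - m)) = cos (2*pi/L*m) * cos (2*pi/L*t) + sin (2*pi/L*m) * sin (2*pi/L*t)" for t
    unfolding right_diff_distrib cos_diff by simp
  have axes: "cmode L (1,0) x = cos (2*pi/L * fst x)" "smode L (1,0) x = sin (2*pi/L * fst x)"
    "cmode L (0,1) x = cos (2*pi/L * snd x)" "smode L (0,1) x = sin (2*pi/L * snd x)" for x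
    by (simp_all add: cmode_def smode_def freq_def inner_prod_def)
  have "(\<lambda>x. (cos (2*pi/L*m) * cmode L k x + sin (2*pi/L*m) * smode L k x) + (- c)) \<in> trigs L" for k
    by (intro trigs.intros trigs_const)
  from this[of "(1,0)"] this[of "(0,1)"]
  show "(\<lambda>x. cos (2*pi/L * (fst x - m)) - c) \<in> trigs L" "(\<lambda>x. cos (2*pi/L * (snd x - m)) - c) \<in> trigs L"
    unfolding axes cos_shift by simp_all
qed

lemma integral_trigs_zero:
  assumes [measurable]: "f \<in> borel_measurable borel" and f: "set_integrable lborel (cell L) f"
    and orth: "\<And>k. (LINT x:cell L|lborel. f x * cmode L k x) = 0"
       "\<And>k. (LINT x:cell L|lborel. f x * smode L k x) = 0"
    and "h \<in> trigs L"
  shows "(LINT x:cell L|lborel. f x * h x) = 0"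
  using \<open>h \<in> trigs L\<close>
proof (induction rule: trigs.induct)
  case (add g h)
  then show ?case
    using set_integrable_cell_mult_continuous[OF assms(1) f trigs_continuous]
    by (simp add: distrib_left)
qed (simp_all add: orth mult.left_commute)

text \<open>
  Indicators of open rectangles in the cell are bounded pointwise limits of trigonometric polynomials, so
  \<open>f\<close> integrates to zero over all of them. A Dynkin argument extends this to all Borel sets, which forces
  \<open>f = 0\<close> almost everywhere.
\<close>

theorem trig_system_complete:
  fixes f :: "real \<times> real \<Rightarrow> real"
  assumes L: "L > 0" and per: "periodic L f"
    and meas [measurable]: "f \<in> borel_measurable borel" and f: "set_integrable lborel (cell L) f"
    and orth: "\<And>k. (LINT x:cell L|lborel. f x * cmode L k x) = 0"
       "\<And>k. (LINT x:cell L|lborel. f x * smode L k x) = 0"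
  shows "ae_eq f (\<lambda>x. 0)"
proof -
  define C where "C = box (0,0) (L,L)"
  have C: "C = {0<..<L} \<times> {0<..<L}" by (auto simp: C_def box_def Basis_plane)
  have [measurable]: "C \<in> sets borel" by (simp add: C_def)
  \<comment> \<open>The open cell is used because boxes meet it in boxes; the boundary is added as a null set at the end.\<close>
  define \<phi> where "\<phi> x = indicator C x * f x" for x
  have int: "integrable lborel (\<lambda>x. indicator (cell L) x * f x)"
    using f by (simp add: set_integrable_def)
  have [measurable]: "\<phi> \<in> borel_measurable borel"
    unfolding \<phi>_def[abs_def] by measurable
  have int_\<phi>: "integrable lborel \<phi>"
    by (rule Bochner_Integration.integrable_bound[OF int]) (auto simp: \<phi>_def C cell_def indicator_def)
  have rect: "(LINT x|lborel. indicator ({a<..<b} \<times> {c<..<d}) x * f x) = 0"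
    if "0 \<le> a" "a < b" "b \<le> L" "0 \<le> c" "c < d" "d \<le> L" for a b c d
  proof -
    define s1 s2 :: "real \<times> real \<Rightarrow> real" where "s1 x = cos (2*pi/L * (fst x - (a+b)/2)) - cos (2*pi/L * ((b-a)/2))"
      and "s2 x = cos (2*pi/L * (snd x - (c+d)/2)) - cos (2*pi/L * ((d-c)/2))" for x
    have s: "s1 \<in> trigs L" "s2 \<in> trigs L"
      unfolding s1_def[abs_def] s2_def[abs_def] by (rule trigs_shifted_cos)+
    have cb: "\<bar>cos u - cos v\<bar> \<le> 2" for u v :: real
      using abs_cos_le_one[of u] abs_cos_le_one[of v] by linarith
    obtain h1 where h1: "\<And>n. h1 n \<in> trigs L" "\<And>n x. \<bar>h1 n x\<bar> \<le> 2"
      "\<And>x. (\<lambda>n. h1 n x) \<longlonglongrightarrow> (if s1 x > 0 then 1 else 0)"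
      using trigs_approx_superlevel[OF s(1)] cb unfolding s1_def by metis
    obtain h2 where h2: "\<And>n. h2 n \<in> trigs L" "\<And>n x. \<bar>h2 n x\<bar> \<le> 2"
      "\<And>x. (\<lambda>n. h2 n x) \<longlonglongrightarrow> (if s2 x > 0 then 1 else 0)"
      using trigs_approx_superlevel[OF s(2)] cb unfolding s2_def by metis
    have [measurable]: "h1 n \<in> borel_measurable borel" "h2 n \<in> borel_measurable borel" for n
      using h1(1) h2(1) by (auto intro!: borel_measurable_continuous_onI trigs_continuous)
    have "(\<lambda>n. LINT x|lborel. indicator (cell L) x * (f x * (h1 n x * h2 n x))) \<longlonglongrightarrow>
        (LINT x|lborel. indicator ({a<..<b} \<times> {c<..<d}) x * f x)"
    proof (rule integral_dominated_convergence[where w="\<lambda>x. 4 * \<bar>indicator (cell L) x * f x\<bar>"])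
      show "AE x in lborel. (\<lambda>n. indicator (cell L) x * (f x * (h1 n x * h2 n x))) \<longlonglongrightarrow>
          indicator ({a<..<b} \<times> {c<..<d}) x * f x"
      proof (rule AE_I2)
        fix x :: "real \<times> real"
        have "(\<lambda>n. indicator (cell L) x * (f x * (h1 n x * h2 n x))) \<longlonglongrightarrow>
          indicator (cell L) x * (f x * ((if s1 x > 0 then 1 else 0) * (if s2 x > 0 then 1 else 0)))"
          by (intro tendsto_intros h1 h2)
        also have "indicator (cell L) x * (f x * ((if s1 x > 0 then 1 else 0) * (if s2 x > 0 then 1 else 0)))
          = indicator ({a<..<b} \<times> {c<..<d}) x * f x"
        proof (cases "x \<in> cell L")
          case True
          then have "s1 x > 0 \<longleftrightarrow> a < fst x \<and> fst x < b" "s2 x > 0 \<longleftrightarrow> c < snd x \<and> snd x < d"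
            using cos_superlevel_interval[of L a b "fst x"] cos_superlevel_interval[of L c d "snd x"] that L
            by (auto simp: s1_def s2_def cell_def)
          then show ?thesis using True by (cases x) (auto simp: indicator_def)
        next
          case False
          then show ?thesis using that by (cases x) (auto simp: indicator_def cell_def)
        qed
        finally show "(\<lambda>n. indicator (cell L) x * (f x * (h1 n x * h2 n x))) \<longlonglongrightarrow>
          indicator ({a<..<b} \<times> {c<..<d}) x * f x" .
      qed
      show "AE x in lborel. norm (indicator (cell L) x * (f x * (h1 n x * h2 n x))) \<le> 4 * \<bar>indicator (cell L) x * f x\<bar>" for n
      proof (rule AE_I2)
        fix x
        have "\<bar>h1 n x\<bar> * \<bar>h2 n x\<bar> \<le> 2 * 2" by (intro mult_mono h1 h2) auto
        then have "\<bar>indicator (cell L) x * f x\<bar> * (\<bar>h1 n x\<bar> * \<bar>h2 n x\<bar>) \<le> \<bar>indicator (cell L) x * f x\<bar> * 4"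
          by (intro mult_left_mono) auto
        then show "norm (indicator (cell L) x * (f x * (h1 n x * h2 n x))) \<le> 4 * \<bar>indicator (cell L) x * f x\<bar>"
          by (simp add: abs_mult mult_ac)
      qed
      show "(\<lambda>x. indicator ({a<..<b} \<times> {c<..<d}) x * f x) \<in> borel_measurable lborel"
        using borel_open[OF open_Times[OF open_greaterThanLessThan open_greaterThanLessThan], of a b c d] by simp
      show "(\<lambda>x. indicator (cell L) x * (f x * (h1 n x * h2 n x))) \<in> borel_measurable lborel" for n
        by simp
    qed (use int in auto)
    moreover have "(LINT x|lborel. indicator (cell L) x * (f x * (h1 n x * h2 n x))) = 0" for n
      using integral_trigs_zero[OF meas f orth trigs_mult[OF h2(1) h1(1), of n n]]
      by (simp add: set_lebesgue_integral_def)
    ultimately show ?thesis by (simp add: LIMSEQ_const_iff)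
  qed
  have box: "(LINT x|lborel. indicator (box a b) x * \<phi> x) = 0" for a b
  proof -
    obtain a1 a2 b1 b2 where ab: "a = (a1, a2)" "b = (b1, b2)" by (metis prod.collapse)
    have eq: "indicator (box a b) x * \<phi> x
        = indicator ({max a1 0<..<min b1 L} \<times> {max a2 0<..<min b2 L}) x * f x" for x
      by (cases x) (auto simp: \<phi>_def C ab box_def Basis_plane indicator_def)
    show ?thesis
    proof (cases "max a1 0 < min b1 L \<and> max a2 0 < min b2 L")
      case True
      then show ?thesis unfolding eq by (intro rect) auto
    next
      case False
      then have empty: "{max a1 0<..<min b1 L} \<times> {max a2 0<..<min b2 L} = {}" by force
      show ?thesis unfolding eq empty by simp
    qed
  qed
  have total: "(LINT x|lborel. \<phi> x) = 0"
  proof -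
    have "(LINT x|lborel. \<phi> x) = (LINT x|lborel. indicator (box (0,0) (L,L)) x * \<phi> x)"
      by (rule Bochner_Integration.integral_cong) (auto simp: \<phi>_def C_def indicator_def)
    then show ?thesis using box[of "(0,0)" "(L,L)"] by simp
  qed
  have all: "(LINT x|lborel. indicator A x * \<phi> x) = 0" if A: "A \<in> sets borel" for A
  proof -
    have "Int_stable (range (\<lambda>(a, b). box a b :: (real \<times> real) set))"
      by (auto simp: Int_stable_def box_Int_box)
    moreover have "(range (\<lambda>(a, b). box a b)) \<subseteq> Pow (UNIV :: (real \<times> real) set)"
      by auto
    moreover have "A \<in> sigma_sets UNIV (range (\<lambda>(a, b). box a b))"
      using A unfolding borel_eq_box by simp
    ultimately show ?thesis
    proof (induction rule: sigma_sets_induct_disjoint)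
      case (basic A) then show ?case using box by auto
    next
      case empty then show ?case by simp
    next
      case (compl A)
      then have [measurable]: "A \<in> sets borel" by (simp add: borel_eq_box)
      have "integrable lborel (\<lambda>x. indicator A x * \<phi> x)"
        using integrable_mult_indicator[of A lborel \<phi>] int_\<phi> by simp
      moreover have "(LINT x|lborel. indicator (UNIV - A) x * \<phi> x) = (LINT x|lborel. \<phi> x - indicator A x * \<phi> x)"
        by (rule Bochner_Integration.integral_cong) (auto simp: indicator_def)
      ultimately show ?case using int_\<phi> compl total by simp
    next
      case (union F)
      then have [measurable]: "\<And>i. F i \<in> sets borel" by (simp add: borel_eq_box subset_eq)
      have "(LINT x:(\<Union>i. F i)|lborel. \<phi> x) = (\<Sum>i. (LINT x:F i|lborel. \<phi> x))"
      proof (rule lebesgue_integral_countable_add)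
        show "set_integrable lborel (\<Union>i. F i) \<phi>"
          unfolding set_integrable_def using int_\<phi> by (intro integrable_mult_indicator) auto
        show "F i \<inter> F j = {}" if "i \<noteq> j" for i j
          using union(1) that by (auto simp: disjoint_family_on_def)
      qed simp
      then show ?case using union by (simp add: set_lebesgue_integral_def)
    qed
  qed
  have "AE x in lborel. \<phi> x = 0"
    by (rule sigma_finite_measure.density_zero[OF lborel.sigma_finite_measure_axioms int_\<phi>]) (use all in \<open>simp add: set_lebesgue_integral_def\<close>)
  moreover have "AE x in lborel. x \<notin> cell L - C"
  proof -
    have "cell L - C = cbox (0,0) (L,L) - box (0,0) (L,L)"
      by (auto simp: C_def cell_def cbox_Pair_eq)
    then have "negligible (cell L - C)" using negligible_frontier_interval by metis
    then have "cell L - C \<in> null_sets lborel"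
      by (simp add: negligible_iff_null_sets null_sets_completion_iff)
    then show ?thesis by (rule AE_not_in)
  qed
  ultimately have "AE x in lborel. x \<in> cell L \<longrightarrow> f x = 0"
    by eventually_elim (auto simp: \<phi>_def indicator_def)
  from periodic_AE_zero[OF L per this] show ?thesis by (simp add: ae_eq_def)
qed

section \<open>Orthonormal expansions\<close>

lemma norm_in_L2:
  assumes "f \<in> L2 L"
  shows "(\<lambda>x. norm (f x)) \<in> L2 L" "l2_norm L (\<lambda>x. norm (f x)) = l2_norm L f"
  using assms by (auto simp: L2_def periodic_def l2_norm_def l2_inner_def power2_eq_square[symmetric] power2_norm_eq_inner)

lemma L1_le_l2_norm:
  assumes f: "f \<in> L2 L"
  shows "(LINT x:cell L|lborel. norm (f x)) \<le> l2_norm L f * l2_norm L (\<lambda>x. 1::real)"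
proof -
  have "(\<lambda>x. 1::real) \<in> L2 L" by (rule L2_I_continuous) (auto simp: periodic_def)
  from l2_Cauchy_Schwarz[OF norm_in_L2(1)[OF f] this] show ?thesis
    using norm_in_L2(2)[OF f] by (simp add: l2_inner_def)
qed

lemma nn_integral_l2_norm:
  assumes f: "f \<in> L2 L"
  shows "(\<integral>\<^sup>+x. ennreal (indicator (cell L) x * (norm (f x))\<^sup>2) \<partial>lborel) = ennreal ((l2_norm L f)\<^sup>2)"
proof -
  have "integrable lborel (\<lambda>x. indicator (cell L) x * (norm (f x))\<^sup>2)"
    using f by (simp add: L2_def set_integrable_def)
  then show ?thesis
    by (subst nn_integral_eq_integral)
       (auto simp: l2_norm_sq l2_inner_def set_lebesgue_integral_def power2_norm_eq_inner)
qed

text \<open>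
  The limit is given as the pointwise limit of a subsequence, not just as some function: being periodic,
  Borel, or a function of \<open>x\<^sub>1\<close> alone then passes to the limit at every point of the plane. Almost
  everywhere convergence on the cell comes from \<open>L\<^sup>1\<close>, and Fatou's lemma upgrades it to the \<open>L\<^sup>2\<close> norm.
\<close>

theorem L2_complete:
  fixes s :: "nat \<Rightarrow> real \<times> real \<Rightarrow> 'b::euclidean_space"
  assumes s: "\<And>n. s n \<in> L2 L"
    and cauchy: "\<And>e. e > 0 \<Longrightarrow> \<exists>N. \<forall>i\<ge>N. \<forall>j\<ge>N. l2_norm L (\<lambda>x. s i x - s j x) < e"
  obtains r where "(\<lambda>x. lim (\<lambda>k. s (r k) x)) \<in> L2 L"
    "(\<lambda>n. l2_norm L (\<lambda>x. lim (\<lambda>k. s (r k) x) - s n x)) \<longlonglongrightarrow> 0"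
proof -
  note [measurable] = L2_D[OF s]
  define S where "S n x = indicator (cell L) x *\<^sub>R s n x" for n x
  have int: "integrable lborel (S n)" for n
    using norm_integrable_L2[OF s[of n]] by (simp add: S_def[abs_def] set_integrable_def)
  have L1: "\<exists>N. \<forall>i\<ge>N. \<forall>j\<ge>N. (LINT x|lborel. norm (S i x - S j x)) < e" if "e > 0" for e
  proof -
    define c where "c = l2_norm L (\<lambda>x. 1::real) + 1"
    have c: "c > 0" using l2_norm_nonneg[of L "\<lambda>x. 1::real"] by (simp add: c_def)
    then obtain N where N: "\<And>i j. i \<ge> N \<Longrightarrow> j \<ge> N \<Longrightarrow> l2_norm L (\<lambda>x. s i x - s j x) < e / c"
      using cauchy[of "e / c"] \<open>e > 0\<close> by auto
    have "(LINT x|lborel. norm (S i x - S j x)) < e" if ij: "i \<ge> N" "j \<ge> N" for i j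
    proof -
      have "norm (S i x - S j x) = indicator (cell L) x * norm (s i x - s j x)" for x
        by (simp add: S_def indicator_def)
      then have "(LINT x|lborel. norm (S i x - S j x)) = (LINT x:cell L|lborel. norm (s i x - s j x))"
        by (simp add: set_lebesgue_integral_def)
      also have "\<dots> \<le> l2_norm L (\<lambda>x. s i x - s j x) * l2_norm L (\<lambda>x. 1::real)"
        by (rule L1_le_l2_norm[OF L2_diff[OF s s]])
      also have "\<dots> \<le> l2_norm L (\<lambda>x. s i x - s j x) * c"
        by (intro mult_left_mono l2_norm_nonneg) (simp add: c_def)
      also have "\<dots> < e" using N[OF ij] c by (simp add: pos_less_divide_eq)
      finally show ?thesis .
    qed
    then show ?thesis by blast
  qed
  obtain r where r: "strict_mono r" "AE x in lborel. Cauchy (\<lambda>i. S (r i) x)"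
    by (rule cauchy_L1_AE_cauchy_subseq[OF int L1])
  define f where "f x = lim (\<lambda>k. s (r k) x)" for x
  have [measurable]: "f \<in> borel_measurable borel" unfolding f_def[abs_def] by measurable
  have conv: "AE x in lborel. x \<in> cell L \<longrightarrow> (\<lambda>k. s (r k) x) \<longlonglongrightarrow> f x"
    using r(2)
  proof eventually_elim
    case (elim x)
    show ?case
    proof
      assume "x \<in> cell L"
      with elim have "Cauchy (\<lambda>i. s (r i) x)" by (simp add: S_def)
      then show "(\<lambda>k. s (r k) x) \<longlonglongrightarrow> f x"
        unfolding f_def by (simp only: Cauchy_convergent_iff convergent_LIMSEQ_iff)
    qed
  qed
  have per: "periodic L f"
    using L2_periodic[OF s] by (simp add: periodic_def f_def)
  have bound: "(\<lambda>x. f x - s n x) \<in> L2 L \<and> l2_norm L (\<lambda>x. f x - s n x) \<le> e"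
    if "e > 0" and N: "\<And>i. i \<ge> N \<Longrightarrow> l2_norm L (\<lambda>x. s i x - s n x) < e" for e n N
  proof -
    let ?F = "\<lambda>x. ennreal (indicator (cell L) x * (norm (f x - s n x))\<^sup>2)"
    let ?G = "\<lambda>k x. ennreal (indicator (cell L) x * (norm (s (r k) x - s n x))\<^sup>2)"
    have "(\<integral>\<^sup>+x. ?F x \<partial>lborel) = (\<integral>\<^sup>+x. liminf (\<lambda>k. ?G k x) \<partial>lborel)"
    proof (rule nn_integral_cong_AE)
      show "AE x in lborel. ?F x = liminf (\<lambda>k. ?G k x)"
        using conv
      proof eventually_elim
        case (elim x)
        have "(\<lambda>k. ?G k x) \<longlonglongrightarrow> ?F x"
        proof (cases "x \<in> cell L")
          case True
          with elim show ?thesis by (intro tendsto_ennrealI tendsto_intros) auto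
        qed simp
        then show ?case by (rule lim_imp_Liminf[OF trivial_limit_sequentially, symmetric])
      qed
    qed
    also have "\<dots> \<le> liminf (\<lambda>k. \<integral>\<^sup>+x. ?G k x \<partial>lborel)"
      by (rule nn_integral_liminf) measurable
    also have "\<dots> \<le> ennreal (e\<^sup>2)"
    proof (rule Liminf_le)
      have "\<forall>\<^sub>F k in sequentially. r k \<ge> N"
        using filterlim_subseq[OF r(1)] by (simp add: filterlim_at_top)
      then show "\<forall>\<^sub>F k in sequentially. (\<integral>\<^sup>+x. ?G k x \<partial>lborel) \<le> ennreal (e\<^sup>2)"
      proof eventually_elim
        case (elim k)
        have "(l2_norm L (\<lambda>x. s (r k) x - s n x))\<^sup>2 \<le> e\<^sup>2"
          using N[OF elim] l2_norm_nonneg by (intro power_mono) auto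
        then show ?case
          by (subst nn_integral_l2_norm[OF L2_diff[OF s s]]) (simp add: ennreal_leI)
      qed
    qed simp
    finally have le: "(\<integral>\<^sup>+x. ?F x \<partial>lborel) \<le> ennreal (e\<^sup>2)" .
    have "integrable lborel (\<lambda>x. indicator (cell L) x * (norm (f x - s n x))\<^sup>2)"
      by (rule integrableI_nonneg) (use le_less_trans[OF le] in simp_all)
    then have mem: "(\<lambda>x. f x - s n x) \<in> L2 L"
      using per L2_periodic[OF s[of n]] by (auto simp: L2_def set_integrable_def periodic_def)
    have "(l2_norm L (\<lambda>x. f x - s n x))\<^sup>2 \<le> e\<^sup>2"
      using le by (subst (asm) nn_integral_l2_norm[OF mem]) (simp add: ennreal_le_iff)
    then have "l2_norm L (\<lambda>x. f x - s n x) \<le> e" by (rule power2_le_imp_le) (use \<open>e > 0\<close> in simp)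
    with mem show ?thesis ..
  qed
  have fL2: "f \<in> L2 L"
  proof -
    obtain N where "\<And>i j. i \<ge> N \<Longrightarrow> j \<ge> N \<Longrightarrow> l2_norm L (\<lambda>x. s i x - s j x) < 1"
      using cauchy[of 1] by auto
    then have "(\<lambda>x. f x - s N x) \<in> L2 L" using bound[of 1 N N] by simp
    from L2_add[OF this s[of N]] show ?thesis by simp
  qed
  have "(\<lambda>n. l2_norm L (\<lambda>x. f x - s n x)) \<longlonglongrightarrow> 0"
  proof (rule LIMSEQ_I)
    fix e :: real assume "e > 0"
    then obtain N where N: "\<And>i j. i \<ge> N \<Longrightarrow> j \<ge> N \<Longrightarrow> l2_norm L (\<lambda>x. s i x - s j x) < e / 2"
      using cauchy[of "e / 2"] by auto
    have "norm (l2_norm L (\<lambda>x. f x - s n x) - 0) < e" if "n \<ge> N" for n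
      using bound[of "e / 2" N n] N[OF _ that] \<open>e > 0\<close> l2_norm_nonneg[of L "\<lambda>x. f x - s n x"] by simp
    then show "\<exists>N. \<forall>n\<ge>N. norm (l2_norm L (\<lambda>x. f x - s n x) - 0) < e" by blast
  qed
  with fL2 show ?thesis using that[of r] unfolding f_def[abs_def] by blast
qed

lemma l2_norm_tendsto:
  assumes "\<And>n. s n \<in> L2 L" "f \<in> L2 L" and lim: "(\<lambda>n. l2_norm L (\<lambda>x. f x - s n x)) \<longlonglongrightarrow> 0"
  shows "(\<lambda>n. l2_norm L (s n)) \<longlonglongrightarrow> l2_norm L f"
proof -
  have "norm (l2_norm L f - l2_norm L (s n)) \<le> l2_norm L (\<lambda>x. f x - s n x)" for n
    using l2_norm_triangle[OF assms(1)[of n] L2_diff[OF assms(2) assms(1)[of n]]]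
      l2_norm_triangle[OF assms(2) L2_diff[OF assms(1)[of n] assms(2)]]
      l2_norm_minus_commute[of L f "s n"]
    by simp
  then have "(\<lambda>n. l2_norm L f - l2_norm L (s n)) \<longlonglongrightarrow> 0"
    by (intro Lim_null_comparison[OF _ lim] always_eventually allI)
  from tendsto_diff[OF tendsto_const[of "l2_norm L f"] this] show ?thesis by simp
qed

locale orthonormal_sequence =
  fixes L :: real and e :: "nat \<Rightarrow> real \<times> real \<Rightarrow> real"
  assumes e_L2: "e n \<in> L2 L"
    and orthonormal: "l2_inner L (e m) (e n) = (if m = n then 1 else 0)"
begin

lemma combination_L2: "(\<lambda>x. \<Sum>n\<in>A. c n * e n x) \<in> L2 L"
  using L2_scaleR[OF e_L2] by (intro L2_sum) simp

lemma inner_combination: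
  assumes "finite A"
  shows "l2_inner L (\<lambda>x. \<Sum>n\<in>A. c n * e n x) (e m) = (if m \<in> A then c m else 0)"
proof -
  have "l2_inner L (\<lambda>x. \<Sum>n\<in>A. c n * e n x) (e m) = (\<Sum>n\<in>A. c n * l2_inner L (e n) (e m))"
    using L2_scaleR[OF e_L2] l2_inner_scaleR_left[of L _ "e _" "e m"]
    by (subst l2_inner_sum_left) (simp_all add: e_L2)
  also have "\<dots> = (\<Sum>n\<in>A. if n = m then c n else 0)"
    by (intro sum.cong) (auto simp: orthonormal)
  finally show ?thesis using assms by simp
qed

lemma norm_combination:
  assumes "finite A"
  shows "(l2_norm L (\<lambda>x. \<Sum>n\<in>A. c n * e n x))\<^sup>2 = (\<Sum>n\<in>A. (c n)\<^sup>2)"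
proof -
  have "(l2_norm L (\<lambda>x. \<Sum>n\<in>A. c n * e n x))\<^sup>2
      = (\<Sum>n\<in>A. l2_inner L (\<lambda>x. c n * e n x) (\<lambda>x. \<Sum>n\<in>A. c n * e n x))"
    unfolding l2_norm_sq using L2_scaleR[OF e_L2] by (subst l2_inner_sum_left) (simp_all add: combination_L2)
  also have "\<dots> = (\<Sum>n\<in>A. c n * l2_inner L (\<lambda>x. \<Sum>n\<in>A. c n * e n x) (e n))"
    using l2_inner_scaleR_left[of L _ "e _"] by (simp add: l2_inner_commute[of L "e _"])
  also have "\<dots> = (\<Sum>n\<in>A. (c n)\<^sup>2)"
    using assms by (intro sum.cong) (simp_all add: inner_combination power2_eq_square)
  finally show ?thesis .
qed

lemma bessel:
  assumes f: "f \<in> L2 L"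
  shows "summable (\<lambda>n. (l2_inner L f (e n))\<^sup>2)" "(\<Sum>n. (l2_inner L f (e n))\<^sup>2) \<le> (l2_norm L f)\<^sup>2"
proof -
  define c where "c n = l2_inner L f (e n)" for n
  have le: "(\<Sum>n<N. (c n)\<^sup>2) \<le> (l2_norm L f)\<^sup>2" for N
  proof -
    let ?S = "\<lambda>x. \<Sum>n<N. c n * e n x"
    have "l2_inner L ?S f = (\<Sum>n<N. l2_inner L (\<lambda>x. c n * e n x) f)"
      using L2_scaleR[OF e_L2] by (subst l2_inner_sum_left) (simp_all add: f)
    also have "\<dots> = (\<Sum>n<N. (c n)\<^sup>2)"
      using l2_inner_scaleR_left[of L _ "e _" f]
      by (intro sum.cong) (simp_all add: c_def l2_inner_commute[of L "e _"] power2_eq_square)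
    finally have "l2_inner L f ?S = (\<Sum>n<N. (c n)\<^sup>2)" by (simp add: l2_inner_commute)
    then show ?thesis
      using l2_norm_sq_add[OF f L2_scaleR[OF combination_L2[of c "{..<N}"], of "-1"]]
        norm_combination[of "{..<N}" c] l2_norm_scaleR[of L "-1" ?S]
        l2_inner_scaleR_right[of L f "-1" ?S] zero_le_power2[of "l2_norm L (\<lambda>x. f x + (-1) *\<^sub>R ?S x)"]
      by simp
  qed
  show s: "summable (\<lambda>n. (l2_inner L f (e n))\<^sup>2)"
    using le by (intro summableI_nonneg_bounded[where x="(l2_norm L f)\<^sup>2"]) (auto simp: c_def)
  show "(\<Sum>n. (l2_inner L f (e n))\<^sup>2) \<le> (l2_norm L f)\<^sup>2"
    using le by (intro suminf_le_const s) (auto simp: c_def)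
qed

theorem riesz_fischer:
  assumes c: "summable (\<lambda>n. (c n)\<^sup>2)"
  obtains r where "(\<lambda>x. lim (\<lambda>k. \<Sum>n<r k. c n * e n x)) \<in> L2 L"
    "(\<lambda>N. l2_norm L (\<lambda>x. lim (\<lambda>k. \<Sum>n<r k. c n * e n x) - (\<Sum>n<N. c n * e n x))) \<longlonglongrightarrow> 0"
proof -
  define s where "s N x = (\<Sum>n<N. c n * e n x)" for N x
  have dist: "(l2_norm L (\<lambda>x. s i x - s j x))\<^sup>2 = (\<Sum>n\<in>{j..<i}. (c n)\<^sup>2)" if "j \<le> i" for i j
  proof -
    have "s i x - s j x = (\<Sum>n\<in>{j..<i}. c n * e n x)" for x
      using sum_diff_nat_ivl[of 0 j i "\<lambda>n. c n * e n x"] that by (simp add: s_def lessThan_atLeast0)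
    then show ?thesis using norm_combination[of "{j..<i}" c] by simp
  qed
  have "\<exists>N. \<forall>i\<ge>N. \<forall>j\<ge>N. l2_norm L (\<lambda>x. s i x - s j x) < d" if "d > 0" for d
  proof -
    obtain N where N: "\<And>m n. m \<ge> N \<Longrightarrow> norm (\<Sum>n\<in>{m..<n}. (c n)\<^sup>2) < d\<^sup>2"
      using c[unfolded summable_Cauchy] \<open>d > 0\<close> by (meson zero_less_power)
    have half: "l2_norm L (\<lambda>x. s i x - s j x) < d" if "j \<ge> N" "j \<le> i" for i j
    proof (rule power2_less_imp_less)
      show "(l2_norm L (\<lambda>x. s i x - s j x))\<^sup>2 < d\<^sup>2"
        using N[of j i] that by (simp add: dist sum_nonneg)
    qed (use \<open>d > 0\<close> in simp)
    have "l2_norm L (\<lambda>x. s i x - s j x) < d" if "i \<ge> N" "j \<ge> N" for i j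
      using half[of j i] half[of i j] l2_norm_minus_commute[of L "s i" "s j"] that by (cases "j \<le> i") auto
    then show ?thesis by blast
  qed
  moreover have "s n \<in> L2 L" for n unfolding s_def[abs_def] by (rule combination_L2)
  ultimately obtain r where "(\<lambda>x. lim (\<lambda>k. s (r k) x)) \<in> L2 L"
    "(\<lambda>n. l2_norm L (\<lambda>x. lim (\<lambda>k. s (r k) x) - s n x)) \<longlonglongrightarrow> 0"
    using L2_complete[of s L] by blast
  then show ?thesis using that[of r] by (simp add: s_def)
qed

lemma coefficient_of_limit:
  assumes f: "f \<in> L2 L" and lim: "(\<lambda>N. l2_norm L (\<lambda>x. f x - (\<Sum>n<N. c n * e n x))) \<longlonglongrightarrow> 0"
  shows "l2_inner L f (e m) = c m"
proof (rule LIMSEQ_unique)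
  show "(\<lambda>N. l2_inner L (\<lambda>x. \<Sum>n<N. c n * e n x) (e m)) \<longlonglongrightarrow> l2_inner L f (e m)"
    by (rule l2_inner_tendsto[OF combination_L2 f e_L2 lim])
  have "\<forall>\<^sub>F N in sequentially. l2_inner L (\<lambda>x. \<Sum>n<N. c n * e n x) (e m) = c m"
    using eventually_gt_at_top[of m] by eventually_elim (simp add: inner_combination)
  then show "(\<lambda>N. l2_inner L (\<lambda>x. \<Sum>n<N. c n * e n x) (e m)) \<longlonglongrightarrow> c m"
    by (rule tendsto_eventually)
qed

lemma parseval_limit:
  assumes f: "f \<in> L2 L" and lim: "(\<lambda>N. l2_norm L (\<lambda>x. f x - (\<Sum>n<N. c n * e n x))) \<longlonglongrightarrow> 0"
  shows "(\<lambda>n. (c n)\<^sup>2) sums (l2_norm L f)\<^sup>2"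
  using tendsto_power[OF l2_norm_tendsto[OF combination_L2 f lim], of 2]
  by (simp add: norm_combination sums_def)

end

section \<open>Horizontal Fourier series\<close>

text \<open>
  The horizontal modes are enumerated as cosine, sine, cosine, sine, with the wave numbers
  \<open>1, 1, 2, 2\<close> and so on. The factor \<open>sqrt 2 / L\<close> normalises them on the two-dimensional cell.
\<close>

definition wave :: "nat \<Rightarrow> int \<times> int" where
  "wave n = (int (n div 2) + 1, 0)"

definition hmode :: "real \<Rightarrow> nat \<Rightarrow> real \<times> real \<Rightarrow> real" where
  "hmode L n x = sqrt 2 / L * (if even n then cmode L (wave n) x else smode L (wave n) x)"

lemma hmode_even: "even n \<Longrightarrow> hmode L n = (\<lambda>x. (sqrt 2 / L) *\<^sub>R cmode L (wave n) x)"
  and hmode_odd: "odd n \<Longrightarrow> hmode L n = (\<lambda>x. (sqrt 2 / L) *\<^sub>R smode L (wave n) x)"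
  by (auto simp: hmode_def)

lemma wave_eqs: "wave m = wave n \<longleftrightarrow> m div 2 = n div 2" "wave m \<noteq> - wave n" "wave n \<noteq> 0" "snd (wave n) = 0"
  by (auto simp: wave_def prod_eq_iff)

lemma hmode_L2: "L > 0 \<Longrightarrow> hmode L n \<in> L2 L"
  by (cases "even n") (auto simp: hmode_even hmode_odd simp del: real_scaleR_def intro!: L2_scaleR L2_mode)

lemma hmode_orthonormal:
  assumes L: "L > 0"
  shows "l2_inner L (hmode L m) (hmode L n) = (if m = n then 1 else 0)"
proof -
  have "m = n \<longleftrightarrow> m div 2 = n div 2 \<and> even m = even n"
    by (metis dvd_mult_div_cancel odd_two_times_div_two_succ)
  then show ?thesis
    using assms
    by (cases "even m"; cases "even n")
       (auto simp: hmode_even hmode_odd l2_inner_scaleR_left l2_inner_scaleR_right l2_inner_mode wave_eqs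
         power2_eq_square simp del: real_scaleR_def)
qed

lemma hmode_orthonormal_sequence: "L > 0 \<Longrightarrow> orthonormal_sequence L (hmode L)"
  by standard (auto simp: hmode_L2 hmode_orthonormal)

text \<open>
  Being a mean-free function of \<open>x\<^sub>1\<close>, expressed through Fourier coefficients. In this form the property
  passes from a profile to its weak derivative, which is only given as a function of both variables.
\<close>

definition horizontal :: "real \<Rightarrow> (real \<times> real \<Rightarrow> real) \<Rightarrow> bool" where
  "horizontal L f \<longleftrightarrow> f \<in> L2 L \<and>
     (\<forall>k. fst k = 0 \<or> snd k \<noteq> 0 \<longrightarrow> l2_inner L f (cmode L k) = 0 \<and> l2_inner L f (smode L k) = 0)"

text \<open>
  A mode that oscillates in \<open>x\<^sub>2\<close> is the derivative in \<open>x\<^sub>2\<close> of another mode.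
\<close>

lemma horizontal_zero_frequency:
  assumes L: "L > 0" and f: "f \<in> borel_measurable borel" "set_integrable lborel (cell L) f"
    and ae: "ae_eq f (\<lambda>x. g (fst x))" and "snd k \<noteq> 0"
  shows "l2_inner L f (cmode L k) = 0" "l2_inner L f (smode L k) = 0"
proof -
  have nz: "freq L k \<bullet> (0, 1) \<noteq> 0" using assms by (simp add: freq_def)
  have "(LINT x:cell L|lborel. f x * pd (0, 1) (smode L k) x) = (freq L k \<bullet> (0, 1)) * l2_inner L f (cmode L k)"
  proof -
    have "f x * ((freq L k \<bullet> (0, 1)) * cmode L k x) = (freq L k \<bullet> (0, 1)) * (f x * cmode L k x)" for x
      by simp
    then show ?thesis by (simp only: pd_mode l2_inner_def set_integral_mult_right inner_real_def)
  qed
  moreover have "(LINT x:cell L|lborel. f x * pd (0, 1) (smode L k) x) = 0"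
    by (rule integral_horizontal_pd[OF L C1_mode(2) periodic_mode(2)[OF L] f ae])
  ultimately show "l2_inner L f (cmode L k) = 0" using nz by simp
  have "f x * (- (freq L k \<bullet> (0, 1)) * smode L k x) = - (freq L k \<bullet> (0, 1)) * (f x * smode L k x)" for x
    by simp
  then have "(LINT x:cell L|lborel. f x * pd (0, 1) (cmode L k) x)
    = (LINT x:cell L|lborel. - (freq L k \<bullet> (0, 1)) * (f x * smode L k x))"
    by (simp only: pd_mode)
  also have "\<dots> = - (freq L k \<bullet> (0, 1)) * l2_inner L f (smode L k)"
    unfolding set_integral_mult_right by (simp add: l2_inner_def)
  finally have "(LINT x:cell L|lborel. f x * pd (0, 1) (cmode L k) x) = - (freq L k \<bullet> (0, 1)) * l2_inner L f (smode L k)" .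
  moreover have "(LINT x:cell L|lborel. f x * pd (0, 1) (cmode L k) x) = 0"
    by (rule integral_horizontal_pd[OF L C1_mode(1) periodic_mode(1)[OF L] f ae])
  ultimately show "l2_inner L f (smode L k) = 0" using nz by simp
qed

lemma mode_zero: "cmode L 0 = (\<lambda>x. 1)" "smode L 0 = (\<lambda>x. 0)"
  by (auto simp: cmode_def smode_def freq_arith)

lemma L2_0H_horizontal:
  assumes L: "L > 0" and "f \<in> L2_0H L"
  shows "horizontal L f"
proof -
  obtain g where f: "f \<in> L2 L" "mean_free L f" "ae_eq f (\<lambda>x. g (fst x))"
    using assms by (auto simp: L2_0H_def L2_0_def)
  have "l2_inner L f (cmode L k) = 0 \<and> l2_inner L f (smode L k) = 0" if "fst k = 0 \<or> snd k \<noteq> 0" for k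
  proof (cases "snd k = 0")
    case True
    then have "k = 0" using that by (auto simp: prod_eq_iff)
    then show ?thesis using f(2) by (simp add: mode_zero l2_inner_def mean_free_def)
  next
    case False
    then show ?thesis
      using horizontal_zero_frequency[OF L L2_D[OF f(1)] norm_integrable_L2[OF f(1)] f(3)] by auto
  qed
  with f(1) show ?thesis by (simp add: horizontal_def)
qed

lemma hmode_inner_mode:
  assumes L: "L > 0" and "fst k = 0 \<or> snd k \<noteq> 0"
  shows "l2_inner L (hmode L n) (cmode L k) = 0" "l2_inner L (hmode L n) (smode L k) = 0"
proof -
  have "wave n \<noteq> k" "wave n \<noteq> - k" using assms(2) by (auto simp: wave_def prod_eq_iff)
  then show "l2_inner L (hmode L n) (cmode L k) = 0" "l2_inner L (hmode L n) (smode L k) = 0"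
    using assms(1) by (cases "even n";
      simp add: hmode_even hmode_odd l2_inner_scaleR_left l2_inner_mode del: real_scaleR_def)+
qed

lemma mode_uminus: "cmode L (- k) = cmode L k" "smode L (- k) = (\<lambda>x. - 1 *\<^sub>R smode L k x)"
  by (auto simp: cmode_def smode_def freq_arith)

text \<open>
  By Bessel's inequality and completeness of \<open>L\<^sup>2\<close> the Fourier series has a limit; what \<open>f\<close> and that limit
  differ by is orthogonal to the horizontal modes and, both being horizontal, to all other modes.
\<close>

theorem horizontal_expansion:
  assumes L: "L > 0" and hor: "horizontal L f"
  shows "(\<lambda>N. l2_norm L (\<lambda>x. f x - (\<Sum>n<N. l2_inner L f (hmode L n) * hmode L n x))) \<longlonglongrightarrow> 0"
proof -
  interpret orthonormal_sequence L "hmode L" by (rule hmode_orthonormal_sequence[OF L])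
  have f: "f \<in> L2 L" using hor by (simp add: horizontal_def)
  define c where "c n = l2_inner L f (hmode L n)" for n
  have "summable (\<lambda>n. (c n)\<^sup>2)" unfolding c_def by (rule bessel(1)[OF f])
  then obtain r where r: "(\<lambda>x. lim (\<lambda>k. \<Sum>n<r k. c n * hmode L n x)) \<in> L2 L"
    "(\<lambda>N. l2_norm L (\<lambda>x. lim (\<lambda>k. \<Sum>n<r k. c n * hmode L n x) - (\<Sum>n<N. c n * hmode L n x))) \<longlonglongrightarrow> 0"
    by (rule riesz_fischer)
  define h where "h x = lim (\<lambda>k. \<Sum>n<r k. c n * hmode L n x)" for x
  have h: "h \<in> L2 L" "(\<lambda>N. l2_norm L (\<lambda>x. h x - (\<Sum>n<N. c n * hmode L n x))) \<longlonglongrightarrow> 0"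
    using r by (simp_all add: h_def[abs_def])
  define d where "d x = f x - h x" for x
  have d: "d \<in> L2 L" unfolding d_def[abs_def] by (intro L2_diff f h)
  have d_inner: "l2_inner L d g = l2_inner L f g - l2_inner L h g" if "g \<in> L2 L" for g
    unfolding d_def[abs_def] by (intro l2_inner_diff_left f h that)
  have d_hmode: "l2_inner L d (hmode L n) = 0" for n
    using coefficient_of_limit[OF h] by (simp add: d_inner hmode_L2[OF L] c_def)
  have h_mode: "l2_inner L h m = 0" if "m \<in> L2 L" "\<And>n. l2_inner L (hmode L n) m = 0" for m
  proof (rule LIMSEQ_unique)
    show "(\<lambda>N. l2_inner L (\<lambda>x. \<Sum>n<N. c n * hmode L n x) m) \<longlonglongrightarrow> l2_inner L h m"
      by (rule l2_inner_tendsto[OF combination_L2 h(1) that(1) h(2)])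
    have "l2_inner L (\<lambda>x. \<Sum>n<N. c n * hmode L n x) m = 0" for N
      using L2_scaleR[OF e_L2] l2_inner_scaleR_left[of L _ "hmode L _" m] that
      by (subst l2_inner_sum_left) simp_all
    then show "(\<lambda>N. l2_inner L (\<lambda>x. \<Sum>n<N. c n * hmode L n x) m) \<longlonglongrightarrow> 0" by simp
  qed
  have pos: "l2_inner L d (cmode L k) = 0 \<and> l2_inner L d (smode L k) = 0" if "fst k > 0" "snd k = 0" for k
  proof -
    define n where "n = 2 * nat (fst k - 1)"
    have w: "wave n = k" "wave (Suc n) = k" using that by (auto simp: n_def wave_def prod_eq_iff)
    have "even n" "odd (Suc n)" by (auto simp: n_def)
    then show ?thesis
      using d_hmode[of n] d_hmode[of "Suc n"] L w
      by (simp add: hmode_even hmode_odd l2_inner_scaleR_right del: real_scaleR_def)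
  qed
  have all: "l2_inner L d (cmode L k) = 0 \<and> l2_inner L d (smode L k) = 0" for k
  proof -
    consider "fst k = 0 \<or> snd k \<noteq> 0" | "fst k > 0" "snd k = 0" | "fst (- k) > 0" "snd (- k) = 0" by fastforce
    then show ?thesis
    proof cases
      case 1
      then have "l2_inner L f (cmode L k) = 0" "l2_inner L f (smode L k) = 0"
        using hor unfolding horizontal_def by blast+
      then show ?thesis
        using h_mode[OF L2_mode(1) hmode_inner_mode(1)[OF _ 1]] h_mode[OF L2_mode(2) hmode_inner_mode(2)[OF _ 1]]
          L by (simp add: d_inner L2_mode)
    next
      case 2 then show ?thesis using pos by auto
    next
      case 3
      from pos[OF this] show ?thesis
        unfolding mode_uminus l2_inner_scaleR_right by simp
    qed
  qed
  have "ae_eq d (\<lambda>x. 0)"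
    by (rule trig_system_complete[OF L L2_periodic[OF d] L2_D[OF d] norm_integrable_L2[OF d]])
       (use all in \<open>simp_all add: l2_inner_def\<close>)
  then have eq: "AE x in lborel. f x = h x" by (simp add: ae_eq_def d_def)
  have "l2_norm L (\<lambda>x. f x - (\<Sum>n<N. c n * hmode L n x)) = l2_norm L (\<lambda>x. h x - (\<Sum>n<N. c n * hmode L n x))" for N
  proof (rule l2_norm_cong_ae)
    show "ae_eq (\<lambda>x. f x - (\<Sum>n<N. c n * hmode L n x)) (\<lambda>x. h x - (\<Sum>n<N. c n * hmode L n x))"
      using eq by (auto simp: ae_eq_def)
  qed (rule L2_D[OF L2_diff[OF f combination_L2]] L2_D[OF L2_diff[OF h(1) combination_L2]])+
  then show ?thesis using h(2) by (simp add: c_def)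
qed

section \<open>Weak derivatives\<close>

lemma periodic_pd:
  assumes "C1 f" "periodic L f"
  shows "periodic L (pd b f)"
proof -
  have "pd b f (x + a) = pd b f x" if a: "\<And>y. f (y + a) = f y" for a x
  proof -
    have "((\<lambda>y. f (y + a)) has_derivative (\<lambda>h. pd h f (x + a))) (at x)"
      by (rule has_derivative_compose[where g=f and f="\<lambda>y. y + a", OF _ C1_has_derivative[OF assms(1)]])
         (intro has_derivative_add_const has_derivative_ident)
    then have "(f has_derivative (\<lambda>h. pd h f (x + a))) (at x)" by (simp only: a)
    from frechet_derivative_at[OF this] show ?thesis by (metis pd_def)
  qed
  then show ?thesis using assms(2) unfolding periodic_def by blast
qed

lemma set_integrable_scaleR_L2:
  fixes f :: "real \<times> real \<Rightarrow> 'b::euclidean_space" and \<phi> :: "real \<times> real \<Rightarrow> real"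
  assumes f: "f \<in> L2 L" and \<phi>: "continuous_on UNIV \<phi>"
  shows "set_integrable lborel (cell L) (\<lambda>x. \<phi> x *\<^sub>R f x)"
proof (rule set_integrable_cell_dominated)
  note [measurable] = L2_D[OF f] borel_measurable_continuous_onI[OF \<phi>]
  show "set_integrable lborel (cell L) (\<lambda>x. norm (f x) * \<phi> x)"
    using norm_in_L2(1)[OF f] by (intro set_integrable_cell_mult_continuous \<phi> L2_D norm_integrable_L2)
  show "(\<lambda>x. \<phi> x *\<^sub>R f x) \<in> borel_measurable borel" by measurable
qed (simp add: abs_mult mult.commute)

lemma set_integral_bounded_linear:
  fixes f :: "real \<times> real \<Rightarrow> 'b::euclidean_space" and A :: "'b \<Rightarrow> 'c::euclidean_space"
  assumes A: "bounded_linear A" and f: "set_integrable lborel S f"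
  shows "(LINT x:S|lborel. A (f x)) = A (LINT x:S|lborel. f x)"
proof -
  have "A (LINT x:S|lborel. f x) = (LINT x|lborel. A (indicator S x *\<^sub>R f x))"
    using f unfolding set_lebesgue_integral_def set_integrable_def
    by (rule integral_bounded_linear[OF A, symmetric])
  then show ?thesis
    by (simp add: set_lebesgue_integral_def linear_scale[OF bounded_linear.linear[OF A]])
qed

lemma Cinf_continuous:
  fixes \<phi> :: "real \<times> real \<Rightarrow> real"
  assumes "Cinf_on UNIV \<phi>"
  shows "continuous_on UNIV \<phi>" "b \<in> Basis \<Longrightarrow> continuous_on UNIV (pd b \<phi>)"
  using Cinf_imp_C1[OF assms] C1_continuous C1_pd_continuous by blast+

lemma has_weak_pd_linear:
  fixes f g :: "real \<times> real \<Rightarrow> 'b::euclidean_space" and A :: "'b \<Rightarrow> 'c::euclidean_space"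
  assumes A: "bounded_linear A" and "f \<in> L2 L" "g \<in> L2 L" "b \<in> Basis" and w: "has_weak_pd L b f g"
  shows "has_weak_pd L b (\<lambda>x. A (f x)) (\<lambda>x. A (g x))"
  unfolding has_weak_pd_def
proof (intro allI impI)
  fix \<phi> :: "real \<times> real \<Rightarrow> real" assume \<phi>: "Cinf_on UNIV \<phi> \<and> periodic L \<phi>"
  note lin = bounded_linear.linear[OF A]
  have "(LINT x:cell L|lborel. pd b \<phi> x *\<^sub>R A (f x)) = A (LINT x:cell L|lborel. pd b \<phi> x *\<^sub>R f x)"
    using set_integral_bounded_linear[OF A set_integrable_scaleR_L2] Cinf_continuous \<phi> assms
    by (simp add: linear_scale[OF lin])
  also have "\<dots> = A (- (LINT x:cell L|lborel. \<phi> x *\<^sub>R g x))"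
    using w \<phi> by (simp add: has_weak_pd_def)
  also have "\<dots> = - (LINT x:cell L|lborel. \<phi> x *\<^sub>R A (g x))"
    using set_integral_bounded_linear[OF A set_integrable_scaleR_L2[of g L \<phi>]] Cinf_continuous(1) \<phi> assms
    by (simp add: linear_scale[OF lin] linear_neg[OF lin])
  finally show "(LINT x:cell L|lborel. pd b \<phi> x *\<^sub>R A (f x)) = - (LINT x:cell L|lborel. \<phi> x *\<^sub>R A (g x))" .
qed

lemma has_weak_pd_diff:
  fixes f g :: "real \<times> real \<Rightarrow> 'b::euclidean_space"
  assumes mem: "f \<in> L2 L" "g \<in> L2 L" "f' \<in> L2 L" "g' \<in> L2 L" and b: "b \<in> Basis"
    and w: "has_weak_pd L b f g" "has_weak_pd L b f' g'"
  shows "has_weak_pd L b (\<lambda>x. f x - f' x) (\<lambda>x. g x - g' x)"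
  unfolding has_weak_pd_def
proof (intro allI impI)
  fix \<phi> :: "real \<times> real \<Rightarrow> real" assume \<phi>: "Cinf_on UNIV \<phi> \<and> periodic L \<phi>"
  note c = Cinf_continuous[OF conjunct1[OF \<phi>]]
  show "(LINT x:cell L|lborel. pd b \<phi> x *\<^sub>R (f x - f' x)) = - (LINT x:cell L|lborel. \<phi> x *\<^sub>R (g x - g' x))"
    using w \<phi> by (simp add: has_weak_pd_def scaleR_diff_right set_integral_diff(2) set_integrable_scaleR_L2 c mem b)
qed

lemma has_weak_pd_C1:
  fixes f :: "real \<times> real \<Rightarrow> 'b::euclidean_space"
  assumes L: "L > 0" and "C1 f" "periodic L f" "b \<in> Basis"
  shows "has_weak_pd L b f (pd b f)"
  unfolding has_weak_pd_def
proof (intro allI impI)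
  fix \<phi> :: "real \<times> real \<Rightarrow> real" assume \<phi>: "Cinf_on UNIV \<phi> \<and> periodic L \<phi>"
  note C = Cinf_imp_C1[OF conjunct1[OF \<phi>]]
  have "periodic L (\<lambda>x. \<phi> x *\<^sub>R f x)" using \<phi> assms(3) by (auto simp: periodic_def)
  from torus_integral_pd[OF L C1_scaleR[OF C assms(2)] this assms(4)]
  have "(LINT x:cell L|lborel. pd b \<phi> x *\<^sub>R f x + \<phi> x *\<^sub>R pd b f x) = 0"
    by (simp add: pd_scaleR[OF C assms(2)])
  moreover have "set_integrable lborel (cell L) (\<lambda>x. pd b \<phi> x *\<^sub>R f x)" "set_integrable lborel (cell L) (\<lambda>x. \<phi> x *\<^sub>R pd b f x)"
    by (intro set_integrable_cell_continuous continuous_on_scaleR C1_continuous C1_pd_continuous C assms)+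
  ultimately show "(LINT x:cell L|lborel. pd b \<phi> x *\<^sub>R f x) = - (LINT x:cell L|lborel. \<phi> x *\<^sub>R pd b f x)"
    by (simp add: set_integral_add(2) eq_neg_iff_add_eq_0)
qed

lemma has_weak_pd_cong_ae:
  fixes f f' g g' :: "real \<times> real \<Rightarrow> 'b::euclidean_space"
  assumes w: "has_weak_pd L b f g" and b: "b \<in> Basis"
    and ae: "ae_eq f f'" "ae_eq g g'"
    and [measurable]: "f \<in> borel_measurable borel" "f' \<in> borel_measurable borel"
       "g \<in> borel_measurable borel" "g' \<in> borel_measurable borel"
  shows "has_weak_pd L b f' g'"
  unfolding has_weak_pd_def
proof (intro allI impI)
  fix \<phi> :: "real \<times> real \<Rightarrow> real" assume \<phi>: "Cinf_on UNIV \<phi> \<and> periodic L \<phi>"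
  note [measurable] = Cinf_continuous[OF conjunct1[OF \<phi>], THEN borel_measurable_continuous_onI]
    borel_measurable_continuous_onI[OF Cinf_continuous(2)[OF conjunct1[OF \<phi>] b]]
  have "(LINT x:cell L|lborel. pd b \<phi> x *\<^sub>R f' x) = (LINT x:cell L|lborel. pd b \<phi> x *\<^sub>R f x)"
    unfolding set_lebesgue_integral_def using ae(1)
    by (intro integral_cong_AE) (auto simp: ae_eq_def)
  moreover have "(LINT x:cell L|lborel. \<phi> x *\<^sub>R g' x) = (LINT x:cell L|lborel. \<phi> x *\<^sub>R g x)"
    unfolding set_lebesgue_integral_def using ae(2)
    by (intro integral_cong_AE) (auto simp: ae_eq_def)
  ultimately show "(LINT x:cell L|lborel. pd b \<phi> x *\<^sub>R f' x) = - (LINT x:cell L|lborel. \<phi> x *\<^sub>R g' x)"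
    using w \<phi> by (simp add: has_weak_pd_def)
qed

lemma has_weak_pd_inner:
  fixes f g :: "real \<times> real \<Rightarrow> real"
  assumes "has_weak_pd L b f g" "Cinf_on UNIV \<phi>" "periodic L \<phi>"
  shows "l2_inner L f (pd b \<phi>) = - l2_inner L g \<phi>"
  using assms by (simp add: has_weak_pd_def l2_inner_def mult.commute)

lemma has_weak_pd_limit:
  fixes f g :: "real \<times> real \<Rightarrow> real"
  assumes mem: "\<And>n. fn n \<in> L2 L" "\<And>n. gn n \<in> L2 L" "f \<in> L2 L" "g \<in> L2 L" and b: "b \<in> Basis"
    and w: "\<And>n. has_weak_pd L b (fn n) (gn n)"
    and lim: "(\<lambda>n. l2_norm L (\<lambda>x. f x - fn n x)) \<longlonglongrightarrow> 0" "(\<lambda>n. l2_norm L (\<lambda>x. g x - gn n x)) \<longlonglongrightarrow> 0"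
  shows "has_weak_pd L b f g"
  unfolding has_weak_pd_def
proof (intro allI impI)
  fix \<phi> :: "real \<times> real \<Rightarrow> real" assume \<phi>: "Cinf_on UNIV \<phi> \<and> periodic L \<phi>"
  note C = Cinf_imp_C1[OF conjunct1[OF \<phi>]]
  have L2: "\<phi> \<in> L2 L" "pd b \<phi> \<in> L2 L"
    by (rule L2_I_continuous[OF C1_continuous[OF C]] L2_I_continuous[OF C1_pd_continuous[OF C b] periodic_pd[OF C]];
        use \<phi> in simp)+
  have "l2_inner L f (pd b \<phi>) = - l2_inner L g \<phi>"
  proof (rule LIMSEQ_unique)
    show "(\<lambda>n. l2_inner L (fn n) (pd b \<phi>)) \<longlonglongrightarrow> l2_inner L f (pd b \<phi>)"
      by (intro l2_inner_tendsto mem L2 lim)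
    have "(\<lambda>n. - l2_inner L (gn n) \<phi>) \<longlonglongrightarrow> - l2_inner L g \<phi>"
      by (intro tendsto_minus l2_inner_tendsto mem L2 lim)
    then show "(\<lambda>n. l2_inner L (fn n) (pd b \<phi>)) \<longlonglongrightarrow> - l2_inner L g \<phi>"
      using has_weak_pd_inner[OF w] \<phi> by simp
  qed
  then show "(LINT x:cell L|lborel. pd b \<phi> x *\<^sub>R f x) = - (LINT x:cell L|lborel. \<phi> x *\<^sub>R g x)"
    by (simp add: l2_inner_def mult.commute)
qed

text \<open>
  Testing with the modes already determines the derivative.
\<close>

theorem weak_pd_unique:
  fixes f g h :: "real \<times> real \<Rightarrow> 'b::euclidean_space"
  assumes L: "L > 0" and g: "g \<in> L2 L" and h: "h \<in> L2 L"
    and w: "has_weak_pd L b f g" "has_weak_pd L b f h"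
  shows "ae_eq g h"
proof -
  have comp: "AE x in lborel. (g x - h x) \<bullet> i = 0" for i
  proof -
    define d where "d x = (g x - h x) \<bullet> i" for x
    have d: "d \<in> L2 L"
      unfolding d_def[abs_def] by (rule L2_bounded_linear[OF L2_diff[OF g h] bounded_linear_inner_left])
    have orth: "(LINT x:cell L|lborel. d x * \<phi> x) = 0" if \<phi>: "Cinf_on UNIV \<phi>" "periodic L \<phi>" for \<phi>
    proof -
      note c = Cinf_continuous(1)[OF \<phi>(1)]
      have "(LINT x:cell L|lborel. d x * \<phi> x) = (LINT x:cell L|lborel. (\<phi> x *\<^sub>R (g x - h x)) \<bullet> i)"
        by (simp add: d_def mult.commute)
      also have "\<dots> = (LINT x:cell L|lborel. \<phi> x *\<^sub>R (g x - h x)) \<bullet> i"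
        by (rule set_integral_bounded_linear[OF bounded_linear_inner_left set_integrable_scaleR_L2[OF L2_diff[OF g h] c]])
      also have "(LINT x:cell L|lborel. \<phi> x *\<^sub>R (g x - h x))
          = (LINT x:cell L|lborel. \<phi> x *\<^sub>R g x) - (LINT x:cell L|lborel. \<phi> x *\<^sub>R h x)"
        by (simp add: scaleR_diff_right set_integral_diff(2) set_integrable_scaleR_L2 c g h)
      also have "\<dots> = 0" using w \<phi> by (simp add: has_weak_pd_def)
      finally show ?thesis by simp
    qed
    have "ae_eq d (\<lambda>x. 0)"
      by (rule trig_system_complete[OF L L2_periodic[OF d] L2_D[OF d] norm_integrable_L2[OF d]])
         (intro orth Cinf_mode periodic_mode L)+
    then show ?thesis by (simp add: ae_eq_def d_def)
  qed
  have "AE x in lborel. \<forall>i\<in>Basis. (g x - h x) \<bullet> i = 0"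
    using comp by (intro AE_finite_allI) auto
  then show ?thesis
    unfolding ae_eq_def
  proof eventually_elim
    case (elim x)
    then have "g x - h x = 0" by (simp only: euclidean_all_zero_iff)
    then show ?case by simp
  qed
qed

lemma wpd_works:
  assumes "\<exists>g\<in>L2 L. has_weak_pd L b f g"
  shows "wpd L b f \<in> L2 L" "has_weak_pd L b f (wpd L b f)"
  using assms someI_ex[of "\<lambda>g. g \<in> L2 L \<and> has_weak_pd L b f g"] by (auto simp: wpd_def)

lemma wpd_ae:
  assumes L: "L > 0" and "h \<in> L2 L" "has_weak_pd L b f h"
  shows "wpd L b f \<in> L2 L" "has_weak_pd L b f (wpd L b f)" "ae_eq (wpd L b f) h"
proof -
  have ex: "\<exists>g\<in>L2 L. has_weak_pd L b f g" using assms by blast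
  show w: "wpd L b f \<in> L2 L" "has_weak_pd L b f (wpd L b f)" by (rule wpd_works[OF ex])+
  show "ae_eq (wpd L b f) h" by (rule weak_pd_unique[OF assms(1) w(1) assms(2) w(2) assms(3)])
qed

lemma h1_norm_eq:
  assumes L: "L > 0" and "g1 \<in> L2 L" "has_weak_pd L (1, 0) f g1" "g2 \<in> L2 L" "has_weak_pd L (0, 1) f g2"
  shows "h1_norm L f = sqrt ((l2_norm L f)\<^sup>2 + (l2_norm L g1)\<^sup>2 + (l2_norm L g2)\<^sup>2)"
proof -
  note w1 = wpd_ae[OF assms(1-3)] and w2 = wpd_ae[OF assms(1,4,5)]
  have "l2_norm L (wpd L (1, 0) f) = l2_norm L g1" "l2_norm L (wpd L (0, 1) f) = l2_norm L g2"
    by (rule l2_norm_cong_ae L2_D w1 w2 assms)+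
  then show ?thesis by (simp add: h1_norm_def grad_norm_sq_def sum_Basis_plane)
qed

text \<open>
  Each weak derivative, moved to the mode, exchanges cosine and sine and produces one frequency factor.
\<close>

lemma weak_second_derivative_mode:
  fixes f g h :: "real \<times> real \<Rightarrow> 'b::euclidean_space"
  assumes L: "L > 0" and w: "has_weak_pd L b f g" "has_weak_pd L b g h"
  shows "(LINT x:cell L|lborel. cmode L k x *\<^sub>R h x) = (- (freq L k \<bullet> b)\<^sup>2) *\<^sub>R (LINT x:cell L|lborel. cmode L k x *\<^sub>R f x)"
    "(LINT x:cell L|lborel. smode L k x *\<^sub>R h x) = (- (freq L k \<bullet> b)\<^sup>2) *\<^sub>R (LINT x:cell L|lborel. smode L k x *\<^sub>R f x)"
proof -
  define q where "q = freq L k \<bullet> b"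
  have pull: "(LINT x:cell L|lborel. (c * m x) *\<^sub>R v x) = c *\<^sub>R (LINT x:cell L|lborel. m x *\<^sub>R v x)"
    for c and m :: "real \<times> real \<Rightarrow> real" and v :: "real \<times> real \<Rightarrow> 'b"
    by (simp add: set_integral_scaleR_right flip: scaleR_scaleR)
  have wC: "(- q) *\<^sub>R (LINT x:cell L|lborel. smode L k x *\<^sub>R u x) = - (LINT x:cell L|lborel. cmode L k x *\<^sub>R v x)"
    and wS: "q *\<^sub>R (LINT x:cell L|lborel. cmode L k x *\<^sub>R u x) = - (LINT x:cell L|lborel. smode L k x *\<^sub>R v x)"
    if uv: "has_weak_pd L b u v" for u v :: "real \<times> real \<Rightarrow> 'b"
  proof -
    have "(LINT x:cell L|lborel. pd b (cmode L k) x *\<^sub>R u x) = - (LINT x:cell L|lborel. cmode L k x *\<^sub>R v x)"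
      "(LINT x:cell L|lborel. pd b (smode L k) x *\<^sub>R u x) = - (LINT x:cell L|lborel. smode L k x *\<^sub>R v x)"
      using uv Cinf_mode[of L k] periodic_mode[OF L, of k] unfolding has_weak_pd_def by blast+
    then show "(- q) *\<^sub>R (LINT x:cell L|lborel. smode L k x *\<^sub>R u x) = - (LINT x:cell L|lborel. cmode L k x *\<^sub>R v x)"
      "q *\<^sub>R (LINT x:cell L|lborel. cmode L k x *\<^sub>R u x) = - (LINT x:cell L|lborel. smode L k x *\<^sub>R v x)"
      unfolding pd_mode pull q_def by simp_all
  qed
  have "(LINT x:cell L|lborel. cmode L k x *\<^sub>R h x) = q *\<^sub>R (LINT x:cell L|lborel. smode L k x *\<^sub>R g x)"
    using wC[OF w(2)] by simp
  also have "\<dots> = q *\<^sub>R (- (q *\<^sub>R (LINT x:cell L|lborel. cmode L k x *\<^sub>R f x)))"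
    using wS[OF w(1)] by simp
  finally show "(LINT x:cell L|lborel. cmode L k x *\<^sub>R h x) = (- (freq L k \<bullet> b)\<^sup>2) *\<^sub>R (LINT x:cell L|lborel. cmode L k x *\<^sub>R f x)"
    by (simp add: q_def power2_eq_square)
  have "(LINT x:cell L|lborel. smode L k x *\<^sub>R h x) = - (q *\<^sub>R (LINT x:cell L|lborel. cmode L k x *\<^sub>R g x))"
    using wS[OF w(2)] by simp
  also have "\<dots> = - (q *\<^sub>R (q *\<^sub>R (LINT x:cell L|lborel. smode L k x *\<^sub>R f x)))"
    using wC[OF w(1)] by simp
  finally show "(LINT x:cell L|lborel. smode L k x *\<^sub>R h x) = (- (freq L k \<bullet> b)\<^sup>2) *\<^sub>R (LINT x:cell L|lborel. smode L k x *\<^sub>R f x)"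
    by (simp add: q_def power2_eq_square)
qed

section \<open>Solenoidal trigonometric polynomials\<close>

lemma periodic_compose: "periodic L f \<Longrightarrow> periodic L (\<lambda>x. A (f x))"
  by (simp add: periodic_def)

lemma set_integrable_bounded_linear:
  fixes f :: "real \<times> real \<Rightarrow> 'b::euclidean_space" and A :: "'b \<Rightarrow> 'c::euclidean_space"
  assumes A: "bounded_linear A" and f: "set_integrable lborel S f"
  shows "set_integrable lborel S (\<lambda>x. A (f x))"
  using integrable_bounded_linear[OF A f[unfolded set_integrable_def]]
  by (simp add: set_integrable_def linear_scale[OF bounded_linear.linear[OF A]])

lemma pd_add:
  assumes "C1 f" "C1 g"
  shows "pd b (\<lambda>x. f x + g x) x = pd b f x + pd b g x"
proof -
  have "((\<lambda>x. f x + g x) has_derivative (\<lambda>h. pd h f x + pd h g x)) (at x)"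
    by (rule has_derivative_add[OF C1_has_derivative C1_has_derivative]) fact+
  from frechet_derivative_at[OF this, symmetric] show ?thesis by (simp add: pd_def)
qed

lemma C1_add:
  assumes "C1 f" "C1 g"
  shows "C1 (\<lambda>x. f x + g x)"
  unfolding C1_def
proof (intro conjI ballI allI)
  show "(\<lambda>x. f x + g x) differentiable at x" for x
    by (rule differentiable_add[OF C1_differentiable C1_differentiable]) fact+
  show "continuous_on UNIV (pd b (\<lambda>x. f x + g x))" if "b \<in> Basis" for b
    unfolding pd_add[OF assms, abs_def]
    by (intro continuous_on_add C1_pd_continuous assms that)
qed

lemma C1_sum: "(\<And>i. i \<in> I \<Longrightarrow> C1 (f i)) \<Longrightarrow> C1 (\<lambda>x. \<Sum>i\<in>I. f i x)"
  by (induction I rule: infinite_finite_induct) (simp_all add: C1_const C1_add)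

definition vmode :: "real \<Rightarrow> int \<times> int \<Rightarrow> real \<times> real \<Rightarrow> real \<times> real \<Rightarrow> real \<times> real \<Rightarrow> real \<times> real" where
  "vmode L k a b x = cmode L k x *\<^sub>R a + smode L k x *\<^sub>R b"

lemma vmode_trig: "vmode L k a b = (\<lambda>x. cos (freq L k \<bullet> x) *\<^sub>R a + sin (freq L k \<bullet> x) *\<^sub>R b)"
  by (simp add: vmode_def[abs_def] cmode_def smode_def)

lemma C1_vmode: "C1 (vmode L k a b)"
  unfolding vmode_trig by (rule Cinf_imp_C1[OF Cinf_trig])

lemma periodic_vmode: "L > 0 \<Longrightarrow> periodic L (vmode L k a b)"
  unfolding vmode_trig by (rule periodic_trig)

lemma pd_vmode: "pd h (vmode L k a b) = vmode L k ((freq L k \<bullet> h) *\<^sub>R b) (- (freq L k \<bullet> h) *\<^sub>R a)"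
  unfolding vmode_trig pd_trig by (simp add: algebra_simps)

lemma freq_inner: "freq L k \<bullet> x = 2 * pi / L * (real_of_int (fst k) * fst x + real_of_int (snd k) * snd x)"
  by (simp add: freq_def inner_prod_def distrib_left add_divide_distrib mult.assoc)

lemma trig_poly_iff: "trig_poly L p \<longleftrightarrow> (\<exists>K a b. finite K \<and> p = (\<lambda>x. \<Sum>k\<in>K. vmode L k (a k) (b k) x))"
  by (simp only: trig_poly_def vmode_trig freq_inner)

lemma trig_poly_vmode: "trig_poly L (vmode L k a b)"
  unfolding trig_poly_iff
  by (rule exI[of _ "{k}"], rule exI[of _ "\<lambda>_. a"], rule exI[of _ "\<lambda>_. b"]) simp

lemma trig_poly_zero: "trig_poly L (\<lambda>x. 0)"
  unfolding trig_poly_iff by (rule exI[of _ "{}"]) simp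

lemma trig_poly_add:
  assumes "trig_poly L p" "trig_poly L q"
  shows "trig_poly L (\<lambda>x. p x + q x)"
proof -
  obtain K a b where p: "finite K" "p = (\<lambda>x. \<Sum>k\<in>K. vmode L k (a k) (b k) x)"
    using assms(1) unfolding trig_poly_iff by blast
  obtain K' a' b' where q: "finite K'" "q = (\<lambda>x. \<Sum>k\<in>K'. vmode L k (a' k) (b' k) x)"
    using assms(2) unfolding trig_poly_iff by blast
  define A where "A k = (if k \<in> K then a k else 0) + (if k \<in> K' then a' k else 0)" for k
  define B where "B k = (if k \<in> K then b k else 0) + (if k \<in> K' then b' k else 0)" for k
  have "p x + q x = (\<Sum>k\<in>K \<union> K'. vmode L k (A k) (B k) x)" for x
  proof -
    have "p x = (\<Sum>k\<in>K \<union> K'. if k \<in> K then vmode L k (a k) (b k) x else 0)"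
      unfolding p(2) using p(1) q(1) by (simp add: sum.If_cases Int_absorb1 Un_Int_distrib2)
    moreover have "q x = (\<Sum>k\<in>K \<union> K'. if k \<in> K' then vmode L k (a' k) (b' k) x else 0)"
      unfolding q(2) using p(1) q(1) by (simp add: sum.If_cases Int_absorb1 Un_Int_distrib2)
    ultimately have "p x + q x = (\<Sum>k\<in>K \<union> K'. (if k \<in> K then vmode L k (a k) (b k) x else 0)
        + (if k \<in> K' then vmode L k (a' k) (b' k) x else 0))"
      by (simp only: sum.distrib)
    also have "\<dots> = (\<Sum>k\<in>K \<union> K'. vmode L k (A k) (B k) x)"
      by (intro sum.cong) (auto simp: vmode_def A_def B_def algebra_simps)
    finally show ?thesis .
  qed
  then show ?thesis using p(1) q(1) unfolding trig_poly_iff by blast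
qed

lemma trig_poly_C1: "trig_poly L p \<Longrightarrow> C1 p"
  unfolding trig_poly_iff by (elim exE conjE) (simp only: C1_sum C1_vmode)

lemma trig_poly_periodic:
  assumes L: "L > 0" and "trig_poly L p"
  shows "periodic L p"
proof -
  obtain K a b where "p = (\<lambda>x. \<Sum>k\<in>K. vmode L k (a k) (b k) x)"
    using assms(2) unfolding trig_poly_iff by blast
  then show ?thesis using periodic_vmode[OF assms(1)] by (simp add: periodic_def)
qed

lemma solenoidal_trig_D:
  assumes L: "L > 0" and "p \<in> solenoidal_trig L"
  shows "C1 p" "periodic L p" "p \<in> L2 L"
  using assms trig_poly_C1[of L p] trig_poly_periodic[of L p] L2_I_continuous[OF C1_continuous, of p L]
  by (auto simp: solenoidal_trig_def)

lemma solenoidal_trig_zero: "(\<lambda>x. 0) \<in> solenoidal_trig L"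
  by (simp add: solenoidal_trig_def trig_poly_zero divergence_def pd_def mean_free_def)

lemma solenoidal_trig_add:
  assumes L: "L > 0" and p: "p \<in> solenoidal_trig L" and q: "q \<in> solenoidal_trig L"
  shows "(\<lambda>x. p x + q x) \<in> solenoidal_trig L"
proof -
  note P = solenoidal_trig_D[OF L p] and Q = solenoidal_trig_D[OF L q]
  have "divergence (\<lambda>x. p x + q x) x = divergence p x + divergence q x" for x
    by (simp add: divergence_def pd_add[OF P(1) Q(1)] inner_add_left sum.distrib)
  then show ?thesis
    using p q norm_integrable_L2[OF P(3)] norm_integrable_L2[OF Q(3)]
    by (auto simp: solenoidal_trig_def trig_poly_add mean_free_def set_integral_add(2))
qed

lemma vmode_solenoidal:
  assumes L: "L > 0" and "k \<noteq> 0" "freq L k \<bullet> a = 0" "freq L k \<bullet> b = 0"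
  shows "vmode L k a b \<in> solenoidal_trig L"
proof -
  have "divergence (vmode L k a b) x = (\<Sum>h\<in>Basis. (freq L k \<bullet> h) * ((cmode L k x *\<^sub>R b - smode L k x *\<^sub>R a) \<bullet> h))" for x
    unfolding divergence_def pd_vmode by (intro sum.cong) (auto simp: vmode_def inner_add_left inner_diff_left algebra_simps)
  also have "\<dots> x = freq L k \<bullet> (cmode L k x *\<^sub>R b - smode L k x *\<^sub>R a)" for x
    by (rule euclidean_inner[symmetric])
  finally have "divergence (vmode L k a b) x = 0" for x
    using assms by (simp add: inner_diff_right)
  moreover have "mean_free L (vmode L k a b)"
  proof -
    have "set_integrable lborel (cell L) (\<lambda>x. cmode L k x *\<^sub>R a)" "set_integrable lborel (cell L) (\<lambda>x. smode L k x *\<^sub>R b)"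
      by (intro set_integrable_cell_continuous continuous_on_scaleR continuous_mode continuous_on_const)+
    then have "(LINT x:cell L|lborel. vmode L k a b x)
      = (LINT x:cell L|lborel. cmode L k x *\<^sub>R a) + (LINT x:cell L|lborel. smode L k x *\<^sub>R b)"
      unfolding vmode_def by (rule set_integral_add(2))
    also have "(LINT x:cell L|lborel. cmode L k x *\<^sub>R a) = (LINT x:cell L|lborel. cmode L k x) *\<^sub>R a"
      by (rule set_integral_bounded_linear[OF bounded_linear_scaleR_left set_integrable_cell_continuous[OF continuous_mode(1)]])
    also have "(LINT x:cell L|lborel. smode L k x *\<^sub>R b) = (LINT x:cell L|lborel. smode L k x) *\<^sub>R b"
      by (rule set_integral_bounded_linear[OF bounded_linear_scaleR_left set_integrable_cell_continuous[OF continuous_mode(2)]])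
    also have "(LINT x:cell L|lborel. cmode L k x) *\<^sub>R a + (LINT x:cell L|lborel. smode L k x) *\<^sub>R b = 0"
      using integral_mode[OF L, of k] \<open>k \<noteq> 0\<close> by simp
    finally show ?thesis by (simp add: mean_free_def)
  qed
  ultimately show ?thesis by (simp add: solenoidal_trig_def trig_poly_vmode)
qed

lemma solenoidal_in_Hsp:
  assumes L: "L > 0" and "p \<in> solenoidal_trig L"
  shows "p \<in> Hsp L"
  using solenoidal_trig_D(3)[OF assms] assms(2) unfolding Hsp_def
  by (auto simp: l2_norm_zero intro!: bexI[of _ p])

lemma weak_zero: "has_weak_pd L b (\<lambda>x. 0) (\<lambda>x. 0)"
  by (simp add: has_weak_pd_def)

lemma C1_in_H1:
  assumes L: "L > 0" and "C1 f" "periodic L f"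
  shows "f \<in> H1 L"
proof -
  have "f \<in> L2 L" by (rule L2_I_continuous[OF C1_continuous[OF assms(2)] assms(3)])
  moreover have "pd b f \<in> L2 L \<and> has_weak_pd L b f (pd b f)" if "b \<in> Basis" for b
    using L2_I_continuous[OF C1_pd_continuous[OF assms(2) that] periodic_pd[OF assms(2,3)]]
      has_weak_pd_C1[OF assms that] by blast
  ultimately show ?thesis unfolding H1_def by auto
qed

lemma solenoidal_in_Vsp:
  assumes L: "L > 0" and "p \<in> solenoidal_trig L"
  shows "p \<in> Vsp L"
proof -
  have "h1_norm L (\<lambda>x. 0 :: real \<times> real) = 0"
    using h1_norm_eq[OF L L2_zero weak_zero L2_zero weak_zero] by (simp add: l2_norm_zero)
  then have "\<exists>q\<in>solenoidal_trig L. h1_norm L (\<lambda>x. p x - q x) < \<epsilon>" if "\<epsilon> > 0" for \<epsilon>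
    using assms(2) that by (intro bexI[of _ p]) auto
  then show ?thesis
    using C1_in_H1[OF L solenoidal_trig_D(1,2)[OF assms]] by (simp add: Vsp_def)
qed

lemma Vsp_subset_Hsp: "Vsp L \<subseteq> Hsp L"
proof
  fix u assume u: "u \<in> Vsp L"
  have "\<exists>p\<in>solenoidal_trig L. l2_norm L (\<lambda>x. u x - p x) < \<epsilon>" if "\<epsilon> > 0" for \<epsilon>
  proof -
    obtain p where p: "p \<in> solenoidal_trig L" "h1_norm L (\<lambda>x. u x - p x) < \<epsilon>"
      using u \<open>\<epsilon> > 0\<close> by (auto simp: Vsp_def)
    have "l2_norm L (\<lambda>x. u x - p x) \<le> h1_norm L (\<lambda>x. u x - p x)"
      unfolding h1_norm_def grad_norm_sq_def by (rule real_le_rsqrt) (simp add: sum_nonneg)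
    with p show ?thesis by force
  qed
  then show "u \<in> Hsp L" using u by (auto simp: Hsp_def Vsp_def H1_def)
qed

lemma Hsp_orthogonal:
  assumes L: "L > 0" and "u \<in> Hsp L" "v \<in> L2 L" and orth: "\<And>p. p \<in> solenoidal_trig L \<Longrightarrow> l2_inner L p v = 0"
  shows "l2_inner L u v = 0"
proof (rule ccontr)
  assume nz: "l2_inner L u v \<noteq> 0"
  define \<epsilon> where "\<epsilon> = \<bar>l2_inner L u v\<bar> / (l2_norm L v + 1)"
  have v: "l2_norm L v + 1 > 0" using l2_norm_nonneg[of L v] by simp
  then have "\<epsilon> > 0" using nz by (simp add: \<epsilon>_def)
  then obtain p where p: "p \<in> solenoidal_trig L" "l2_norm L (\<lambda>x. u x - p x) < \<epsilon>"
    using assms(2) by (auto simp: Hsp_def)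
  have u: "u \<in> L2 L" using assms(2) by (simp add: Hsp_def)
  note P = solenoidal_trig_D(3)[OF L p(1)]
  have "\<bar>l2_inner L u v\<bar> = \<bar>l2_inner L (\<lambda>x. u x - p x) v\<bar>"
    using orth[OF p(1)] by (simp add: l2_inner_diff_left u P assms(3))
  also have "\<dots> \<le> l2_norm L (\<lambda>x. u x - p x) * l2_norm L v"
    by (rule l2_Cauchy_Schwarz[OF L2_diff[OF u P] assms(3)])
  also have "\<dots> \<le> \<epsilon> * l2_norm L v"
    using p(2) by (intro mult_right_mono l2_norm_nonneg) simp
  also have "\<dots> < \<epsilon> * (l2_norm L v + 1)" using \<open>\<epsilon> > 0\<close> by simp
  also have "\<dots> = \<bar>l2_inner L u v\<bar>" using v by (simp add: \<epsilon>_def)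
  finally show False by simp
qed

lemma vmode_L2: "L > 0 \<Longrightarrow> vmode L k a b \<in> L2 L"
  by (intro L2_I_continuous C1_continuous C1_vmode periodic_vmode)

text \<open>
  The fields \<open>cos(p\<cdot>x) p\<close> and \<open>sin(p\<cdot>x) p\<close> are gradients up to sign, and gradients are orthogonal to
  divergence-free fields after integration by parts.
\<close>

lemma Hsp_orthogonal_gradient:
  assumes L: "L > 0" and "u \<in> Hsp L"
  shows "l2_inner L u (vmode L k (freq L k) 0) = 0" "l2_inner L u (vmode L k 0 (freq L k)) = 0"
proof -
  have grad: "(LINT x:cell L|lborel. (\<Sum>b\<in>Basis. pd b m x * (p x \<bullet> b))) = 0"
    if m: "C1 m" "periodic L m" and p: "p \<in> solenoidal_trig L" for m :: "real \<times> real \<Rightarrow> real" and p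
  proof -
    note P = solenoidal_trig_D[OF L p]
    have F: "C1 (\<lambda>x. m x *\<^sub>R p x)" "periodic L (\<lambda>x. m x *\<^sub>R p x)"
      using C1_scaleR[OF m(1) P(1)] m(2) P(2) by (auto simp: periodic_def)
    have G: "C1 (\<lambda>x. (m x *\<^sub>R p x) \<bullet> b)" "periodic L (\<lambda>x. (m x *\<^sub>R p x) \<bullet> b)" for b
      by (rule C1_inner[OF F(1)], rule periodic_compose[OF F(2)])
    have "(\<Sum>b\<in>Basis. pd b m x * (p x \<bullet> b)) = (\<Sum>b\<in>Basis. pd b (\<lambda>x. (m x *\<^sub>R p x) \<bullet> b) x)" for x
    proof -
      have "(\<Sum>b\<in>Basis. pd b (\<lambda>x. (m x *\<^sub>R p x) \<bullet> b) x)
          = (\<Sum>b\<in>Basis. pd b m x * (p x \<bullet> b)) + m x * divergence p x"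
        unfolding pd_inner[OF F(1)] pd_scaleR[OF m(1) P(1)]
        by (simp add: inner_add_left sum.distrib divergence_def sum_distrib_left)
      moreover have "divergence p x = 0" using p unfolding solenoidal_trig_def by blast
      ultimately show ?thesis by simp
    qed
    moreover have "(LINT x:cell L|lborel. (\<Sum>b\<in>Basis. pd b (\<lambda>x. (m x *\<^sub>R p x) \<bullet> b) x)) = 0"
      using torus_integral_pd[OF L G] set_integrable_cell_continuous[OF C1_pd_continuous[OF G(1)]]
      unfolding sum_Basis_plane by (subst set_integral_add(2)) (simp_all add: Basis_plane)
    ultimately show ?thesis by simp
  qed
  show "l2_inner L u (vmode L k (freq L k) 0) = 0"
  proof (rule Hsp_orthogonal[OF assms vmode_L2[OF L]])
    fix p assume p: "p \<in> solenoidal_trig L"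
    have "p x \<bullet> vmode L k (freq L k) 0 x = (\<Sum>b\<in>Basis. pd b (smode L k) x * (p x \<bullet> b))" for x
      unfolding pd_mode vmode_def by (subst euclidean_inner) (intro sum.cong, simp_all add: mult_ac)
    then show "l2_inner L p (vmode L k (freq L k) 0) = 0"
      using grad[OF C1_mode(2) periodic_mode(2)[OF L] p] by (simp add: l2_inner_def)
  qed
  show "l2_inner L u (vmode L k 0 (freq L k)) = 0"
  proof (rule Hsp_orthogonal[OF assms vmode_L2[OF L]])
    fix p assume p: "p \<in> solenoidal_trig L"
    have "p x \<bullet> vmode L k 0 (freq L k) x = - (\<Sum>b\<in>Basis. pd b (cmode L k) x * (p x \<bullet> b))" for x
      unfolding pd_mode vmode_def sum_negf[symmetric]
      by (subst euclidean_inner) (intro sum.cong, simp_all add: mult_ac)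
    then have "l2_inner L p (vmode L k 0 (freq L k)) = - (LINT x:cell L|lborel. (\<Sum>b\<in>Basis. pd b (cmode L k) x * (p x \<bullet> b)))"
      by (simp add: l2_inner_def set_lebesgue_integral_def)
    then show "l2_inner L p (vmode L k 0 (freq L k)) = 0"
      using grad[OF C1_mode(1) periodic_mode(1)[OF L] p] by simp
  qed
qed

lemma Hsp_orthogonal_const:
  assumes L: "L > 0" and "u \<in> Hsp L"
  shows "l2_inner L u (\<lambda>x. c) = 0"
proof (rule Hsp_orthogonal[OF assms])
  show "(\<lambda>x. c) \<in> L2 L" by (rule L2_I_continuous) (auto simp: periodic_def)
  fix p assume p: "p \<in> solenoidal_trig L"
  have "(LINT x:cell L|lborel. p x \<bullet> c) = (LINT x:cell L|lborel. p x) \<bullet> c"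
    by (rule set_integral_bounded_linear[OF bounded_linear_inner_left norm_integrable_L2[OF solenoidal_trig_D(3)[OF L p]]])
  then show "l2_inner L p (\<lambda>x. c) = 0" using p by (simp add: l2_inner_def solenoidal_trig_def mean_free_def)
qed

section \<open>The first Stokes eigenvalue\<close>

lemma freq_norm_lower:
  assumes L: "L > 0" and "k \<noteq> 0"
  shows "(2 * pi / L)\<^sup>2 \<le> (freq L k \<bullet> freq L k)"
proof -
  have "(1::int) \<le> (fst k)\<^sup>2 + (snd k)\<^sup>2"
    using assms(2) by (cases k) (auto simp: zero_prod_def int_one_le_iff_zero_less sum_power2_gt_zero_iff)
  then have "(1::real) \<le> (of_int (fst k))\<^sup>2 + (of_int (snd k))\<^sup>2"
    by (metis of_int_1_le_iff of_int_add of_int_power)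
  then have "(2 * pi / L)\<^sup>2 * 1 \<le> (2 * pi / L)\<^sup>2 * ((of_int (fst k))\<^sup>2 + (of_int (snd k))\<^sup>2)"
    by (intro mult_left_mono) auto
  also have "\<dots> = freq L k \<bullet> freq L k"
    by (simp add: freq_def inner_prod_def power2_eq_square algebra_simps)
  finally show ?thesis by simp
qed

lemma l2_inner_vmode:
  assumes L: "L > 0" and "u \<in> L2 L"
  shows "l2_inner L u (vmode L k a b) = (LINT x:cell L|lborel. cmode L k x *\<^sub>R u x) \<bullet> a + (LINT x:cell L|lborel. smode L k x *\<^sub>R u x) \<bullet> b"
proof -
  have int: "set_integrable lborel (cell L) (\<lambda>x. cmode L k x *\<^sub>R u x)" "set_integrable lborel (cell L) (\<lambda>x. smode L k x *\<^sub>R u x)"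
    by (rule set_integrable_scaleR_L2[OF assms(2) continuous_mode(1)] set_integrable_scaleR_L2[OF assms(2) continuous_mode(2)])+
  have i2: "set_integrable lborel (cell L) (\<lambda>x. (cmode L k x *\<^sub>R u x) \<bullet> a)" "set_integrable lborel (cell L) (\<lambda>x. (smode L k x *\<^sub>R u x) \<bullet> b)"
    by (rule set_integrable_bounded_linear[OF bounded_linear_inner_left int(1)]
          set_integrable_bounded_linear[OF bounded_linear_inner_left int(2)])+
  have "l2_inner L u (vmode L k a b) = (LINT x:cell L|lborel. (cmode L k x *\<^sub>R u x) \<bullet> a + (smode L k x *\<^sub>R u x) \<bullet> b)"
    by (simp add: l2_inner_def vmode_def inner_add_right)
  also have "\<dots> = (LINT x:cell L|lborel. (cmode L k x *\<^sub>R u x) \<bullet> a) + (LINT x:cell L|lborel. (smode L k x *\<^sub>R u x) \<bullet> b)"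
    by (rule set_integral_add(2)[OF i2])
  also have "\<dots> = (LINT x:cell L|lborel. cmode L k x *\<^sub>R u x) \<bullet> a + (LINT x:cell L|lborel. smode L k x *\<^sub>R u x) \<bullet> b"
    using set_integral_bounded_linear[OF bounded_linear_inner_left int(1)] set_integral_bounded_linear[OF bounded_linear_inner_left int(2)]
    by simp
  finally show ?thesis .
qed

lemma H1_wpd:
  assumes "u \<in> H1 L" "b \<in> Basis"
  shows "wpd L b u \<in> L2 L" "has_weak_pd L b u (wpd L b u)"
  using assms wpd_works[of L b u] by (auto simp: H1_def)

lemma sum_inner_Basis_sq: "(\<Sum>h\<in>Basis. (p \<bullet> h)\<^sup>2) = p \<bullet> p"
  by (subst euclidean_inner) (simp add: power2_eq_square)

lemma weak_laplacian_vmode: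
  assumes L: "L > 0" and u: "u \<in> stokes_domain L"
  shows "weak_laplacian L u \<in> L2 L"
    "l2_inner L (weak_laplacian L u) (vmode L k a b) = - (freq L k \<bullet> freq L k) * l2_inner L u (vmode L k a b)"
proof -
  have uH: "u \<in> H1 L" "u \<in> L2 L" using u by (auto simp: stokes_domain_def Vsp_def H1_def)
  have w: "has_weak_pd L h u (wpd L h u)" "has_weak_pd L h (wpd L h u) (wpd L h (wpd L h u))" "wpd L h (wpd L h u) \<in> L2 L"
    if "h \<in> Basis" for h
  proof -
    have "wpd L h u \<in> H1 L" using u that unfolding stokes_domain_def by blast
    then show "has_weak_pd L h u (wpd L h u)" "has_weak_pd L h (wpd L h u) (wpd L h (wpd L h u))" "wpd L h (wpd L h u) \<in> L2 L"
      using H1_wpd[OF uH(1) that] H1_wpd[OF _ that] by blast+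
  qed
  show mem: "weak_laplacian L u \<in> L2 L"
    unfolding weak_laplacian_def[abs_def] by (intro L2_sum w)
  have comp: "l2_inner L (wpd L h (wpd L h u)) (vmode L k a b) = - (freq L k \<bullet> h)\<^sup>2 * l2_inner L u (vmode L k a b)" if h: "h \<in> Basis" for h
    unfolding l2_inner_vmode[OF L w(3)[OF h]] l2_inner_vmode[OF L uH(2)]
      weak_second_derivative_mode[OF L w(1,2)[OF h]]
    by (simp add: algebra_simps)
  have "l2_inner L (weak_laplacian L u) (vmode L k a b) = (\<Sum>h\<in>Basis. l2_inner L (wpd L h (wpd L h u)) (vmode L k a b))"
    unfolding weak_laplacian_def[abs_def] by (intro l2_inner_sum_left w vmode_L2 L)
  also have "\<dots> = (\<Sum>h\<in>Basis. - (freq L k \<bullet> h)\<^sup>2 * l2_inner L u (vmode L k a b))"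
    by (intro sum.cong comp) auto
  also have "\<dots> = - (freq L k \<bullet> freq L k) * l2_inner L u (vmode L k a b)"
    by (simp only: sum_distrib_right[symmetric] sum_negf sum_inner_Basis_sq)
  finally show "l2_inner L (weak_laplacian L u) (vmode L k a b) = - (freq L k \<bullet> freq L k) * l2_inner L u (vmode L k a b)" .
qed

text \<open>
  Completeness of the trigonometric system, applied to each component.
\<close>

lemma orthogonal_vmodes_imp_zero:
  assumes L: "L > 0" and u: "u \<in> L2 L" and orth: "\<And>k a b. l2_inner L u (vmode L k a b) = 0"
  shows "l2_norm L u = 0"
proof -
  have "AE x in lborel. u x \<bullet> i = 0" for i
  proof -
    have d: "(\<lambda>x. u x \<bullet> i) \<in> L2 L" by (rule L2_bounded_linear[OF u bounded_linear_inner_left])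
    have "ae_eq (\<lambda>x. u x \<bullet> i) (\<lambda>x. 0)"
      by (rule trig_system_complete[OF L L2_periodic[OF d] L2_D[OF d] norm_integrable_L2[OF d]])
         (use orth[of _ i 0] orth[of _ 0 i] in \<open>simp_all add: l2_inner_def vmode_def mult.commute\<close>)
    then show ?thesis by (simp add: ae_eq_def)
  qed
  then have "AE x in lborel. \<forall>i\<in>Basis. u x \<bullet> i = 0" by (intro AE_finite_allI) auto
  then have "ae_eq u (\<lambda>x. 0)" unfolding ae_eq_def by eventually_elim (simp only: euclidean_all_zero_iff)
  then show ?thesis using l2_norm_cong_ae[OF L2_D[OF u] L2_D[OF L2_zero], of L] by (simp add: l2_norm_zero)
qed

text \<open>
  For a divergence-free mode of frequency \<open>p\<close> the eigenvalue equation reads \<open>(p\<cdot>p - l)\<langle>u, v\<rangle> = 0\<close>. If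
  \<open>l\<close> is smaller than every \<open>p\<cdot>p\<close>, then \<open>u\<close> is orthogonal to all of these modes; it is orthogonal to
  gradient modes and constants anyway, hence zero. Working mode by mode avoids a Poincare inequality.
\<close>

lemma stokes_eigenvalue_lower:
  assumes L: "L > 0" and "stokes_eigenvalue L l"
  shows "(2 * pi / L)\<^sup>2 \<le> l"
proof (rule ccontr)
  assume "\<not> (2 * pi / L)\<^sup>2 \<le> l"
  then have small: "l < (2 * pi / L)\<^sup>2" by simp
  obtain u where u: "u \<in> stokes_domain L" "l2_norm L u \<noteq> 0"
    and leray: "\<And>v. v \<in> Hsp L \<Longrightarrow> l2_inner L (\<lambda>x. - weak_laplacian L u x - l *\<^sub>R u x) v = 0"
    using assms(2) by (auto simp: stokes_eigenvalue_def leray_projection_def)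
  have uL: "u \<in> L2 L" using u(1) by (auto simp: stokes_domain_def Vsp_def H1_def)
  have uH: "u \<in> Hsp L" using u(1) Vsp_subset_Hsp by (auto simp: stokes_domain_def)
  have perp: "l2_inner L u (vmode L k a b) = 0" if "k \<noteq> 0" "freq L k \<bullet> a = 0" "freq L k \<bullet> b = 0" for k a b
  proof -
    have v: "vmode L k a b \<in> Hsp L" by (rule solenoidal_in_Hsp[OF L vmode_solenoidal[OF L that]])
    note vL = vmode_L2[OF L, of k a b] and lap = weak_laplacian_vmode[OF L u(1)]
    have "0 = l2_inner L (\<lambda>x. - weak_laplacian L u x - l *\<^sub>R u x) (vmode L k a b)"
      using leray[OF v] by simp
    also have "\<dots> = l2_inner L (\<lambda>x. (-1) *\<^sub>R weak_laplacian L u x) (vmode L k a b) - l2_inner L (\<lambda>x. l *\<^sub>R u x) (vmode L k a b)"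
      using l2_inner_diff_left[OF L2_scaleR[OF lap(1), of "-1"] L2_scaleR[OF uL, of l] vL] by simp
    also have "\<dots> = (freq L k \<bullet> freq L k - l) * l2_inner L u (vmode L k a b)"
      unfolding l2_inner_scaleR_left lap(2) by (simp add: algebra_simps)
    finally show ?thesis using freq_norm_lower[OF L \<open>k \<noteq> 0\<close>] small by simp
  qed
  have "l2_inner L u (vmode L k a b) = 0" for k a b
  proof (cases "k = 0")
    case True
    then show ?thesis using Hsp_orthogonal_const[OF L uH, of a] by (simp add: vmode_def[abs_def] mode_zero)
  next
    case False
    define p where "p = freq L k"
    \<comment> \<open>Split the amplitudes into their components along and across the frequency.\<close>
    have pp: "p \<bullet> p > 0" using freq_eq_0[OF L] False by (simp add: p_def)
    define s t where "s = (p \<bullet> a) / (p \<bullet> p)" and "t = (p \<bullet> b) / (p \<bullet> p)"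
    have "p \<bullet> (a - s *\<^sub>R p) = 0" "p \<bullet> (b - t *\<^sub>R p) = 0"
      using pp by (auto simp: s_def t_def inner_diff_right)
    then have "l2_inner L u (vmode L k (a - s *\<^sub>R p) (b - t *\<^sub>R p)) = 0" using perp[OF False] by (simp add: p_def)
    moreover have "l2_inner L u (vmode L k p 0) = 0" "l2_inner L u (vmode L k 0 p) = 0"
      unfolding p_def by (rule Hsp_orthogonal_gradient[OF L uH])+
    ultimately show ?thesis
      unfolding l2_inner_vmode[OF L uL] by (simp add: inner_diff_right)
  qed
  from orthogonal_vmodes_imp_zero[OF L uL this] u(2) show False by simp
qed

lemma stokes_eigenvalue_vmode:
  assumes L: "L > 0" and "k \<noteq> 0" and a: "freq L k \<bullet> a = 0" "a \<noteq> 0"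
  shows "stokes_eigenvalue L (freq L k \<bullet> freq L k)"
proof -
  define u where "u = vmode L k a 0"
  define p where "p = freq L k"
  have sol: "u \<in> solenoidal_trig L" unfolding u_def by (rule vmode_solenoidal) (use assms in auto)
  have C: "C1 u" "periodic L u" "u \<in> L2 L" by (rule solenoidal_trig_D[OF L sol])+
  have D: "C1 (pd h u)" "periodic L (pd h u)" "pd h u \<in> L2 L" for h
    unfolding u_def pd_vmode by (intro C1_vmode periodic_vmode vmode_L2 L)+
  have DD: "pd h (pd h u) x = - (p \<bullet> h)\<^sup>2 *\<^sub>R u x" for h x
    unfolding u_def pd_vmode vmode_def p_def[symmetric] by (simp add: power2_eq_square)
  have w: "wpd L h u \<in> L2 L" "ae_eq (wpd L h u) (pd h u)" if "h \<in> Basis" for h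
    using wpd_ae[OF L D(3) has_weak_pd_C1[OF L C(1,2) that]] by auto
  have hw: "has_weak_pd L h (wpd L h' u) (pd h (pd h' u))" if "h \<in> Basis" "h' \<in> Basis" for h h'
  proof -
    have "ae_eq (pd h' u) (wpd L h' u)" using w(2)[OF that(2)] by (auto simp: ae_eq_def elim: eventually_mono)
    moreover have "pd h (pd h' u) \<in> borel_measurable borel"
      by (rule borel_measurable_continuous_onI[OF C1_pd_continuous[OF D(1) that(1)]])
    moreover have "ae_eq (pd h (pd h' u)) (pd h (pd h' u))" by (simp add: ae_eq_def)
    ultimately show ?thesis
      using has_weak_pd_cong_ae[OF has_weak_pd_C1[OF L D(1,2) that(1), of h'] that(1)]
        L2_D[OF D(3)[of h']] L2_D[OF w(1)[OF that(2)]] by blast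
  qed
  have pdL2: "pd h (pd h' u) \<in> L2 L" if "h \<in> Basis" for h h'
    by (rule L2_I_continuous[OF C1_pd_continuous[OF D(1) that] periodic_pd[OF D(1,2)]])
  have ww: "wpd L h (wpd L h u) \<in> L2 L" "ae_eq (wpd L h (wpd L h u)) (pd h (pd h u))" if "h \<in> Basis" for h
    using wpd_ae[OF L pdL2[OF that] hw[OF that that]] by auto
  have dom: "u \<in> stokes_domain L"
    unfolding stokes_domain_def H1_def
    using solenoidal_in_Vsp[OF L sol] w(1) hw pdL2 by blast
  have lapae: "ae_eq (\<lambda>x. - weak_laplacian L u x - (p \<bullet> p) *\<^sub>R u x) (\<lambda>x. 0)"
  proof -
    have "AE x in lborel. \<forall>h\<in>Basis. wpd L h (wpd L h u) x = pd h (pd h u) x"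
      using ww(2) unfolding ae_eq_def by (intro AE_finite_allI) auto
    then show ?thesis
      unfolding ae_eq_def
    proof eventually_elim
      case (elim x)
      have "weak_laplacian L u x = (\<Sum>h\<in>Basis. - (p \<bullet> h)\<^sup>2 *\<^sub>R u x)"
        unfolding weak_laplacian_def using elim by (intro sum.cong) (simp_all only: DD)
      also have "\<dots> = - (p \<bullet> p) *\<^sub>R u x"
        by (simp only: scaleR_sum_left[symmetric] sum_negf sum_inner_Basis_sq)
      finally show ?case by simp
    qed
  qed
  have lapL: "(\<lambda>x. - weak_laplacian L u x - (p \<bullet> p) *\<^sub>R u x) \<in> L2 L"
    using weak_laplacian_vmode(1)[OF L dom] by (intro L2_diff L2_uminus L2_scaleR C)
  have "leray_projection L (\<lambda>x. - weak_laplacian L u x) (\<lambda>x. (p \<bullet> p) *\<^sub>R u x)"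
    unfolding leray_projection_def
  proof (intro conjI ballI)
    have "(\<lambda>x. (p \<bullet> p) *\<^sub>R u x) = vmode L k ((p \<bullet> p) *\<^sub>R a) 0"
      by (auto simp: u_def vmode_def)
    moreover have "vmode L k ((p \<bullet> p) *\<^sub>R a) 0 \<in> Hsp L"
      by (intro solenoidal_in_Hsp vmode_solenoidal L) (use assms in auto)
    ultimately show "(\<lambda>x. (p \<bullet> p) *\<^sub>R u x) \<in> Hsp L" by simp
    fix v assume "v \<in> Hsp L"
    then have "v \<in> borel_measurable borel" by (auto simp: Hsp_def L2_def)
    then show "l2_inner L (\<lambda>x. - weak_laplacian L u x - (p \<bullet> p) *\<^sub>R u x) v = 0"
      using l2_inner_cong_ae[OF L2_D[OF lapL] L2_D[OF L2_zero] _ lapae, of v L] by (simp add: l2_inner_zero_left)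
  qed
  moreover have "l2_norm L u \<noteq> 0"
  proof
    assume "l2_norm L u = 0"
    then have "0 = l2_inner L u u" by (metis l2_norm_sq zero_power2)
    also have "\<dots> = (a \<bullet> a) * l2_inner L (cmode L k) (cmode L k)"
    proof -
      have "u x \<bullet> u x = (a \<bullet> a) * (cmode L k x * cmode L k x)" for x
        by (simp add: u_def vmode_def mult_ac)
      then show ?thesis by (simp only: l2_inner_def set_integral_mult_right inner_real_def)
    qed
    finally show False using L \<open>a \<noteq> 0\<close> by (simp add: l2_inner_mode split: if_splits)
  qed
  ultimately show ?thesis
    using dom unfolding stokes_eigenvalue_def p_def by blast
qed

text \<open>
  A least element of a set of reals is only known once it is exhibited, so the lower bound has to be sharp.
\<close>

theorem lambda1_eq:
  assumes L: "L > 0"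
  shows "lambda1 L = (2 * pi / L)\<^sup>2"
  unfolding lambda1_def
proof (rule Least_equality)
  have "stokes_eigenvalue L (freq L (1, 0) \<bullet> freq L (1, 0))"
    by (rule stokes_eigenvalue_vmode[OF assms, of "(1, 0)" "(0, 1)"]) (auto simp: freq_def zero_prod_def)
  then show "stokes_eigenvalue L ((2 * pi / L)\<^sup>2)"
    by (simp add: freq_def power2_eq_square)
qed (rule stokes_eigenvalue_lower[OF assms])

section \<open>Balanced horizontal profiles\<close>

definition wavenumber :: "real \<Rightarrow> nat \<Rightarrow> real" where
  "wavenumber L n = 2 * pi / L * (real (n div 2) + 1)"

text \<open>
  The action of \<open>\<partial>\<^sub>1\<close> on coefficients: it swaps the cosine at \<open>2j\<close> with the sine at \<open>2j + 1\<close>.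
\<close>

definition hderiv :: "real \<Rightarrow> (nat \<Rightarrow> real) \<Rightarrow> nat \<Rightarrow> real" where
  "hderiv L a n = wavenumber L n * (if even n then a (n + 1) else - a (n - 1))"

lemma wavenumber_lower: "L > 0 \<Longrightarrow> 2 * pi / L \<le> wavenumber L n" and wavenumber_pos: "L > 0 \<Longrightarrow> wavenumber L n > 0"
proof -
  assume L: "L > 0"
  then have "2 * pi / L * 1 \<le> 2 * pi / L * (real (n div 2) + 1)" by (intro mult_left_mono) auto
  then show "2 * pi / L \<le> wavenumber L n" by (simp add: wavenumber_def)
  moreover have "2 * pi / L > 0" using L by simp
  ultimately show "wavenumber L n > 0" by linarith
qed

lemma hderiv_hderiv: "hderiv L (hderiv L a) n = - (wavenumber L n)\<^sup>2 * a n"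
  by (cases "even n") (auto simp: hderiv_def wavenumber_def power2_eq_square elim!: oddE)

lemma freq_wave: "freq L (wave n) \<bullet> (1, 0) = wavenumber L n"
  by (simp add: freq_def wave_def wavenumber_def)

lemma hmode_trig: "\<exists>a b. hmode L n = (\<lambda>x. cos (freq L (wave n) \<bullet> x) *\<^sub>R a + sin (freq L (wave n) \<bullet> x) *\<^sub>R b)"
proof (cases "even n")
  case True
  then have "hmode L n = (\<lambda>x. cos (freq L (wave n) \<bullet> x) *\<^sub>R (sqrt 2 / L) + sin (freq L (wave n) \<bullet> x) *\<^sub>R 0)"
    by (auto simp: hmode_def cmode_def)
  then show ?thesis by blast
next
  case False
  then have "hmode L n = (\<lambda>x. cos (freq L (wave n) \<bullet> x) *\<^sub>R 0 + sin (freq L (wave n) \<bullet> x) *\<^sub>R (sqrt 2 / L))"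
    by (auto simp: hmode_def smode_def)
  then show ?thesis by blast
qed

lemma Cinf_hmode: "Cinf_on UNIV (hmode L n)"
  using hmode_trig[of L n] by (elim exE) (simp only: Cinf_trig)

lemma C1_hmode: "C1 (hmode L n)"
  by (rule Cinf_imp_C1[OF Cinf_hmode])

lemma periodic_hmode: "L > 0 \<Longrightarrow> periodic L (hmode L n)"
  using hmode_trig[of L n] by (elim exE) (simp only: periodic_trig)

lemma pd_hmode: "pd (1, 0) (hmode L n) x = wavenumber L n * (if even n then - hmode L (n + 1) x else hmode L (n - 1) x)"
proof (cases "even n")
  case True
  have "wave (n + 1) = wave n" using True by (auto simp: wave_def)
  moreover have "pd (1, 0) (hmode L n) x = sqrt 2 / L * pd (1, 0) (cmode L (wave n)) x"
    using True pd_scaleR[OF C1_const C1_mode(1), of "(1,0)" "sqrt 2 / L" L "wave n" x]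
    by (simp add: hmode_even pd_def)
  ultimately show ?thesis using True
    by (simp add: pd_mode freq_wave hmode_def)
next
  case False
  have "wave (n - 1) = wave n" using False by (auto simp: wave_def elim!: oddE)
  moreover have "pd (1, 0) (hmode L n) x = sqrt 2 / L * pd (1, 0) (smode L (wave n)) x"
    using False pd_scaleR[OF C1_const C1_mode(2), of "(1,0)" "sqrt 2 / L" L "wave n" x]
    by (simp add: hmode_odd pd_def)
  ultimately show ?thesis using False
    by (simp add: pd_mode freq_wave hmode_def)
qed

definition hpoly :: "real \<Rightarrow> (nat \<Rightarrow> real) \<Rightarrow> nat \<Rightarrow> real \<times> real \<Rightarrow> real" where
  "hpoly L a N x = (\<Sum>n<N. a n * hmode L n x)"

lemma hmode_flat: "hmode L n (y, t) = hmode L n (y, 0)"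
proof -
  have "freq L (wave n) \<bullet> (y, t) = freq L (wave n) \<bullet> (y, 0)" by (simp add: freq_def wave_def)
  then show ?thesis by (simp only: hmode_def cmode_def smode_def)
qed

lemma C1_hpoly: "C1 (hpoly L a N)"
  unfolding hpoly_def[abs_def] using C1_scaleR[OF C1_const C1_hmode] by (intro C1_sum) simp

lemma periodic_hpoly: "L > 0 \<Longrightarrow> periodic L (hpoly L a N)"
  using periodic_hmode by (simp add: periodic_def hpoly_def)

lemma hpoly_L2: "L > 0 \<Longrightarrow> hpoly L a N \<in> L2 L"
  by (intro L2_I_continuous C1_continuous C1_hpoly periodic_hpoly)

lemma hpoly_Suc: "hpoly L a (Suc N) = (\<lambda>x. hpoly L a N x + a N * hmode L N x)"
  by (simp add: hpoly_def[abs_def])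

text \<open>
  Only sums over complete cosine-sine pairs are mapped to partial sums, hence the even length.
\<close>

lemma pd_hpoly: "pd (1, 0) (hpoly L a (2 * M)) = hpoly L (hderiv L a) (2 * M)"
proof (induction M)
  case 0
  show ?case by (simp add: hpoly_def[abs_def] pd_def)
next
  case (Suc M)
  have term_C1: "C1 (\<lambda>x. a n * hmode L n x)" for n using C1_scaleR[OF C1_const C1_hmode, of "a n"] by simp
  have term_pd: "pd (1, 0) (\<lambda>x. a n * hmode L n x) x = a n * pd (1, 0) (hmode L n) x" for n x
    using pd_scaleR[OF C1_const C1_hmode, of "(1, 0)" "a n" L n x] by (simp add: pd_def)
  have "pd (1, 0) (hpoly L a (2 * Suc M)) x = hpoly L (hderiv L a) (2 * Suc M) x" for x
  proof -
    have "pd (1, 0) (hpoly L a (2 * Suc M)) x = pd (1, 0) (hpoly L a (2 * M)) x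
        + a (2 * M) * pd (1, 0) (hmode L (2 * M)) x + a (2 * M + 1) * pd (1, 0) (hmode L (2 * M + 1)) x"
    proof -
      have "pd (1, 0) (\<lambda>x. hpoly L a (2 * M) x + a (2 * M) * hmode L (2 * M) x) x
          = pd (1, 0) (hpoly L a (2 * M)) x + a (2 * M) * pd (1, 0) (hmode L (2 * M)) x"
        unfolding term_pd[symmetric] by (rule pd_add[OF C1_hpoly term_C1])
      moreover have "pd (1, 0) (\<lambda>x. (hpoly L a (2 * M) x + a (2 * M) * hmode L (2 * M) x)
            + a (2 * M + 1) * hmode L (2 * M + 1) x) x
          = pd (1, 0) (\<lambda>x. hpoly L a (2 * M) x + a (2 * M) * hmode L (2 * M) x) x
            + a (2 * M + 1) * pd (1, 0) (hmode L (2 * M + 1)) x"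
        unfolding term_pd[symmetric] by (rule pd_add[OF C1_add[OF C1_hpoly term_C1] term_C1])
      ultimately show ?thesis by (simp add: hpoly_Suc)
    qed
    also have "\<dots> = hpoly L (hderiv L a) (2 * M) x + hderiv L a (2 * M) * hmode L (2 * M) x
        + hderiv L a (2 * M + 1) * hmode L (2 * M + 1) x"
    proof -
      have "wavenumber L (2 * M + 1) = wavenumber L (2 * M)" by (simp add: wavenumber_def)
      then show ?thesis unfolding Suc pd_hmode hderiv_def by simp
    qed
    finally show ?thesis by (simp add: hpoly_Suc)
  qed
  then show ?case by (rule ext)
qed

lemma bounded_linear_vertical: "bounded_linear (\<lambda>t::real. (0::real, c * t))"
  by (intro bounded_linear_Pair bounded_linear_zero bounded_linear_mult_right)

lemma norm_vertical: "l2_norm L (\<lambda>x. (0::real, c * f x)) = \<bar>c\<bar> * l2_norm L f"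
proof -
  have "l2_inner L (\<lambda>x. (0::real, c * f x)) (\<lambda>x. (0, c * f x)) = l2_inner L (\<lambda>x. c *\<^sub>R f x) (\<lambda>x. c *\<^sub>R f x)"
    by (simp add: l2_inner_def)
  then show ?thesis by (metis l2_norm_def l2_norm_scaleR)
qed

lemma vertical_mode_solenoidal:
  assumes L: "L > 0"
  shows "(\<lambda>x. (0, c * hmode L n x)) \<in> solenoidal_trig L"
proof -
  have p: "freq L (wave n) \<bullet> (0, d) = 0" for d by (simp add: freq_def wave_def)
  show ?thesis
  proof (cases "even n")
    case True
    then have "(\<lambda>x. (0, c * hmode L n x)) = vmode L (wave n) (0, c * (sqrt 2 / L)) (0, 0)"
      by (simp add: vmode_def[abs_def] hmode_def mult_ac)
    then show ?thesis using vmode_solenoidal[OF assms wave_eqs(3) p p] by metis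
  next
    case False
    then have "(\<lambda>x. (0, c * hmode L n x)) = vmode L (wave n) (0, 0) (0, c * (sqrt 2 / L))"
      by (simp add: vmode_def[abs_def] hmode_def mult_ac)
    then show ?thesis using vmode_solenoidal[OF assms wave_eqs(3) p p] by metis
  qed
qed

lemma vertical_hpoly_solenoidal:
  assumes L: "L > 0"
  shows "(\<lambda>x. (0, c * hpoly L a N x)) \<in> solenoidal_trig L"
proof (induction N)
  case 0
  show ?case using solenoidal_trig_zero by (simp add: hpoly_def zero_prod_def)
next
  case (Suc N)
  show ?case
    using solenoidal_trig_add[OF assms Suc vertical_mode_solenoidal[OF assms, of "c * a N" N]]
    by (simp add: hpoly_Suc algebra_simps)
qed

lemma L2_limit_subseq:
  assumes "(\<lambda>N. l2_norm L (\<lambda>x. f x - hpoly L a N x)) \<longlonglongrightarrow> 0"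
  shows "(\<lambda>M. l2_norm L (\<lambda>x. f x - hpoly L a (2 * M) x)) \<longlonglongrightarrow> 0"
  using LIMSEQ_subseq_LIMSEQ[OF assms, of "\<lambda>M. 2 * M"] by (simp add: strict_mono_def o_def)

text \<open>
  One element \<open>u\<close> of the ellipsoid with the temperature \<open>\<theta>\<close> that generates it; \<open>g\<close> is the first derivative
  of \<open>w\<close>.
\<close>

locale horizontal_profile =
  fixes L \<nu> :: real and \<theta> w g :: "real \<times> real \<Rightarrow> real" and u :: "real \<times> real \<Rightarrow> real \<times> real"
  assumes L: "L > 0" and \<nu>: "\<nu> > 0" and \<theta>: "\<theta> \<in> L2_0H L" and w: "w \<in> L2_0H L" and g: "g \<in> L2 L"
    and wg: "has_weak_pd L (1, 0) w g" and g\<theta>: "has_weak_pd L (1, 0) g (\<lambda>x. - \<theta> x)"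
    and u: "u \<in> L2 L" and uw: "ae_eq u (\<lambda>x. (0, 1 / \<nu> * w x))"
begin

sublocale orthonormal_sequence L "hmode L"
  by (rule hmode_orthonormal_sequence[OF L])

lemma \<theta>_L2: "\<theta> \<in> L2 L" and w_L2: "w \<in> L2 L"
  using \<theta> w by (auto simp: L2_0H_def L2_0_def)

lemma basis_memb: "(1, 0) \<in> (Basis :: (real \<times> real) set)" "(0, 1) \<in> (Basis :: (real \<times> real) set)"
  by (auto simp: Basis_plane)

lemma vertical_L2: "f \<in> L2 L \<Longrightarrow> (\<lambda>x. (0::real, c * f x)) \<in> L2 L" for f :: "real \<times> real \<Rightarrow> real"
  by (rule L2_bounded_linear[OF _ bounded_linear_vertical])

lemma w_vertical_derivative: "has_weak_pd L (0, 1) w (\<lambda>x. 0)"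
proof -
  obtain h where "ae_eq w (\<lambda>x. h (fst x))" using w by (auto simp: L2_0H_def)
  then show ?thesis
    unfolding has_weak_pd_def
    using integral_horizontal_pd[OF L Cinf_imp_C1 _ L2_D[OF w_L2] norm_integrable_L2[OF w_L2]]
    by (simp add: mult.commute)
qed

lemma u_derivatives:
  shows "has_weak_pd L (1, 0) u (\<lambda>x. (0, 1 / \<nu> * g x))" "has_weak_pd L (0, 1) u (\<lambda>x. 0)"
proof -
  have wu: "ae_eq (\<lambda>x. (0, 1 / \<nu> * w x)) u" using uw by (auto simp: ae_eq_def elim: eventually_mono)
  have rfl: "ae_eq h h" for h :: "real \<times> real \<Rightarrow> real \<times> real" by (simp add: ae_eq_def)
  have "has_weak_pd L (1, 0) (\<lambda>x. (0::real, 1 / \<nu> * w x)) (\<lambda>x. (0, 1 / \<nu> * g x))"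
    by (rule has_weak_pd_linear[OF bounded_linear_vertical w_L2 g basis_memb(1) wg])
  then show "has_weak_pd L (1, 0) u (\<lambda>x. (0, 1 / \<nu> * g x))"
    by (rule has_weak_pd_cong_ae[OF _ basis_memb(1) wu rfl])
       (rule L2_D[OF vertical_L2[OF w_L2]] L2_D[OF vertical_L2[OF g]] L2_D[OF u])+
  have "has_weak_pd L (0, 1) (\<lambda>x. (0::real, 1 / \<nu> * w x)) (\<lambda>x. (0, 1 / \<nu> * 0))"
    by (rule has_weak_pd_linear[OF bounded_linear_vertical w_L2 L2_zero basis_memb(2) w_vertical_derivative])
  then have "has_weak_pd L (0, 1) (\<lambda>x. (0::real, 1 / \<nu> * w x)) (\<lambda>x. 0)" by (simp add: zero_prod_def)
  then show "has_weak_pd L (0, 1) u (\<lambda>x. 0)"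
    by (rule has_weak_pd_cong_ae[OF _ basis_memb(2) wu rfl])
       (rule L2_D[OF vertical_L2[OF w_L2]] L2_D[OF L2_zero] L2_D[OF u])+
qed

lemma wpd_u:
  shows "wpd L (1, 0) u \<in> L2 L" "ae_eq (wpd L (1, 0) u) (\<lambda>x. (0, 1 / \<nu> * g x))"
    "wpd L (0, 1) u \<in> L2 L" "ae_eq (wpd L (0, 1) u) (\<lambda>x. 0)"
  using wpd_ae[OF L vertical_L2[OF g] u_derivatives(1)] wpd_ae[OF L L2_zero u_derivatives(2)] by blast+

abbreviation "w_coeff n \<equiv> l2_inner L w (hmode L n)"

lemma \<theta>_coeff: "l2_inner L \<theta> (hmode L n) = (wavenumber L n)\<^sup>2 * w_coeff n"
proof -
  have as_integral: "l2_inner L f (cmode L k) = (LINT x:cell L|lborel. cmode L k x *\<^sub>R f x)"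
    "l2_inner L f (smode L k) = (LINT x:cell L|lborel. smode L k x *\<^sub>R f x)" for f k
    by (simp_all add: l2_inner_def mult.commute)
  have "l2_inner L (\<lambda>x. - \<theta> x) (cmode L (wave n)) = - (wavenumber L n)\<^sup>2 * l2_inner L w (cmode L (wave n))"
    "l2_inner L (\<lambda>x. - \<theta> x) (smode L (wave n)) = - (wavenumber L n)\<^sup>2 * l2_inner L w (smode L (wave n))"
    unfolding as_integral weak_second_derivative_mode[OF L wg g\<theta>, of "wave n"] freq_wave by simp_all
  moreover have "l2_inner L (\<lambda>x. - \<theta> x) h = - l2_inner L \<theta> h" for h
    using l2_inner_scaleR_left[of L "-1" \<theta> h] by simp
  ultimately have "l2_inner L \<theta> (cmode L (wave n)) = (wavenumber L n)\<^sup>2 * l2_inner L w (cmode L (wave n))"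
     "l2_inner L \<theta> (smode L (wave n)) = (wavenumber L n)\<^sup>2 * l2_inner L w (smode L (wave n))"
    by simp_all
  then show ?thesis
    by (cases "even n") (simp_all add: hmode_even hmode_odd l2_inner_scaleR_right del: real_scaleR_def)
qed

lemma g_coeff: "l2_inner L g (hmode L n) = hderiv L w_coeff n"
proof -
  have "pd (1, 0) (hmode L n) = (\<lambda>x. (wavenumber L n * (if even n then -1 else 1)) *\<^sub>R hmode L (if even n then n + 1 else n - 1) x)"
    by (auto simp: pd_hmode)
  moreover have "l2_inner L g (hmode L n) = - l2_inner L w (pd (1, 0) (hmode L n))"
    using has_weak_pd_inner[OF wg Cinf_hmode periodic_hmode[OF L], of n] by simp
  ultimately show ?thesis
    by (simp add: l2_inner_scaleR_right hderiv_def del: real_scaleR_def)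
qed

lemma g_horizontal: "horizontal L g"
proof -
  have "l2_inner L g (cmode L k) = 0 \<and> l2_inner L g (smode L k) = 0" if k: "fst k = 0 \<or> snd k \<noteq> 0" for k
  proof -
    have w0: "l2_inner L w (cmode L k) = 0" "l2_inner L w (smode L k) = 0"
      using L2_0H_horizontal[OF L w] k unfolding horizontal_def by blast+
    have "pd (1, 0) (cmode L k) = (\<lambda>x. (- (freq L k \<bullet> (1, 0))) *\<^sub>R smode L k x)"
      "pd (1, 0) (smode L k) = (\<lambda>x. (freq L k \<bullet> (1, 0)) *\<^sub>R cmode L k x)"
      by (rule ext, simp add: pd_mode)+
    then have "l2_inner L w (pd (1, 0) (cmode L k)) = 0" "l2_inner L w (pd (1, 0) (smode L k)) = 0"
      by (simp_all only: l2_inner_scaleR_right w0 mult_zero_right)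
    then show ?thesis
      using has_weak_pd_inner[OF wg Cinf_mode(1) periodic_mode(1)[OF L], of k]
        has_weak_pd_inner[OF wg Cinf_mode(2) periodic_mode(2)[OF L], of k] by simp
  qed
  with g show ?thesis by (simp add: horizontal_def)
qed

lemma w_expansion: "(\<lambda>N. l2_norm L (\<lambda>x. w x - hpoly L w_coeff N x)) \<longlonglongrightarrow> 0"
  using horizontal_expansion[OF L L2_0H_horizontal[OF L w]] by (simp add: hpoly_def)

lemma g_expansion: "(\<lambda>N. l2_norm L (\<lambda>x. g x - hpoly L (hderiv L w_coeff) N x)) \<longlonglongrightarrow> 0"
  using horizontal_expansion[OF L g_horizontal] by (simp add: hpoly_def g_coeff)

lemma u_minus_hpoly_ae: "ae_eq (\<lambda>x. u x - (0, 1 / \<nu> * h x)) (\<lambda>x. (0, 1 / \<nu> * (w x - h x)))"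
  using uw unfolding ae_eq_def by eventually_elim (simp add: algebra_simps diff_divide_distrib)

lemma u_minus_hpoly_norm:
  "l2_norm L (\<lambda>x. u x - (0, 1 / \<nu> * hpoly L a N x)) = 1 / \<nu> * l2_norm L (\<lambda>x. w x - hpoly L a N x)"
proof -
  have "l2_norm L (\<lambda>x. u x - (0, 1 / \<nu> * hpoly L a N x)) = l2_norm L (\<lambda>x. (0::real, 1 / \<nu> * (w x - hpoly L a N x)))"
    by (rule l2_norm_cong_ae[OF _ _ u_minus_hpoly_ae])
       (rule L2_D[OF L2_diff[OF u vertical_L2[OF hpoly_L2[OF L]]]] L2_D[OF vertical_L2[OF L2_diff[OF w_L2 hpoly_L2[OF L]]]])+
  then show ?thesis using \<nu> by (simp only: norm_vertical) simp
qed

lemma u_expansion: "(\<lambda>N. l2_norm L (\<lambda>x. u x - (0, 1 / \<nu> * hpoly L w_coeff N x))) \<longlonglongrightarrow> 0"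
  unfolding u_minus_hpoly_norm using tendsto_mult[OF tendsto_const w_expansion, of "1 / \<nu>"] by simp

text \<open>
  Even partial sums of the series of \<open>w\<close> are solenoidal trigonometric polynomials whose derivatives are the
  even partial sums of the series of \<open>g\<close>, so the approximation holds in the \<open>H\<^sup>1\<close> norm.
\<close>

lemma u_Vsp: "u \<in> Vsp L"
proof -
  define p where "p M x = (0::real, 1 / \<nu> * hpoly L w_coeff (2 * M) x)" for M x
  have p: "p M \<in> solenoidal_trig L" for M
    unfolding p_def[abs_def] by (rule vertical_hpoly_solenoidal[OF L])
  have pL2: "p M \<in> L2 L" for M by (rule solenoidal_trig_D(3)[OF L p])
  have d1: "has_weak_pd L (1, 0) (p M) (\<lambda>x. (0, 1 / \<nu> * hpoly L (hderiv L w_coeff) (2 * M) x))" for M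
  proof -
    have "has_weak_pd L (1, 0) (hpoly L w_coeff (2 * M)) (hpoly L (hderiv L w_coeff) (2 * M))"
      using has_weak_pd_C1[OF L C1_hpoly periodic_hpoly[OF L] basis_memb(1), of w_coeff "2 * M"]
      by (simp only: pd_hpoly)
    then show ?thesis
      unfolding p_def[abs_def]
      by (rule has_weak_pd_linear[OF bounded_linear_vertical hpoly_L2[OF L] hpoly_L2[OF L] basis_memb(1)])
  qed
  have d2: "has_weak_pd L (0, 1) (p M) (\<lambda>x. 0)" for M
  proof -
    have "pd (0, 1) (hpoly L w_coeff (2 * M)) = (\<lambda>x. 0)"
    proof
      fix x :: "real \<times> real"
      have flat: "hpoly L w_coeff (2 * M) (y, t) = hpoly L w_coeff (2 * M) (y, 0)" for y t
        unfolding hpoly_def by (rule sum.cong[OF refl], subst hmode_flat) (rule refl)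
      have "((\<lambda>t. hpoly L w_coeff (2 * M) (fst x, t)) has_vector_derivative pd (0, 1) (hpoly L w_coeff (2 * M)) (fst x, snd x)) (at (snd x))"
        by (rule pd_vector_derivative(2)[OF C1_hpoly])
      moreover have "((\<lambda>t. hpoly L w_coeff (2 * M) (fst x, t)) has_vector_derivative 0) (at (snd x))"
        by (subst flat) (rule has_vector_derivative_const)
      ultimately have "pd (0, 1) (hpoly L w_coeff (2 * M)) (fst x, snd x) = 0"
        by (rule vector_derivative_unique_at)
      then show "pd (0, 1) (hpoly L w_coeff (2 * M)) x = 0" by simp
    qed
    then have "has_weak_pd L (0, 1) (hpoly L w_coeff (2 * M)) (\<lambda>x. 0)"
      using has_weak_pd_C1[OF L C1_hpoly periodic_hpoly[OF L] basis_memb(2), of w_coeff "2 * M"] by simp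
    from has_weak_pd_linear[OF bounded_linear_vertical hpoly_L2[OF L] L2_zero basis_memb(2) this, of "1 / \<nu>"]
    show ?thesis by (simp add: p_def[abs_def] zero_prod_def)
  qed
  have h1: "h1_norm L (\<lambda>x. u x - p M x) = 1 / \<nu> * sqrt ((l2_norm L (\<lambda>x. w x - hpoly L w_coeff (2 * M) x))\<^sup>2
      + (l2_norm L (\<lambda>x. g x - hpoly L (hderiv L w_coeff) (2 * M) x))\<^sup>2)" for M
  proof -
    have "has_weak_pd L (1, 0) (\<lambda>x. u x - p M x) (\<lambda>x. (0, 1 / \<nu> * g x) - (0, 1 / \<nu> * hpoly L (hderiv L w_coeff) (2 * M) x))"
      by (rule has_weak_pd_diff[OF u vertical_L2[OF g] pL2 vertical_L2[OF hpoly_L2[OF L]] basis_memb(1) u_derivatives(1) d1])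
    then have w1: "has_weak_pd L (1, 0) (\<lambda>x. u x - p M x) (\<lambda>x. (0, 1 / \<nu> * (g x - hpoly L (hderiv L w_coeff) (2 * M) x)))"
      by (simp add: right_diff_distrib diff_divide_distrib)
    have w2: "has_weak_pd L (0, 1) (\<lambda>x. u x - p M x) (\<lambda>x. 0)"
      using has_weak_pd_diff[OF u L2_zero pL2 L2_zero basis_memb(2) u_derivatives(2) d2] by simp
    have "h1_norm L (\<lambda>x. u x - p M x) = sqrt ((1 / \<nu> * l2_norm L (\<lambda>x. w x - hpoly L w_coeff (2 * M) x))\<^sup>2
       + (1 / \<nu> * l2_norm L (\<lambda>x. g x - hpoly L (hderiv L w_coeff) (2 * M) x))\<^sup>2)"
      unfolding h1_norm_eq[OF L vertical_L2[OF L2_diff[OF g hpoly_L2[OF L]]] w1 L2_zero w2]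
      unfolding norm_vertical l2_norm_zero unfolding p_def u_minus_hpoly_norm using \<nu> by simp
    also have "\<dots> = sqrt ((1 / \<nu>)\<^sup>2 * ((l2_norm L (\<lambda>x. w x - hpoly L w_coeff (2 * M) x))\<^sup>2
       + (l2_norm L (\<lambda>x. g x - hpoly L (hderiv L w_coeff) (2 * M) x))\<^sup>2))"
      by (simp only: power_mult_distrib distrib_left)
    finally show ?thesis using \<nu> by (simp only: real_sqrt_mult real_sqrt_abs) simp
  qed
  have "(\<lambda>M. 1 / \<nu> * sqrt ((l2_norm L (\<lambda>x. w x - hpoly L w_coeff (2 * M) x))\<^sup>2
      + (l2_norm L (\<lambda>x. g x - hpoly L (hderiv L w_coeff) (2 * M) x))\<^sup>2)) \<longlonglongrightarrow> 1 / \<nu> * sqrt (0\<^sup>2 + 0\<^sup>2)"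
    by (intro tendsto_mult tendsto_const tendsto_real_sqrt tendsto_add tendsto_power
        L2_limit_subseq w_expansion g_expansion)
  then have lim: "(\<lambda>M. h1_norm L (\<lambda>x. u x - p M x)) \<longlonglongrightarrow> 0" by (simp only: h1) simp
  have "\<exists>q\<in>solenoidal_trig L. h1_norm L (\<lambda>x. u x - q x) < \<epsilon>" if "\<epsilon> > 0" for \<epsilon>
  proof -
    have "\<forall>\<^sub>F M in sequentially. h1_norm L (\<lambda>x. u x - p M x) < \<epsilon>"
      using order_tendstoD(2)[OF lim that] .
    then obtain M where "h1_norm L (\<lambda>x. u x - p M x) < \<epsilon>" by (auto simp: eventually_sequentially)
    then show ?thesis using p by blast
  qed
  moreover have "u \<in> H1 L"
  proof -
    have "\<exists>h\<in>L2 L. has_weak_pd L (1, 0) u h" by (rule bexI, rule u_derivatives(1), rule vertical_L2[OF g])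
    moreover have "\<exists>h\<in>L2 L. has_weak_pd L (0, 1) u h" by (rule bexI, rule u_derivatives(2), rule L2_zero)
    ultimately show ?thesis
      using u by (simp only: H1_def Basis_plane mem_Collect_eq ball_simps simp_thms)
  qed
  ultimately show ?thesis by (simp add: Vsp_def)
qed

lemma u_Hsp: "u \<in> Hsp L"
  using u_Vsp Vsp_subset_Hsp by blast

lemma u_norm_bound: "l2_norm L u \<le> l2_norm L \<theta> / (\<nu> * (2 * pi / L)\<^sup>2)"
proof -
  define \<kappa> where "\<kappa> = 2 * pi / L"
  have \<kappa>: "\<kappa> > 0" using L by (simp add: \<kappa>_def)
  have w_sums: "(\<lambda>n. (w_coeff n)\<^sup>2) sums (l2_norm L w)\<^sup>2"
    using parseval_limit[OF w_L2, of w_coeff] w_expansion by (simp add: hpoly_def)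
  have "(l2_norm L w)\<^sup>2 * \<kappa>^4 = (\<Sum>n. (w_coeff n)\<^sup>2 * \<kappa>^4)"
    using sums_mult2[OF w_sums, of "\<kappa>^4"] by (simp add: sums_iff)
  also have "\<dots> \<le> (\<Sum>n. (l2_inner L \<theta> (hmode L n))\<^sup>2)"
  proof (rule suminf_le)
    show "summable (\<lambda>n. (w_coeff n)\<^sup>2 * \<kappa>^4)" using w_sums by (intro summable_mult2) (simp add: sums_iff)
    show "summable (\<lambda>n. (l2_inner L \<theta> (hmode L n))\<^sup>2)" by (rule bessel(1)[OF \<theta>_L2])
    show "(w_coeff n)\<^sup>2 * \<kappa>^4 \<le> (l2_inner L \<theta> (hmode L n))\<^sup>2" for n
    proof -
      have "\<kappa>^4 \<le> wavenumber L n ^ 4"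
        using wavenumber_lower[OF L, of n] \<kappa> by (intro power_mono) (auto simp: \<kappa>_def)
      then have "(w_coeff n)\<^sup>2 * \<kappa>^4 \<le> (w_coeff n)\<^sup>2 * wavenumber L n ^ 4"
        by (intro mult_left_mono) auto
      then show ?thesis by (simp add: \<theta>_coeff power_mult_distrib mult.commute flip: power_mult)
    qed
  qed
  also have "\<dots> \<le> (l2_norm L \<theta>)\<^sup>2" by (rule bessel(2)[OF \<theta>_L2])
  finally have "(l2_norm L w * \<kappa>\<^sup>2)\<^sup>2 \<le> (l2_norm L \<theta>)\<^sup>2" by (simp add: power_mult_distrib flip: power_mult)
  then have "l2_norm L w * \<kappa>\<^sup>2 \<le> l2_norm L \<theta>" by (rule power2_le_imp_le) (rule l2_norm_nonneg)
  then have "l2_norm L w \<le> l2_norm L \<theta> / \<kappa>\<^sup>2" using \<kappa> by (simp add: pos_le_divide_eq)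
  moreover have "l2_norm L u = 1 / \<nu> * l2_norm L w"
    using l2_norm_cong_ae[OF L2_D[OF u] L2_D[OF vertical_L2[OF w_L2]] uw] \<nu> by (simp only: norm_vertical) simp
  ultimately have "l2_norm L u \<le> 1 / \<nu> * (l2_norm L \<theta> / \<kappa>\<^sup>2)"
    using \<nu> mult_left_mono[of "l2_norm L w" "l2_norm L \<theta> / \<kappa>\<^sup>2" "1 / \<nu>"] by simp
  then show ?thesis by (simp add: \<kappa>_def)
qed

end

section \<open>The ellipsoid\<close>

lemma horizontal_riesz_fischer:
  assumes L: "L > 0" and "summable (\<lambda>n. (a n)\<^sup>2)"
  obtains f where "f \<in> L2_0H L" "(\<lambda>N. l2_norm L (\<lambda>x. f x - hpoly L a N x)) \<longlonglongrightarrow> 0"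
    "(\<lambda>n. (a n)\<^sup>2) sums (l2_norm L f)\<^sup>2"
proof -
  interpret orthonormal_sequence L "hmode L" by (rule hmode_orthonormal_sequence[OF L])
  obtain r where r: "(\<lambda>x. lim (\<lambda>k. \<Sum>n<r k. a n * hmode L n x)) \<in> L2 L"
    "(\<lambda>N. l2_norm L (\<lambda>x. lim (\<lambda>k. \<Sum>n<r k. a n * hmode L n x) - (\<Sum>n<N. a n * hmode L n x))) \<longlonglongrightarrow> 0"
    by (rule riesz_fischer[OF assms(2)])
  define f where "f x = lim (\<lambda>k. \<Sum>n<r k. a n * hmode L n x)" for x
  have f: "f \<in> L2 L" and lim: "(\<lambda>N. l2_norm L (\<lambda>x. f x - (\<Sum>n<N. a n * hmode L n x))) \<longlonglongrightarrow> 0"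
    using r unfolding f_def[abs_def] by blast+
  have "f (y, t) = f (y, 0)" for y t
    unfolding f_def by (subst hmode_flat) (rule refl)
  then have "f x = f (fst x, 0)" for x by (cases x) (simp only: fst_conv)
  then have flat: "ae_eq f (\<lambda>x. f (fst x, 0))" unfolding ae_eq_def by (rule AE_I2)
  have one: "cmode L 0 \<in> L2 L" by (rule L2_mode(1)[OF L])
  have "l2_inner L f (cmode L 0) = 0"
  proof (rule LIMSEQ_unique)
    show "(\<lambda>N. l2_inner L (\<lambda>x. \<Sum>n<N. a n * hmode L n x) (cmode L 0)) \<longlonglongrightarrow> l2_inner L f (cmode L 0)"
      by (rule l2_inner_tendsto[OF combination_L2 f one lim])
    have "l2_inner L (\<lambda>x. \<Sum>n<N. a n * hmode L n x) (cmode L 0) = (\<Sum>n<N. l2_inner L (\<lambda>x. a n *\<^sub>R hmode L n x) (cmode L 0))" for N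
      using l2_inner_sum_left[of "{..<N}" "\<lambda>n x. a n *\<^sub>R hmode L n x" L "cmode L 0"] L2_scaleR[OF e_L2] one by simp
    then have "l2_inner L (\<lambda>x. \<Sum>n<N. a n * hmode L n x) (cmode L 0) = 0" for N
      using hmode_inner_mode(1)[OF L, of 0] by (simp only: l2_inner_scaleR_left) simp
    then show "(\<lambda>N. l2_inner L (\<lambda>x. \<Sum>n<N. a n * hmode L n x) (cmode L 0)) \<longlonglongrightarrow> 0" by simp
  qed
  then have "mean_free L f" by (simp add: mean_free_def l2_inner_def mode_zero)
  moreover have "\<exists>g. ae_eq f (\<lambda>x. g (fst x))"
    by (rule exI[of _ "\<lambda>y. f (y, 0)"]) (rule flat)
  ultimately have "f \<in> L2_0H L" using f unfolding L2_0H_def L2_0_def by blast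
  moreover have "(\<lambda>N. l2_norm L (\<lambda>x. f x - hpoly L a N x)) \<longlonglongrightarrow> 0"
    using lim by (simp only: hpoly_def)
  moreover have "(\<lambda>n. (a n)\<^sup>2) sums (l2_norm L f)\<^sup>2" by (rule parseval_limit[OF f lim])
  ultimately show ?thesis by (rule that)
qed

text \<open>
  The swap within pairs leaves sums over complete pairs unchanged.
\<close>

lemma hderiv_summable:
  assumes "summable (\<lambda>n. (wavenumber L n * a n)\<^sup>2)"
  shows "summable (\<lambda>n. (hderiv L a n)\<^sup>2)"
proof (rule summableI_nonneg_bounded)
  have pairing: "(\<Sum>n<2 * M. (hderiv L a n)\<^sup>2) = (\<Sum>n<2 * M. (wavenumber L n * a n)\<^sup>2)" for M
  proof (induction M)
    case (Suc M)
    have "wavenumber L (Suc (2 * M)) = wavenumber L (2 * M)" by (simp add: wavenumber_def)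
    then show ?case using Suc by (simp add: hderiv_def power_mult_distrib)
  qed simp
  show "(\<Sum>n<N. (hderiv L a n)\<^sup>2) \<le> (\<Sum>n. (wavenumber L n * a n)\<^sup>2)" for N
  proof -
    have "(\<Sum>n<N. (hderiv L a n)\<^sup>2) \<le> (\<Sum>n<2 * N. (hderiv L a n)\<^sup>2)"
      by (rule sum_mono2) auto
    also have "\<dots> \<le> (\<Sum>n. (wavenumber L n * a n)\<^sup>2)"
      unfolding pairing by (rule sum_le_suminf[OF assms]) auto
    finally show ?thesis .
  qed
qed simp

text \<open>
  The norm \<open>r\<close> of the temperature divided by the symbol of \<open>-\<nu> \<partial>\<^sub>1\<^sup>2\<close>.
\<close>

definition ell_axis :: "real \<Rightarrow> real \<Rightarrow> real \<Rightarrow> nat \<Rightarrow> real" where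
  "ell_axis L \<nu> r n = r / (\<nu> * (wavenumber L n)\<^sup>2)"

lemma ell_axis_tendsto:
  assumes L: "L > 0" and "\<nu> > 0" "r > 0"
  shows "ell_axis L \<nu> r \<longlonglongrightarrow> 0"
proof (rule tendsto_sandwich[OF _ _ tendsto_const])
  define q where "q = \<nu> * (2 * pi / L)\<^sup>2"
  define K where "K = 2 * r / q"
  have le: "ell_axis L \<nu> r n \<le> K * inverse (real (Suc n))" for n
  proof -
    define m where "m = real (n div 2) + 1"
    have m: "m \<ge> 1" "real (Suc n) \<le> 2 * m"
    proof -
      have "Suc n \<le> 2 * (n div 2 + 1)" by presburger
      then have "real (Suc n) \<le> real (2 * (n div 2 + 1))" by (simp only: of_nat_le_iff)
      then show "m \<ge> 1" "real (Suc n) \<le> 2 * m" by (auto simp: m_def)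
    qed
    have "real (Suc n) / 2 \<le> m" using m(2) by simp
    also have "m \<le> m\<^sup>2" using m(1) by (rule self_le_power) simp
    finally have sq: "real (Suc n) / 2 \<le> m\<^sup>2" .
    have q: "q > 0" using assms by (simp add: q_def)
    have "ell_axis L \<nu> r n = r / (q * m\<^sup>2)"
      by (simp only: ell_axis_def wavenumber_def m_def q_def power_mult_distrib mult.assoc)
    also have "\<dots> \<le> r / (q * (real (Suc n) / 2))"
    proof (rule divide_left_mono)
      show "q * (real (Suc n) / 2) \<le> q * m\<^sup>2" using q by (intro mult_left_mono[OF sq]) simp
      have "0 < q * m\<^sup>2" using q m(1) by simp
      moreover have "0 < q * (real (Suc n) / 2)" using q by simp
      ultimately show "0 < q * m\<^sup>2 * (q * (real (Suc n) / 2))" by (rule mult_pos_pos)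
    qed (use assms in simp)
    also have "\<dots> = K * inverse (real (Suc n))"
      unfolding K_def by (simp only: divide_inverse inverse_mult_distrib inverse_inverse_eq mult_ac)
    finally show ?thesis .
  qed
  show "\<forall>\<^sub>F n in sequentially. ell_axis L \<nu> r n \<le> K * inverse (real (Suc n))" by (intro always_eventually allI le)
  show "(\<lambda>n. K * inverse (real (Suc n))) \<longlonglongrightarrow> 0"
    by (rule tendsto_mult_right_zero[OF LIMSEQ_inverse_real_of_nat])
  have "0 \<le> ell_axis L \<nu> r n" for n using assms by (simp add: ell_axis_def)
  then show "\<forall>\<^sub>F n in sequentially. 0 \<le> ell_axis L \<nu> r n" by (intro always_eventually allI)
qed

definition ell_basis :: "real \<Rightarrow> nat \<Rightarrow> real \<times> real \<Rightarrow> real \<times> real" where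
  "ell_basis L n x = (0, hmode L n x)"

lemma ell_basis_sum: "(\<Sum>n<N. c n *\<^sub>R ell_basis L n x) = (0, hpoly L c N x)"
  by (induction N) (simp_all add: ell_basis_def hpoly_def zero_prod_def)

lemma hpoly_scale: "hpoly L (\<lambda>n. c * a n) N x = c * hpoly L a N x"
  by (simp add: hpoly_def sum_distrib_left mult.assoc)

lemma EH_profileD:
  assumes L: "L > 0" and "\<nu> > 0" "u \<in> EH L \<nu> r"
  obtains \<theta> w g where "horizontal_profile L \<nu> \<theta> w g u" "l2_norm L \<theta> \<le> r"
proof -
  obtain \<theta> w where u: "u \<in> L2 L" "\<theta> \<in> L2_0H L" "l2_norm L \<theta> \<le> r" "inv_neg_d1_sq L \<theta> w" "ae_eq u (\<lambda>x. (0, 1 / \<nu> * w x))"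
    using assms(3) unfolding EH_def by blast
  then obtain g where "g \<in> L2 L" "has_weak_pd L (1, 0) w g" "has_weak_pd L (1, 0) g (\<lambda>x. - \<theta> x)" "w \<in> L2_0H L"
    unfolding inv_neg_d1_sq_def by blast
  with u assms that show ?thesis by (auto simp: horizontal_profile_def)
qed

text \<open>
  The coefficients of \<open>u\<close>, measured in units of the semi-axes, are those of \<open>\<theta>/r\<close>; Bessel's inequality
  bounds their square sum by one.
\<close>

lemma EH_subset_ellipsoid:
  assumes L: "L > 0" and "\<nu> > 0" "r > 0" and u: "u \<in> EH L \<nu> r"
  shows "u \<in> Hsp L \<and> (\<exists>c. summable (\<lambda>n. (c n)\<^sup>2 / (ell_axis L \<nu> r n)\<^sup>2) \<and> (\<Sum>n. (c n)\<^sup>2 / (ell_axis L \<nu> r n)\<^sup>2) \<le> 1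
     \<and> (\<lambda>N. l2_norm L (\<lambda>x. u x - (\<Sum>n<N. c n *\<^sub>R ell_basis L n x))) \<longlonglongrightarrow> 0)"
proof -
  obtain \<theta> w g where prof: "horizontal_profile L \<nu> \<theta> w g u" and r: "l2_norm L \<theta> \<le> r"
    using EH_profileD[OF assms(1,2) u] .
  interpret horizontal_profile L \<nu> \<theta> w g u by (rule prof)
  define c where "c n = 1 / \<nu> * w_coeff n" for n
  have ratio: "(c n)\<^sup>2 / (ell_axis L \<nu> r n)\<^sup>2 = (l2_inner L \<theta> (hmode L n))\<^sup>2 / r\<^sup>2" for n
    using wavenumber_pos[OF assms(1), of n] assms
    by (simp add: c_def ell_axis_def \<theta>_coeff power_divide power_mult_distrib field_simps)
  have "(\<lambda>N. l2_norm L (\<lambda>x. u x - (\<Sum>n<N. c n *\<^sub>R ell_basis L n x))) \<longlonglongrightarrow> 0"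
    using u_expansion unfolding ell_basis_sum c_def hpoly_scale .
  moreover have "summable (\<lambda>n. (c n)\<^sup>2 / (ell_axis L \<nu> r n)\<^sup>2)"
    unfolding ratio by (rule summable_divide[OF bessel(1)[OF \<theta>_L2]])
  moreover have "(\<Sum>n. (c n)\<^sup>2 / (ell_axis L \<nu> r n)\<^sup>2) \<le> 1"
  proof -
    have "(\<Sum>n. (c n)\<^sup>2 / (ell_axis L \<nu> r n)\<^sup>2) = (\<Sum>n. (l2_inner L \<theta> (hmode L n))\<^sup>2) / r\<^sup>2"
      unfolding ratio by (rule suminf_divide[OF bessel(1)[OF \<theta>_L2]])
    also have "\<dots> \<le> (l2_norm L \<theta>)\<^sup>2 / r\<^sup>2" by (intro divide_right_mono bessel(2)[OF \<theta>_L2]) simp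
    also have "\<dots> \<le> 1" using r assms l2_norm_nonneg[of L \<theta>] by (simp add: power_mono)
    finally show ?thesis .
  qed
  ultimately show ?thesis using u_Hsp by blast
qed

text \<open>
  Multiplying the coefficients by \<open>\<nu>\<close> and powers of the wave number gives candidates for \<open>w\<close>, \<open>g\<close> and \<open>\<theta>\<close>.
  All three series converge since the one for \<open>\<theta>\<close> does, and weak derivatives pass to the limit.
\<close>

lemma ellipsoid_subset_EH:
  assumes L: "L > 0" and "\<nu> > 0" "r > 0" and u: "u \<in> Hsp L"
    and summ: "summable (\<lambda>n. (c n)\<^sup>2 / (ell_axis L \<nu> r n)\<^sup>2)" and le: "(\<Sum>n. (c n)\<^sup>2 / (ell_axis L \<nu> r n)\<^sup>2) \<le> 1"
    and lim: "(\<lambda>N. l2_norm L (\<lambda>x. u x - (\<Sum>n<N. c n *\<^sub>R ell_basis L n x))) \<longlonglongrightarrow> 0"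
  shows "u \<in> EH L \<nu> r"
proof -
  define \<kappa> where "\<kappa> = 2 * pi / L"
  have \<kappa>: "\<kappa> > 0" "\<And>n. \<kappa> \<le> wavenumber L n" using L wavenumber_lower by (auto simp: \<kappa>_def)
  define a where "a n = \<nu> * c n" for n
  define t where "t n = (wavenumber L n)\<^sup>2 * a n" for n
  have t_sq: "(t n)\<^sup>2 = r\<^sup>2 * ((c n)\<^sup>2 / (ell_axis L \<nu> r n)\<^sup>2)" for n
    using wavenumber_pos[OF L, of n] assms
    by (simp add: t_def a_def ell_axis_def power_divide power_mult_distrib field_simps)
  have t_summ: "summable (\<lambda>n. (t n)\<^sup>2)" unfolding t_sq by (rule summable_mult[OF summ])
  have d_summ: "summable (\<lambda>n. (wavenumber L n * a n)\<^sup>2)"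
  proof (rule summable_comparison_test')
    show "summable (\<lambda>n. (t n)\<^sup>2 / \<kappa>\<^sup>2)" by (rule summable_divide[OF t_summ])
    show "norm ((wavenumber L n * a n)\<^sup>2) \<le> (t n)\<^sup>2 / \<kappa>\<^sup>2" for n
    proof -
      have "\<kappa>\<^sup>2 * (wavenumber L n * a n)\<^sup>2 \<le> (wavenumber L n)\<^sup>2 * (wavenumber L n * a n)\<^sup>2"
        using \<kappa> by (intro mult_right_mono power_mono) auto
      also have "\<dots> = (t n)\<^sup>2" by (simp add: t_def power2_eq_square)
      finally show ?thesis using \<kappa>(1) by (simp add: pos_le_divide_eq mult.commute)
    qed
  qed
  have a_summ: "summable (\<lambda>n. (a n)\<^sup>2)"
  proof (rule summable_comparison_test')
    show "summable (\<lambda>n. (wavenumber L n * a n)\<^sup>2 / \<kappa>\<^sup>2)" by (rule summable_divide[OF d_summ])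
    show "norm ((a n)\<^sup>2) \<le> (wavenumber L n * a n)\<^sup>2 / \<kappa>\<^sup>2" for n
    proof -
      have "\<kappa>\<^sup>2 * (a n)\<^sup>2 \<le> (wavenumber L n)\<^sup>2 * (a n)\<^sup>2"
        using \<kappa> by (intro mult_right_mono power_mono) auto
      then show ?thesis using \<kappa>(1) by (simp add: pos_le_divide_eq mult.commute power_mult_distrib)
    qed
  qed
  obtain \<theta> where \<theta>: "\<theta> \<in> L2_0H L" "(\<lambda>N. l2_norm L (\<lambda>x. \<theta> x - hpoly L t N x)) \<longlonglongrightarrow> 0"
    "(\<lambda>n. (t n)\<^sup>2) sums (l2_norm L \<theta>)\<^sup>2"
    using horizontal_riesz_fischer[OF L t_summ] .
  obtain w where w: "w \<in> L2_0H L" "(\<lambda>N. l2_norm L (\<lambda>x. w x - hpoly L a N x)) \<longlonglongrightarrow> 0"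
    using horizontal_riesz_fischer[OF L a_summ] .
  obtain g where g: "g \<in> L2_0H L" "(\<lambda>N. l2_norm L (\<lambda>x. g x - hpoly L (hderiv L a) N x)) \<longlonglongrightarrow> 0"
    using horizontal_riesz_fischer[OF L hderiv_summable[OF d_summ]] .
  have mem: "\<theta> \<in> L2 L" "w \<in> L2 L" "g \<in> L2 L" using \<theta>(1) w(1) g(1) by (auto simp: L2_0H_def L2_0_def)
  have b: "(1, 0) \<in> (Basis :: (real \<times> real) set)" by (simp add: Basis_plane)
  have hpoly_pd: "has_weak_pd L (1, 0) (hpoly L a' (2 * M)) (hpoly L (hderiv L a') (2 * M))" for a' M
    using has_weak_pd_C1[OF L C1_hpoly periodic_hpoly[OF L] b, of a' "2 * M"] by (simp only: pd_hpoly)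
  have wg: "has_weak_pd L (1, 0) w g"
    by (rule has_weak_pd_limit[OF hpoly_L2[OF L] hpoly_L2[OF L] mem(2,3) b hpoly_pd])
       (rule L2_limit_subseq w g)+
  have second: "hpoly L (hderiv L (hderiv L a)) N x = - hpoly L t N x" for N x
    by (simp add: hpoly_def hderiv_hderiv t_def sum_negf)
  have "(\<lambda>M. l2_norm L (\<lambda>x. - \<theta> x - hpoly L (hderiv L (hderiv L a)) (2 * M) x)) \<longlonglongrightarrow> 0"
  proof -
    have "l2_norm L (\<lambda>x. - \<theta> x - hpoly L (hderiv L (hderiv L a)) N x) = l2_norm L (\<lambda>x. \<theta> x - hpoly L t N x)" for N
      unfolding second using l2_norm_minus_commute[of L \<theta> "hpoly L t N"] by (simp add: algebra_simps)
    then show ?thesis using L2_limit_subseq[OF \<theta>(2)] by simp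
  qed
  then have g\<theta>: "has_weak_pd L (1, 0) g (\<lambda>x. - \<theta> x)"
    by (rule has_weak_pd_limit[OF hpoly_L2[OF L] hpoly_L2[OF L] mem(3) L2_uminus[OF mem(1)] b hpoly_pd
          L2_limit_subseq[OF g(2)]])
  have \<theta>_norm: "l2_norm L \<theta> \<le> r"
  proof (rule power2_le_imp_le)
    have "(l2_norm L \<theta>)\<^sup>2 = r\<^sup>2 * (\<Sum>n. (c n)\<^sup>2 / (ell_axis L \<nu> r n)\<^sup>2)"
      by (rule sums_unique2[OF \<theta>(3)[unfolded t_sq] sums_mult[OF summable_sums[OF summ]]])
    also have "\<dots> \<le> r\<^sup>2 * 1" using le by (intro mult_left_mono) auto
    finally show "(l2_norm L \<theta>)\<^sup>2 \<le> r\<^sup>2" by simp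
  qed (use assms in simp)
  have uL: "u \<in> L2 L" using u by (simp add: Hsp_def)
  define v where "v x = (0::real, 1 / \<nu> * w x)" for x
  have vL: "v \<in> L2 L" unfolding v_def[abs_def] by (rule L2_bounded_linear[OF mem(2) bounded_linear_vertical])
  define s where "s N x = (0::real, hpoly L c N x)" for N x
  have sL: "s N \<in> L2 L" for N
    unfolding s_def[abs_def] using L2_bounded_linear[OF hpoly_L2[OF L] bounded_linear_vertical[of 1], of c N] by simp
  have us: "(\<lambda>N. l2_norm L (\<lambda>x. u x - s N x)) \<longlonglongrightarrow> 0" using lim unfolding ell_basis_sum s_def .
  have vs: "(\<lambda>N. l2_norm L (\<lambda>x. s N x - v x)) \<longlonglongrightarrow> 0"
  proof -
    have "s N x - v x = (0, - (1 / \<nu>) * (w x - hpoly L a N x))" for N x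
      using \<open>\<nu> > 0\<close> by (simp add: s_def v_def a_def[abs_def] hpoly_scale field_simps)
    then have "l2_norm L (\<lambda>x. s N x - v x) = \<bar>- (1 / \<nu>)\<bar> * l2_norm L (\<lambda>x. w x - hpoly L a N x)" for N
      by (simp only: norm_vertical)
    then show ?thesis using tendsto_mult[OF tendsto_const w(2), of "\<bar>- (1 / \<nu>)\<bar>"] by simp
  qed
  have "l2_norm L (\<lambda>x. u x - v x) \<le> 0"
  proof (rule LIMSEQ_le_const)
    show "(\<lambda>N. l2_norm L (\<lambda>x. u x - s N x) + l2_norm L (\<lambda>x. s N x - v x)) \<longlonglongrightarrow> 0"
      using tendsto_add[OF us vs] by simp
    have "l2_norm L (\<lambda>x. u x - v x) \<le> l2_norm L (\<lambda>x. u x - s N x) + l2_norm L (\<lambda>x. s N x - v x)" for N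
      using l2_norm_triangle[OF L2_diff[OF uL sL[of N]] L2_diff[OF sL[of N] vL]] by simp
    then show "\<exists>N. \<forall>n\<ge>N. l2_norm L (\<lambda>x. u x - v x) \<le> l2_norm L (\<lambda>x. u x - s n x) + l2_norm L (\<lambda>x. s n x - v x)"
      by blast
  qed
  then have "l2_norm L (\<lambda>x. u x - v x) = 0" using l2_norm_nonneg[of L "\<lambda>x. u x - v x"] by simp
  from l2_norm_eq_0_imp_ae[OF L L2_diff[OF uL vL] this]
  have "ae_eq u (\<lambda>x. (0, 1 / \<nu> * w x))" by (simp add: ae_eq_def v_def)
  then show ?thesis
    using uL \<theta>(1) \<theta>_norm w(1) mem(3) wg g\<theta> unfolding EH_def inv_neg_d1_sq_def by blast
qed

theorem EH_ellipsoid: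
  assumes L: "L > 0" and "\<nu> > 0" "r > 0"
  shows "infinite_dim_hilbert_ellipsoid L (EH L \<nu> r)"
  unfolding infinite_dim_hilbert_ellipsoid_def
proof (intro exI conjI allI)
  show "ell_basis L n \<in> Hsp L" for n
    using solenoidal_in_Hsp[OF L vertical_mode_solenoidal[OF L, of 1 n]] by (simp add: ell_basis_def[abs_def])
  show "l2_inner L (ell_basis L m) (ell_basis L n) = (if m = n then 1 else 0)" for m n
    using hmode_orthonormal[OF L, of m n] by (simp add: ell_basis_def l2_inner_def)
  show "ell_axis L \<nu> r n > 0" for n
    using wavenumber_pos[OF L, of n] assms by (simp add: ell_axis_def)
  show "ell_axis L \<nu> r \<longlonglongrightarrow> 0" by (rule ell_axis_tendsto[OF assms])
  show "EH L \<nu> r = {u \<in> Hsp L. \<exists>c. summable (\<lambda>n. (c n)\<^sup>2 / (ell_axis L \<nu> r n)\<^sup>2)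
      \<and> (\<Sum>n. (c n)\<^sup>2 / (ell_axis L \<nu> r n)\<^sup>2) \<le> 1
      \<and> (\<lambda>N. l2_norm L (\<lambda>x. u x - (\<Sum>n<N. c n *\<^sub>R ell_basis L n x))) \<longlonglongrightarrow> 0}" (is "_ = ?E")
  proof (intro equalityI subsetI)
    show "u \<in> ?E" if "u \<in> EH L \<nu> r" for u
      using EH_subset_ellipsoid[OF assms that] by (simp only: mem_Collect_eq)
    show "u \<in> EH L \<nu> r" if "u \<in> ?E" for u
      using that by (elim CollectE conjE exE) (rule ellipsoid_subset_EH[OF assms])
  qed
qed

section \<open>Test functions on space-time slabs\<close>

abbreviation slab :: "real \<Rightarrow> (real \<times> real \<times> real) set" where
  "slab T \<equiv> {0..T} \<times> UNIV"

text \<open>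
  Derivatives within the slab restrict to full derivatives on time slices, so that test functions at a
  fixed time, the boundary times included, are admissible for weak derivatives in space.
\<close>

lemma slice_has_derivative:
  fixes F :: "real \<times> real \<times> real \<Rightarrow> 'b::euclidean_space"
  assumes "F differentiable (at (t, x) within slab T)" "t \<in> {0..T}"
  shows "((\<lambda>x. F (t, x)) has_derivative (\<lambda>h. frechet_derivative F (at (t, x) within slab T) (0, h))) (at x)"
proof -
  have "(F has_derivative frechet_derivative F (at (t, x) within slab T)) (at (t, x) within slab T)"
    using assms(1) by (simp add: frechet_derivative_works)
  then have "(F has_derivative frechet_derivative F (at (t, x) within slab T)) (at (t, x) within Pair t ` UNIV)"
    by (rule has_derivative_subset) (use assms(2) in auto)
  moreover have "(Pair t has_derivative (\<lambda>h. (0, h))) (at x within UNIV)"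
    by (intro has_derivative_Pair has_derivative_ident has_derivative_const)
  ultimately show ?thesis by (rule has_derivative_in_compose[rotated])
qed

lemma Ck_slice:
  fixes F :: "real \<times> real \<times> real \<Rightarrow> 'b::euclidean_space"
  assumes "Ck_on k (slab T) F" "t \<in> {0..T}"
  shows "Ck_on k UNIV (\<lambda>x. F (t, x))"
  using assms
proof (induction k arbitrary: F)
  case 0
  then have "continuous_on (slab T) F" by simp
  then have "continuous_on UNIV (\<lambda>x. F (t, x))"
    by (rule continuous_on_compose2) (use 0 in \<open>auto intro!: continuous_on_Pair continuous_on_const continuous_on_id\<close>)
  then show ?case by simp
next
  case (Suc k)
  have d: "F differentiable (at (t, x) within slab T)" for x
    using Suc.prems unfolding Ck_on.simps by blast
  note D = slice_has_derivative[OF d Suc.prems(2)]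
  have "(\<lambda>x. F (t, x)) differentiable (at x)" for x using D by (rule differentiableI)
  moreover have "Ck_on k UNIV (\<lambda>x. frechet_derivative (\<lambda>x. F (t, x)) (at x) b)" if "b \<in> Basis" for b
  proof -
    have "(0, b) \<in> (Basis :: (real \<times> real \<times> real) set)" using that by (simp add: Basis_prod_def)
    then have "Ck_on k (slab T) (\<lambda>z. frechet_derivative F (at z within slab T) (0, b))"
      using Suc.prems(1) by simp
    from Suc.IH[OF this Suc.prems(2)] show ?thesis
      by (simp only: frechet_derivative_at[OF D, symmetric])
  qed
  ultimately show ?case by simp
qed

lemma Ck_inner:
  fixes f :: "real \<times> real \<Rightarrow> 'b::euclidean_space"
  assumes "Ck_on k UNIV f"
  shows "Ck_on k UNIV (\<lambda>x. f x \<bullet> c)"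
  using assms
proof (induction k arbitrary: f)
  case 0
  then show ?case by (auto intro: continuous_on_inner continuous_on_const)
next
  case (Suc k)
  have D: "((\<lambda>x. f x \<bullet> c) has_derivative (\<lambda>h. frechet_derivative f (at x) h \<bullet> c)) (at x)" for x
    by (rule has_derivative_inner_left) (use Suc.prems in \<open>simp add: frechet_derivative_works del: split_paired_All\<close>)
  have "(\<lambda>x. f x \<bullet> c) differentiable (at x)" for x using D by (rule differentiableI)
  moreover have "Ck_on k UNIV (\<lambda>x. frechet_derivative (\<lambda>x. f x \<bullet> c) (at x) b)" if "b \<in> Basis" for b
    unfolding frechet_derivative_at[OF D, symmetric] using Suc that by simp
  ultimately show ?case by simp
qed

lemma Cinf_inner:
  fixes f :: "real \<times> real \<Rightarrow> 'b::euclidean_space"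
  shows "Cinf_on UNIV f \<Longrightarrow> Cinf_on UNIV (\<lambda>x. f x \<bullet> c)"
  by (simp add: Cinf_on_def Ck_inner)

lemma test_function_slice:
  assumes "test_function L T \<phi>" "t \<in> {0..T}"
  shows "Cinf_on UNIV (\<phi> t)" "periodic L (\<phi> t)"
proof -
  show "periodic L (\<phi> t)" using assms by (simp add: test_function_def)
  show "Cinf_on UNIV (\<phi> t)"
    unfolding Cinf_on_def
  proof
    fix k
    have "Ck_on k (slab T) (\<lambda>(t, x). \<phi> t x)" using assms(1) unfolding test_function_def Cinf_on_def by blast
    from Ck_slice[OF this assms(2)] show "Ck_on k UNIV (\<phi> t)" by simp
  qed
qed

lemma integrable_time_interval: "integrable lborel (indicator {0..T::real} :: real \<Rightarrow> real)"
  by (rule integrable_real_indicator) (simp_all add: emeasure_lborel_Icc_eq)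

text \<open>
  The time derivative as a function of time and space jointly, which is continuous on the slab. At the end
  times it is one-sided, in agreement with the derivative used in the equations.
\<close>

definition slab_dt :: "real \<Rightarrow> (real \<Rightarrow> real \<times> real \<Rightarrow> 'b::euclidean_space) \<Rightarrow> real \<times> real \<times> real \<Rightarrow> 'b" where
  "slab_dt T \<phi> z = frechet_derivative (\<lambda>(t, x). \<phi> t x) (at z within slab T) (1, 0)"

lemma slab_dt:
  fixes \<phi> :: "real \<Rightarrow> real \<times> real \<Rightarrow> 'b::euclidean_space"
  assumes "test_function L T \<phi>" "T > 0"
  shows "continuous_on (slab T) (slab_dt T \<phi>)"
    and "t \<in> {0..T} \<Longrightarrow> ((\<lambda>s. \<phi> s x) has_vector_derivative slab_dt T \<phi> (t, x)) (at t within {0..T})"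
    and "t \<in> {0..T} \<Longrightarrow> time_deriv T \<phi> t x = slab_dt T \<phi> (t, x)"
proof -
  let ?F = "\<lambda>(t, x). \<phi> t x"
  have Ck: "Ck_on (Suc 0) (slab T) ?F" using assms(1) unfolding test_function_def Cinf_on_def by blast
  have "(1, 0) \<in> (Basis :: (real \<times> real \<times> real) set)" by (simp add: Basis_prod_def)
  with Ck show "continuous_on (slab T) (slab_dt T \<phi>)"
    unfolding slab_dt_def[abs_def] by (simp only: Ck_on.simps)
  show deriv: "((\<lambda>s. \<phi> s x) has_vector_derivative slab_dt T \<phi> (t, x)) (at t within {0..T})" if t: "t \<in> {0..T}" for t x
  proof -
    define D where "D = frechet_derivative ?F (at (t, x) within slab T)"
    have "?F differentiable (at (t, x) within slab T)"
      using Ck t unfolding Ck_on.simps by blast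
    then have FD: "(?F has_derivative D) (at (t, x) within slab T)"
      unfolding D_def by (simp only: frechet_derivative_works)
    then have "(?F has_derivative D) (at (t, x) within (\<lambda>s. (s, x)) ` {0..T})"
      by (rule has_derivative_subset) auto
    moreover have "((\<lambda>s. (s, x)) has_derivative (\<lambda>h. (h, 0))) (at t within {0..T})"
      by (intro has_derivative_Pair has_derivative_ident has_derivative_const)
    ultimately have "((\<lambda>s. ?F (s, x)) has_derivative (\<lambda>h. D (h, 0))) (at t within {0..T})"
      by (rule has_derivative_in_compose[rotated])
    moreover have "(\<lambda>h. D (h, 0)) = (\<lambda>h. h *\<^sub>R D (1, 0))"
    proof
      show "D (h, 0) = h *\<^sub>R D (1, 0)" for h
        using linear_scale[OF has_derivative_linear[OF FD], of h "(1, 0)"] by simp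
    qed
    ultimately show ?thesis
      by (simp only: has_vector_derivative_def slab_dt_def D_def[symmetric] split_conv)
  qed
  show "time_deriv T \<phi> t x = slab_dt T \<phi> (t, x)" if t: "t \<in> {0..T}"
    unfolding time_deriv_def
    by (rule vector_derivative_within_closed_interval[OF assms(2) t deriv[OF t]])
qed

text \<open>
  For a field that does not change in time, Fubini's theorem turns the time term of the weak formulation
  into the integral of \<open>\<partial>\<^sub>t \<phi>\<close> over time, that is, into \<open>\<phi>(T) - \<phi>(0)\<close>.
\<close>

theorem stationary_time_integral:
  fixes u :: "real \<times> real \<Rightarrow> 'b::euclidean_space"
  assumes L: "L > 0" and "T > 0" and u: "u \<in> L2 L" and \<phi>: "test_function L T \<phi>"
  shows "(LINT s:{0..T}|lebesgue. l2_inner L u (time_deriv T \<phi> s)) = - l2_inner L u (\<phi> 0)"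
proof -
  note [measurable] = L2_D[OF u]
  let ?D = "slab_dt T \<phi>"
  note D = slab_dt[OF \<phi> \<open>T > 0\<close>]
  define E where "E z = indicator (slab T) z *\<^sub>R ?D z" for z
  have "closed (slab T)" by (intro closed_Times closed_atLeastAtMost closed_UNIV)
  then have E [measurable]: "E \<in> borel_measurable borel"
    unfolding E_def[abs_def] by (intro borel_measurable_continuous_on_indicator D(1)) simp
  \<comment> \<open>Cut-offs in time and space make one integrand on the whole space-time, measurable although \<open>\<phi>\<close> is arbitrary outside the slab.\<close>
  define H where "H = (\<lambda>(s, x). indicator (cell L) x * (u x \<bullet> E (s, x)))"
  have H_meas: "H \<in> borel_measurable (lborel \<Otimes>\<^sub>M lborel)"
  proof -
    have "(\<lambda>z. indicator (cell L) (snd z) * (u (snd z) \<bullet> E z)) \<in> borel_measurable (borel \<Otimes>\<^sub>M borel)"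
      by (measurable; simp add: borel_prod)
    then show ?thesis by (simp add: H_def case_prod_beta')
  qed
  obtain B where B: "\<And>s x. s \<in> {0..T} \<Longrightarrow> x \<in> cell L \<Longrightarrow> norm (?D (s, x)) \<le> B"
  proof -
    have "bounded (?D ` ({0..T} \<times> cell L))"
      by (intro compact_imp_bounded compact_continuous_image compact_Times compact_cell compact_Icc
          continuous_on_subset[OF D(1)]) auto
    then obtain B where "\<forall>z\<in>{0..T} \<times> cell L. norm (?D z) \<le> B" by (auto simp: bounded_iff)
    then show ?thesis using that[of B] by blast
  qed
  have int_u: "integrable lborel (\<lambda>x. indicator (cell L) x * norm (u x))"
    using norm_integrable_L2[OF norm_in_L2(1)[OF u]] by (simp add: set_integrable_def)
  have H_bound: "norm (H (s, x)) \<le> \<bar>B\<bar> * (indicator {0..T} s * (indicator (cell L) x * norm (u x)))" for s x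
  proof (cases "s \<in> {0..T} \<and> x \<in> cell L")
    case True
    then have "\<bar>u x \<bullet> ?D (s, x)\<bar> \<le> norm (u x) * \<bar>B\<bar>"
      using B[of s x] by (intro order_trans[OF Cauchy_Schwarz_ineq2] mult_left_mono) auto
    then show ?thesis using True by (simp add: H_def E_def mult.commute)
  next
    case False
    then show ?thesis by (auto simp: H_def E_def indicator_def)
  qed
  have H_int: "integrable (lborel \<Otimes>\<^sub>M lborel) H"
  proof (rule Bochner_Integration.integrable_bound)
    let ?G = "\<lambda>(s, x). \<bar>B\<bar> * (indicator {0..T} s * (indicator (cell L) x * norm (u x)))"
    show "integrable (lborel \<Otimes>\<^sub>M lborel) ?G"
    proof (rule lborel_pair.Fubini_integrable)
      show "?G \<in> borel_measurable (lborel \<Otimes>\<^sub>M lborel)" by measurable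
      show "AE s in lborel. integrable lborel (\<lambda>x. ?G (s, x))" using int_u by simp
      have "(\<lambda>s. LINT x|lborel. norm (?G (s, x))) = (\<lambda>s. indicator {0..T} s * (\<bar>B\<bar> * (LINT x|lborel. indicator (cell L) x * norm (u x))))"
      proof
        show "(LINT x|lborel. norm (?G (s, x))) = indicator {0..T} s * (\<bar>B\<bar> * (LINT x|lborel. indicator (cell L) x * norm (u x)))" for s
          by (cases "s \<in> {0..T}") (simp_all add: abs_mult)
      qed
      then show "integrable lborel (\<lambda>s. LINT x|lborel. norm (?G (s, x)))"
        by (simp add: integrable_time_interval)
    qed
    show "AE z in lborel \<Otimes>\<^sub>M lborel. norm (H z) \<le> norm (?G z)"
    proof (rule AE_I2)
      show "norm (H z) \<le> norm (?G z)" for z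
        using order_trans[OF H_bound abs_ge_self, of "fst z" "snd z"] by (simp add: case_prod_beta')
    qed
  qed (rule H_meas)
  have inner_time: "(LINT s|lborel. H (s, x)) = - (indicator (cell L) x * (u x \<bullet> \<phi> 0 x))" for x
  proof -
    have "continuous_on {0..T} (\<lambda>s. ?D (s, x))"
      by (rule continuous_on_compose2[OF D(1)]) (auto intro!: continuous_intros)
    then have FTC: "has_bochner_integral lborel (\<lambda>s. indicator {0..T} s *\<^sub>R ?D (s, x)) (\<phi> T x - \<phi> 0 x)"
      using has_bochner_integral_FTC_Icc[of 0 T "\<lambda>s. \<phi> s x" "\<lambda>s. ?D (s, x)"] D(2) \<open>T > 0\<close> by auto
    have "H (s, x) = indicator (cell L) x * (u x \<bullet> (indicator {0..T} s *\<^sub>R ?D (s, x)))" for s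
      by (simp add: H_def E_def indicator_def)
    then have "(LINT s|lborel. H (s, x)) = indicator (cell L) x * (u x \<bullet> (LINT s|lborel. indicator {0..T} s *\<^sub>R ?D (s, x)))"
      using FTC by (simp add: has_bochner_integral_iff del: inner_scaleR_right)
    also have "(LINT s|lborel. indicator {0..T} s *\<^sub>R ?D (s, x)) = - \<phi> 0 x"
    proof -
      have "\<phi> T x = 0" using \<phi> unfolding test_function_def by blast
      then show ?thesis using FTC by (simp add: has_bochner_integral_iff)
    qed
    finally show ?thesis by simp
  qed
  have inner_space: "indicator {0..T} s *\<^sub>R l2_inner L u (time_deriv T \<phi> s) = (LINT x|lborel. H (s, x))" for s
  proof (cases "s \<in> {0..T}")
    case True
    then show ?thesis
      by (simp add: l2_inner_def set_lebesgue_integral_def H_def E_def D(3)[OF True])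
  next
    case False
    then show ?thesis by (simp add: H_def E_def)
  qed
  have "(LINT s:{0..T}|lebesgue. l2_inner L u (time_deriv T \<phi> s)) = (LINT s|lebesgue. (LINT x|lborel. H (s, x)))"
    unfolding set_lebesgue_integral_def inner_space ..
  also have "\<dots> = (LINT s|lborel. (LINT x|lborel. H (s, x)))"
  proof (rule integral_completion)
    show "(\<lambda>s. LINT x|lborel. H (s, x)) \<in> borel_measurable lborel"
      using H_meas by (intro lborel.borel_measurable_lebesgue_integral) (simp add: case_prod_beta')
  qed
  also have "\<dots> = (LINT x|lborel. (LINT s|lborel. H (s, x)))"
    using lborel_pair.Fubini_integral[of "\<lambda>s x. H (s, x)"] H_int by (simp add: case_prod_beta')
  also have "\<dots> = - l2_inner L u (\<phi> 0)"
    unfolding inner_time by (simp add: l2_inner_def set_lebesgue_integral_def)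
  finally show ?thesis .
qed

section \<open>Stationary solutions and the attractor\<close>

lemma set_integral_time_cong:
  fixes f g :: "real \<Rightarrow> real"
  assumes "\<And>s. s \<in> {0..T} \<Longrightarrow> f s = g s"
  shows "(LINT s:{0..T}|lebesgue. f s) = (LINT s:{0..T}|lebesgue. g s)"
  unfolding set_lebesgue_integral_def using assms
  by (intro Bochner_Integration.integral_cong) (auto simp: indicator_def)

context horizontal_profile
begin

text \<open>
  The first component of \<open>u\<close> and its derivative in \<open>x\<^sub>2\<close> vanish, which kills one summand each.
\<close>

lemma stationary_convection:
  assumes "\<Psi> \<in> borel_measurable borel"
  shows "l2_inner L (\<lambda>x. \<Sum>b\<in>Basis. (u x \<bullet> b) *\<^sub>R wpd L b u x) \<Psi> = 0"
proof -
  have "ae_eq (\<lambda>x. \<Sum>b\<in>Basis. (u x \<bullet> b) *\<^sub>R wpd L b u x) (\<lambda>x. 0)"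
    using uw wpd_u(4) unfolding ae_eq_def
    by eventually_elim (simp add: sum_Basis_plane)
  moreover have "(\<lambda>x. \<Sum>b\<in>Basis. (u x \<bullet> b) *\<^sub>R wpd L b u x) \<in> borel_measurable borel"
    unfolding sum_Basis_plane using L2_D[OF u] L2_D[OF wpd_u(1)] L2_D[OF wpd_u(3)] by measurable
  ultimately show ?thesis
    using l2_inner_cong_ae[OF _ L2_D[OF L2_zero] assms] by (simp add: l2_inner_zero_left)
qed

text \<open>
  Viscous and buoyancy forces balance: only \<open>\<partial>\<^sub>1 u\<^sub>2 = g/\<nu>\<close> survives, and \<open>-g' = \<theta>\<close>.
\<close>

lemma stationary_balance:
  assumes "Cinf_on UNIV \<Psi>" "periodic L \<Psi>"
  shows "\<nu> * (\<Sum>b\<in>Basis. l2_inner L (wpd L b u) (pd b \<Psi>)) = l2_inner L (\<lambda>x. \<theta> x *\<^sub>R (0, 1)) \<Psi>"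
proof -
  note C = Cinf_imp_C1[OF assms(1)]
  have meas: "pd b \<Psi> \<in> borel_measurable borel" if "b \<in> Basis" for b
    by (rule borel_measurable_continuous_onI[OF C1_pd_continuous[OF C that]])
  have "l2_inner L (wpd L (0, 1) u) (pd (0, 1) \<Psi>) = 0"
    using l2_inner_cong_ae[OF L2_D[OF wpd_u(3)] L2_D[OF L2_zero] meas[OF basis_memb(2)] wpd_u(4)]
    by (simp add: l2_inner_zero_left)
  moreover have "l2_inner L (wpd L (1, 0) u) (pd (1, 0) \<Psi>) = 1 / \<nu> * l2_inner L g (pd (1, 0) (\<lambda>x. \<Psi> x \<bullet> (0, 1)))"
  proof -
    have "l2_inner L (wpd L (1, 0) u) (pd (1, 0) \<Psi>) = l2_inner L (\<lambda>x. (0, 1 / \<nu> * g x)) (pd (1, 0) \<Psi>)"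
      by (rule l2_inner_cong_ae[OF L2_D[OF wpd_u(1)] L2_D[OF vertical_L2[OF g]] meas[OF basis_memb(1)] wpd_u(2)])
    also have "\<dots> = l2_inner L (\<lambda>x. (1 / \<nu>) *\<^sub>R g x) (pd (1, 0) (\<lambda>x. \<Psi> x \<bullet> (0, 1)))"
      unfolding l2_inner_def pd_inner[OF C] by (simp add: inner_prod_def)
    finally show ?thesis by (simp only: l2_inner_scaleR_left)
  qed
  moreover have "l2_inner L g (pd (1, 0) (\<lambda>x. \<Psi> x \<bullet> (0, 1))) = - l2_inner L (\<lambda>x. - \<theta> x) (\<lambda>x. \<Psi> x \<bullet> (0, 1))"
    by (rule has_weak_pd_inner[OF g\<theta> Cinf_inner[OF assms(1)] periodic_compose[OF assms(2)]])
  moreover have "l2_inner L (\<lambda>x. - \<theta> x) (\<lambda>x. \<Psi> x \<bullet> (0, 1)) = - l2_inner L (\<lambda>x. \<theta> x *\<^sub>R (0, 1)) \<Psi>"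
  proof -
    have "(\<theta> x *\<^sub>R (0, 1)) \<bullet> \<Psi> x = \<theta> x * (\<Psi> x \<bullet> (0, 1))" for x
      by (simp only: inner_scaleR_left inner_scaleR_right inner_commute)
    then show ?thesis
      by (simp add: l2_inner_def set_lebesgue_integral_def inner_commute[of "(0, 1)"] del: scaleR_Pair)
  qed
  ultimately show ?thesis using \<nu> by (simp add: sum_Basis_plane)
qed

text \<open>
  The product \<open>\<theta> u\<^sub>2\<close> is again a function of \<open>x\<^sub>1\<close> and is only paired with a derivative in \<open>x\<^sub>2\<close>.
\<close>

lemma stationary_transport:
  assumes "Cinf_on UNIV \<psi>" "periodic L \<psi>"
  shows "l2_inner L \<theta> (\<lambda>x. \<Sum>b\<in>Basis. (u x \<bullet> b) * pd b \<psi> x) = 0"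
proof -
  note C = Cinf_imp_C1[OF assms(1)]
  note [measurable] = L2_D[OF u] L2_D[OF \<theta>_L2] L2_D[OF w_L2]
    borel_measurable_continuous_onI[OF C1_pd_continuous[OF C basis_memb(1)]]
    borel_measurable_continuous_onI[OF C1_pd_continuous[OF C basis_memb(2)]]
  obtain h where h: "ae_eq \<theta> (\<lambda>x. h (fst x))" using \<theta> by (auto simp: L2_0H_def)
  obtain k where k: "ae_eq w (\<lambda>x. k (fst x))" using w by (auto simp: L2_0H_def)
  have "l2_inner L \<theta> (\<lambda>x. \<Sum>b\<in>Basis. (u x \<bullet> b) * pd b \<psi> x)
      = (LINT x:cell L|lborel. (1 / \<nu>) * ((\<theta> x * w x) * pd (0, 1) \<psi> x))"
    unfolding l2_inner_def set_lebesgue_integral_def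
  proof (rule integral_cong_AE)
    show "AE x in lborel. indicator (cell L) x *\<^sub>R (\<theta> x \<bullet> (\<Sum>b\<in>Basis. (u x \<bullet> b) * pd b \<psi> x))
        = indicator (cell L) x *\<^sub>R ((1 / \<nu>) * ((\<theta> x * w x) * pd (0, 1) \<psi> x))"
      using uw unfolding ae_eq_def by eventually_elim (simp add: sum_Basis_plane)
  qed (simp_all add: sum_Basis_plane)
  also have "\<dots> = (1 / \<nu>) * (LINT x:cell L|lborel. (\<theta> x * w x) * pd (0, 1) \<psi> x)"
    by (rule set_integral_mult_right)
  also have "(LINT x:cell L|lborel. (\<theta> x * w x) * pd (0, 1) \<psi> x) = 0"
  proof (rule integral_horizontal_pd[OF L C assms(2)])
    show "set_integrable lborel (cell L) (\<lambda>x. \<theta> x * w x)"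
      using inner_integrable_L2[OF \<theta>_L2 w_L2] by simp
    show "ae_eq (\<lambda>x. \<theta> x * w x) (\<lambda>x. h (fst x) * k (fst x))"
      using h k unfolding ae_eq_def by eventually_elim simp
  qed simp
  finally show ?thesis by simp
qed

theorem stationary_solution: "boussinesq_solution L \<nu> (u, \<theta>) (\<lambda>t. u) (\<lambda>t. \<theta>)"
  unfolding boussinesq_solution_def
proof (intro conjI allI impI)
  show "u \<in> Hsp L" by (rule u_Hsp)
  show "\<theta> \<in> L2_0 L" using \<theta> by (simp add: L2_0H_def)
  show "l2_continuous L (\<lambda>t. u)" "l2_continuous L (\<lambda>t. \<theta>)"
    by (simp_all add: l2_continuous_def l2_norm_zero)
  show "AE t in lebesgue. t \<in> {0..T} \<longrightarrow> u \<in> Vsp L" for T :: real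
    using u_Vsp by simp
  show "set_integrable lebesgue {0..T} (\<lambda>t. (h1_norm L u)\<^sup>2)" for T :: real
  proof -
    have "integrable lebesgue (indicator {0..T} :: real \<Rightarrow> real)"
      by (simp add: integrable_completion integrable_time_interval)
    then show ?thesis by (simp add: set_integrable_def)
  qed
  show "momentum_eq L \<nu> (fst (u, \<theta>)) (\<lambda>t. u) (\<lambda>t. \<theta>)"
    unfolding momentum_eq_def
  proof (intro allI impI)
    fix T :: real and \<Phi> :: "real \<Rightarrow> real \<times> real \<Rightarrow> real \<times> real"
    assume T: "T > 0" and tf: "test_function L T \<Phi> \<and> (\<forall>t\<in>{0..T}. \<forall>x. divergence (\<Phi> t) x = 0)"
    note \<Phi> = conjunct1[OF tf]
    have conv: "(LINT s:{0..T}|lebesgue. l2_inner L (\<lambda>x. \<Sum>b\<in>Basis. (u x \<bullet> b) *\<^sub>R wpd L b u x) (\<Phi> s)) = (LINT s:{0..T}|lebesgue. 0)"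
      by (intro set_integral_time_cong stationary_convection borel_measurable_continuous_onI C1_continuous
          Cinf_imp_C1 test_function_slice(1)[OF \<Phi>])
    have "(LINT s:{0..T}|lebesgue. l2_inner L (\<lambda>x. \<theta> x *\<^sub>R (0, 1)) (\<Phi> s))
        = (LINT s:{0..T}|lebesgue. \<nu> * (\<Sum>b\<in>Basis. l2_inner L (wpd L b u) (pd b (\<Phi> s))))"
      by (intro set_integral_time_cong stationary_balance[symmetric] test_function_slice[OF \<Phi>])
    also have "\<dots> = \<nu> * (LINT s:{0..T}|lebesgue. \<Sum>b\<in>Basis. l2_inner L (wpd L b u) (pd b (\<Phi> s)))"
      by (rule set_integral_mult_right)
    finally show "- (LINT s:{0..T}|lebesgue. l2_inner L u (time_deriv T \<Phi> s))
        + (LINT s:{0..T}|lebesgue. l2_inner L (\<lambda>x. \<Sum>b\<in>Basis. (u x \<bullet> b) *\<^sub>R wpd L b u x) (\<Phi> s))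
        - l2_inner L (fst (u, \<theta>)) (\<Phi> 0)
        = - \<nu> * (LINT s:{0..T}|lebesgue. \<Sum>b\<in>Basis. l2_inner L (wpd L b u) (pd b (\<Phi> s)))
          + (LINT s:{0..T}|lebesgue. l2_inner L (\<lambda>x. \<theta> x *\<^sub>R (0, 1)) (\<Phi> s))"
      unfolding conv stationary_time_integral[OF L T u \<Phi>] by simp
  qed
  show "transport_eq L (snd (u, \<theta>)) (\<lambda>t. u) (\<lambda>t. \<theta>)"
    unfolding transport_eq_def
  proof (intro allI impI)
    fix T :: real and \<phi> :: "real \<Rightarrow> real \<times> real \<Rightarrow> real"
    assume T: "T > 0" and \<phi>: "test_function L T \<phi>"
    have "(LINT s:{0..T}|lebesgue. - l2_inner L \<theta> (\<lambda>x. \<Sum>b\<in>Basis. (u x \<bullet> b) * pd b (\<phi> s) x)) = (LINT s:{0..T}|lebesgue. 0)"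
      using stationary_transport[OF test_function_slice[OF \<phi>]] by (intro set_integral_time_cong) simp
    then show "- (LINT s:{0..T}|lebesgue. l2_inner L \<theta> (time_deriv T \<phi> s))
        + (LINT s:{0..T}|lebesgue. - l2_inner L \<theta> (\<lambda>x. \<Sum>b\<in>Basis. (u x \<bullet> b) * pd b (\<phi> s) x)) = l2_inner L (snd (u, \<theta>)) (\<phi> 0)"
      unfolding stationary_time_integral[OF L T \<theta>_L2 \<phi>] by simp
  qed
qed

text \<open>
  The stationary point is reached from itself at every time, so it lies in every set whose closures are
  intersected.
\<close>

lemma profile_in_attractor:
  assumes "l2_norm L \<theta> \<le> r"
  shows "(u, \<theta>) \<in> local_attractor L \<nu> r"
proof -
  have \<theta>0: "\<theta> \<in> L2_0 L" using \<theta> by (simp add: L2_0H_def)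
  have "l2_norm L u \<le> 2 * r / (\<nu> * lambda1 L)"
  proof -
    have "\<nu> * (2 * pi / L)\<^sup>2 > 0" using L \<nu> by simp
    then have "l2_norm L \<theta> / (\<nu> * (2 * pi / L)\<^sup>2) \<le> 2 * r / (\<nu> * (2 * pi / L)\<^sup>2)"
      using assms l2_norm_nonneg[of L \<theta>] by (intro divide_right_mono) auto
    then show ?thesis using u_norm_bound by (simp only: lambda1_eq[OF L])
  qed
  then have B: "(u, \<theta>) \<in> Bset L \<nu> r" using u_Hsp \<theta>0 assms by (simp add: Bset_def)
  have flow: "(u, \<theta>) \<in> boussinesq_flow L \<nu> t (u, \<theta>)" for t
    unfolding boussinesq_flow_def
    by (rule CollectI, rule exI[of _ "\<lambda>t. u"], rule exI[of _ "\<lambda>t. \<theta>"]) (simp add: stationary_solution)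
  have top: "(u, \<theta>) \<in> topspace (weak_topology L)"
  proof -
    have z: "(\<lambda>x. 0) \<in> Hsp L" "(\<lambda>x. 0) \<in> L2_0 L"
      using solenoidal_in_Hsp[OF L solenoidal_trig_zero] L2_zero by (auto simp: L2_0_def mean_free_def)
    have "(u, \<theta>) \<in> {(u, \<theta>). u \<in> Hsp L \<and> \<theta> \<in> L2_0 L \<and> l2_inner L u (\<lambda>x. 0) + l2_inner L \<theta> (\<lambda>x. 0) \<in> UNIV}"
      using u_Hsp \<theta>0 by simp
    then show ?thesis
      unfolding weak_topology_def topology_generated_by_topspace
      by (rule UnionI[rotated])
        (rule CollectI, rule exI[of _ "\<lambda>x. 0"], rule exI[of _ "\<lambda>x. 0"], rule exI[of _ UNIV], use z in simp)
  qed
  show ?thesis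
    unfolding local_attractor_def
  proof (rule INT_I)
    fix \<tau> :: real
    have "(u, \<theta>) \<in> (\<Union>t\<in>{\<tau><..}. \<Union>z0\<in>Bset L \<nu> r. boussinesq_flow L \<nu> t z0)"
      using B flow by (intro UN_I[of "\<tau> + 1"] UN_I[of "(u, \<theta>)"]) auto
    then have "(u, \<theta>) \<in> topspace (weak_topology L) \<inter> (\<Union>t\<in>{\<tau><..}. \<Union>z0\<in>Bset L \<nu> r. boussinesq_flow L \<nu> t z0)"
      using top by (rule IntI[rotated])
    then show "(u, \<theta>) \<in> weak_topology L closure_of (\<Union>t\<in>{\<tau><..}. \<Union>z0\<in>Bset L \<nu> r. boussinesq_flow L \<nu> t z0)"
      by (rule subsetD[OF closure_of_subset_Int])
  qed
qed

end

theorem mainTheorem3: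
  fixes L \<nu> r :: real
  assumes L: "L > 0" and "\<nu> > 0" and "r > 0"
  shows "infinite_dim_hilbert_ellipsoid L (EH L \<nu> r)
       \<and> EH L \<nu> r \<subseteq> fst ` local_attractor L \<nu> r"
proof
  show "infinite_dim_hilbert_ellipsoid L (EH L \<nu> r)" by (rule EH_ellipsoid[OF assms])
  show "EH L \<nu> r \<subseteq> fst ` local_attractor L \<nu> r"
  proof
    fix u assume "u \<in> EH L \<nu> r"
    then obtain \<theta> w g where "horizontal_profile L \<nu> \<theta> w g u" "l2_norm L \<theta> \<le> r"
      using EH_profileD[OF assms(1,2)] by blast
    then have "(u, \<theta>) \<in> local_attractor L \<nu> r" by (rule horizontal_profile.profile_in_attractor)
    then show "u \<in> fst ` local_attractor L \<nu> r" by force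
  qed
qed

end
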